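(* Let $d\in\{2,3\}$, $k\ge 1$, let $\mathcal{T}_h$ be a shape-regular polytopal partition of $\Omega\subset\mathbb{R}^d$, let $\mu>0$, $\lambda\ge 0$, $\mathbf{f}\in[L^2(\Omega)]^d$ and $\mathbf{g}\in[L^2(\partial\Omega)]^d$. With the spaces $W_h$, $W_h^0$, $V_h$, the discrete weak operators $\epsilon_w$, $\nabla_w\cdot$, the form $a$ and the stabilizers $s_1,s_2$ defined in the context, the least-squares weak Galerkin scheme: find $\mathbf{u}_h=\{\mathbf{u}_0,\mathbf{u}_b\}\in W_h$ and $\sigma_h=\{\sigma_0,\sigma_b\}\in V_h$ such that $\mathbf{u}_b=Q_b\mathbf{g}$ on $\partial\Omega$ and $$a((\mathbf{u}_h,\mathbf{v}),(\sigma_h,\delta))+s_1(\mathbf{u}_h,\mathbf{v})+s_2(\sigma_h,\delta)=\sum_{T\in\mathcal{T}_h}(-\mathbf{f},\nabla_w\cdot\delta)_T\qquad\text{for all }\mathbf{v}\in W_h^0,\ \delta\in V_h,$$ has a unique solution $(\mathbf{u}_h,\sigma_h)$.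
   Context: **Domain and mesh.** $\Omega\subset\mathbb{R}^d$ ($d=2,3$) is open, bounded, connected, with Lipschitz boundary. $\mathcal{T}_h$ is a partition of $\Omega$ into polytopal (polygonal/polyhedral) elements $T$; $\mathcal{E}_h$ is the set of all its edges ($d=2$) / faces ($d=3$), and $\mathcal{E}_h^0=\mathcal{E}_h\setminus\partial\Omega$ the interior ones, each being shared by two elements. $h_T$ is the diameter of $T$, $h=\max_T h_T$, and $\mathbf{n}$ is the unit outward normal to $\partial T$. $(\cdot,\cdot)_T$ and $\langle\cdot,\cdot\rangle_{\partial T}$ are the $L^2$ inner products on $T$ and $\partial T$ (for scalar, vector or matrix functions). **Shape regularity** (Wang–Ye): there are fixed positive constants such that, for every $T\in\mathcal{T}_h$ and every edge/face $e\subset\partial T$ with diameter $h_e$: (A1) $|T|\ge\rho_v h_T^d$ and $|e|\ge\rho_e h_e^{d-1}$; (A2) $\kappa h_T\le h_e$; (A3) there is a pyramid contained in $T$ with base $e$, apex $A_e\in T$ and height $\sigma_e h_T$ with $\sigma_e\ge\sigma^*>0$, such that the angle between $x_e-A_e$ and the outward normal of $e$ is at most $\theta_0<\pi/2$ for all $x_e\in e$; (A4) $T$ has a circumscribed shape-regular simplex $S(T)$ with diameter at most $\gamma^* h_T$, and each such simplex intersects only a uniformly bounded number of the simplices circumscribing the other elements. **Elasticity.** $\mu,\lambda$ are the Lamé constants and $I$ is the $d\times d$ identity matrix. The scheme discretizes the first-order system $-\nabla\cdot\sigma=\mathbf{f}$ and $\sigma-2\mu\epsilon(\mathbf{u})-\lambda(\nabla\cdot\mathbf{u})I=0$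 in $\Omega$, $\mathbf{u}=\mathbf{g}$ on $\partial\Omega$, where $\epsilon(\mathbf{u})=\frac12(\nabla\mathbf{u}+\nabla\mathbf{u}^T)$. **Weak finite element spaces.** $P_k(T)$, $P_k(e)$ denote polynomials of total degree at most $k$ on $T$, $e$. - $W_h$: pairs $\mathbf{v}=\{\mathbf{v}_0,\mathbf{v}_b\}$ with $\mathbf{v}_0|_T\in[P_k(T)]^d$ for each $T\in\mathcal{T}_h$ and $\mathbf{v}_b|_e\in[P_k(e)]^d$ for each $e\in\mathcal{E}_h$, with $\mathbf{v}_b$ single-valued on each interior edge/face. $\mathbf{v}_b$ is not required to be the trace of $\mathbf{v}_0$. - $W_h^0=\{\mathbf{v}\in W_h:\mathbf{v}_b=0\text{ on }\partial\Omega\}$. - $V_h$: pairs $\sigma=\{\sigma_0,\sigma_b\}$ with $\sigma_0|_T\in[P_k(T)]^{d\times d}$ for each $T$ and $\sigma_b|_e\in[P_k(e)]^{d\times d}$ for each $e$, with $\sigma_b$ single-valued on each interior edge/face. No symmetry is imposed. $Q_b$ is the (componentwise) $L^2$ projection onto $P_k(e)$ on each edge/face $e$. **Discrete weak operators**, computed on each $T\in\mathcal{T}_h$: - For $\mathbf{v}\in W_h$, $\epsilon_w(\mathbf{v})|_T\in[P_k(T)]^{d\times d}$ is the unique polynomial matrix with $(\epsilon_w(\mathbf{v}),\boldsymbol\varphi)_T=-(\mathbf{v}_0,\nabla\cdot\tfrac12(\boldsymbol\varphi+\boldsymbol\varphi^T))_T+\langle\mathbf{v}_b,\tfrac12(\boldsymbol\varphi+\boldsymbol\varphi^T)\cdot\mathbf{n}\rangle_{\partial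 T}$ for all $\boldsymbol\varphi\in[P_k(T)]^{d\times d}$. - For $\mathbf{v}\in W_h$, $(\nabla_w\cdot\mathbf{v})|_T\in P_k(T)$ is the unique polynomial with $(\nabla_w\cdot\mathbf{v},\phi)_T=-(\mathbf{v}_0,\nabla\phi)_T+\langle\mathbf{v}_b\cdot\mathbf{n},\phi\rangle_{\partial T}$ for all $\phi\in P_k(T)$. - For $\sigma\in V_h$, $(\nabla_w\cdot\sigma)|_T\in[P_k(T)]^d$ is the unique polynomial vector with $(\nabla_w\cdot\sigma,\mathbf{w})_T=-(\sigma_0,\nabla\mathbf{w})_T+\langle\sigma_b\cdot\mathbf{n},\mathbf{w}\rangle_{\partial T}$ for all $\mathbf{w}\in[P_k(T)]^d$. **Forms.** For $\mathbf{u},\mathbf{v}\in W_h$ and $\sigma,\delta\in V_h$: $$a((\mathbf{u},\mathbf{v}),(\sigma,\delta))=\sum_{T\in\mathcal{T}_h}\Big[(\nabla_w\cdot\sigma,\nabla_w\cdot\delta)_T+\big(\sigma_0-2\mu\epsilon_w(\mathbf{u})-\lambda(\nabla_w\cdot\mathbf{u})I,\ \delta_0-2\mu\epsilon_w(\mathbf{v})-\lambda(\nabla_w\cdot\mathbf{v})I\big)_T\Big],$$ $$s_1(\mathbf{u},\mathbf{v})=\sum_{T\in\mathcal{T}_h}h_T^{-1}\langle\mathbf{u}_0-\mathbf{u}_b,\mathbf{v}_0-\mathbf{v}_b\rangle_{\partial T},\qquad s_2(\sigma,\delta)=\sum_{T\in\mathcal{T}_h}h_T^{-1}\langle\sigma_0-\sigma_b,\delta_0-\delta_b\rangle_{\partial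 T}.$$ *)

theory Defs
  imports "HOL-Analysis.Analysis"
begin

section \<open>Domain\<close>

text \<open>Near each boundary point, and in coordinates whose last axis points along a unit vector
  \<open>\<nu>\<close>, the set is the strict epigraph of a Lipschitz function of the remaining coordinates; the
  latter are represented by the points of the hyperplane orthogonal to \<open>\<nu>\<close>.\<close>

definition lipschitz_boundary :: "(real^'d) set \<Rightarrow> bool" where
  "lipschitz_boundary \<Omega> \<longleftrightarrow>
     (\<forall>x\<in>frontier \<Omega>. \<exists>r>0. \<exists>\<nu> \<gamma> L. norm \<nu> = 1 \<and> L-lipschitz_on {z. z \<bullet> \<nu> = 0} \<gamma> \<and>
        \<Omega> \<inter> ball x r = {y \<in> ball x r. \<gamma> (y - (y \<bullet> \<nu>) *\<^sub>R \<nu>) < y \<bullet> \<nu>})"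

definition lipschitz_domain :: "(real^'d) set \<Rightarrow> bool" where
  "lipschitz_domain \<Omega> \<longleftrightarrow>
     open \<Omega> \<and> \<Omega> \<noteq> {} \<and> bounded \<Omega> \<and> connected \<Omega> \<and> lipschitz_boundary \<Omega>"


section \<open>Polytopal meshes\<close>

text \<open>A not necessarily convex flat polytope of dimension \<open>m\<close>: a finite union of convex polytopes
  of dimension \<open>m\<close> in one \<open>m\<close>-dimensional affine subspace, with connected (relative) interior.\<close>

definition polytopal :: "nat \<Rightarrow> (real^'d) set \<Rightarrow> bool" where
  "polytopal m S \<longleftrightarrow>
     aff_dim S = int m \<and> connected (rel_interior S) \<and>
     (\<exists>\<P>. finite \<P> \<and> (\<forall>P\<in>\<P>. polytope P \<and> aff_dim P = int m) \<and> S = \<Union>\<P>)"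

text \<open>The edges/faces of a mesh that make up the boundary of the element \<open>T\<close>.\<close>

definition faces_of :: "(real^'d) set set \<Rightarrow> (real^'d) set \<Rightarrow> (real^'d) set set" where
  "faces_of Es T = {e \<in> Es. e \<subseteq> frontier T}"

definition boundary_faces :: "(real^'d) set \<Rightarrow> (real^'d) set set \<Rightarrow> (real^'d) set set" where
  "boundary_faces \<Omega> Es = {e \<in> Es. e \<subseteq> frontier \<Omega>}"

text \<open>Elements and faces are closed sets. Coplanar neighbouring faces of an element (hanging nodes)
  are allowed.\<close>

definition polytopal_mesh ::
    "(real^'d) set \<Rightarrow> (real^'d) set set \<Rightarrow> (real^'d) set set \<Rightarrow> bool" where
  "polytopal_mesh \<Omega> Ts Es \<longleftrightarrow>
     finite Ts \<and> (\<forall>T\<in>Ts. polytopal CARD('d) T) \<and> \<Union>Ts = closure \<Omega> \<and>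
     pairwise (\<lambda>T T'. interior T \<inter> interior T' = {}) Ts \<and>
     finite Es \<and> (\<forall>e\<in>Es. polytopal (CARD('d) - 1) e) \<and>
     pairwise (\<lambda>e e'. rel_interior e \<inter> rel_interior e' = {}) Es \<and>
     (\<forall>T\<in>Ts. frontier T = \<Union>(faces_of Es T)) \<and>
     (\<forall>e\<in>Es. \<exists>T\<in>Ts. e \<in> faces_of Es T) \<and>
     (\<forall>e \<in> Es - boundary_faces \<Omega> Es. card {T\<in>Ts. e \<in> faces_of Es T} = 2)"

text \<open>Unit outward normal of \<open>T\<close> at a point near which \<open>T\<close> is a half space.\<close>

definition outward_normal_at :: "(real^'d) set \<Rightarrow> real^'d \<Rightarrow> real^'d \<Rightarrow> bool" where
  "outward_normal_at T x \<nu> \<longleftrightarrow>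
     norm \<nu> = 1 \<and> (\<exists>r>0. T \<inter> ball x r = {y \<in> ball x r. (y - x) \<bullet> \<nu> \<le> 0})"

text \<open>The normal is constant along a face \<open>e\<close> of \<open>T\<close> as soon as \<open>T\<close> contains a pyramid over \<open>e\<close>
  (condition (A3) below), since \<open>T\<close> then lies on the same side of \<open>e\<close> along all of \<open>e\<close>. Not every
  relative interior point of \<open>e\<close> need be a smooth boundary point of \<open>T\<close>, because \<open>T\<close> may touch
  itself there in a set of lower dimension.\<close>

definition face_normal :: "(real^'d) set \<Rightarrow> (real^'d) set \<Rightarrow> real^'d" where
  "face_normal T e = (SOME \<nu>. \<exists>x\<in>rel_interior e. outward_normal_at T x \<nu>)"

text \<open>Lebesgue measure of dimension \<open>d - 1\<close> on a subset \<open>e\<close> of a hyperplane of \<open>d\<close>-space, as a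
  measure on the whole space that is concentrated on \<open>e\<close>. The area of a subset of \<open>e\<close> is the
  volume of the right prism of total height 1 over it, so the measure is the push-forward, under
  the orthogonal projection onto the hyperplane, of the volume restricted to the prism over \<open>e\<close>.\<close>

definition prism :: "(real^'d) set \<Rightarrow> (real^'d) set" where
  "prism e = {y. closest_point (affine hull e) y \<in> e \<and>
                 dist y (closest_point (affine hull e) y) \<le> 1/2}"

definition face_measure :: "(real^'d) set \<Rightarrow> (real^'d) measure" where
  "face_measure e =
     completion (distr (restrict_space lborel (prism e)) borel (closest_point (affine hull e)))"

definition pyramid :: "real^'d \<Rightarrow> (real^'d) set \<Rightarrow> (real^'d) set" where
  "pyramid A e = {(1 - t) *\<^sub>R A + t *\<^sub>R x | t x. 0 \<le> t \<and> t \<le> 1 \<and> x \<in> e}"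

definition angle :: "real^'d \<Rightarrow> real^'d \<Rightarrow> real" where
  "angle u v = arccos (u \<bullet> v / (norm u * norm v))"

text \<open>Conditions (A1)--(A4) of Wang and Ye, in this order. The constant \<open>\<rho>\<^sub>S\<close> bounds the ratio of the
  diameter of a circumscribed simplex to the radius of a ball it contains, which is what
  shape-regular means for a simplex. \<open>N\<close> bounds the number of intersections in (A4).\<close>

definition shape_regular ::
    "real \<Rightarrow> real \<Rightarrow> real \<Rightarrow> real \<Rightarrow> real \<Rightarrow> real \<Rightarrow> real \<Rightarrow> nat
      \<Rightarrow> (real^'d) set set \<Rightarrow> (real^'d) set set \<Rightarrow> bool" where
  "shape_regular \<rho>\<^sub>v \<rho>\<^sub>e \<kappa> \<sigma>\<^sub>s \<theta>\<^sub>0 \<gamma>\<^sub>s \<rho>\<^sub>S N Ts Es \<longleftrightarrow>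
     0 < \<rho>\<^sub>v \<and> 0 < \<rho>\<^sub>e \<and> 0 < \<kappa> \<and> 0 < \<sigma>\<^sub>s \<and> 0 < \<theta>\<^sub>0 \<and> \<theta>\<^sub>0 < pi/2 \<and> 0 < \<gamma>\<^sub>s \<and> 0 < \<rho>\<^sub>S \<and>
     (\<forall>T\<in>Ts. measure lebesgue T \<ge> \<rho>\<^sub>v * diameter T ^ CARD('d) \<and>
        (\<forall>e\<in>faces_of Es T. measure (face_measure e) e \<ge> \<rho>\<^sub>e * diameter e ^ (CARD('d) - 1))) \<and>
     (\<forall>T\<in>Ts. \<forall>e\<in>faces_of Es T. \<kappa> * diameter T \<le> diameter e) \<and>
     (\<forall>T\<in>Ts. \<forall>e\<in>faces_of Es T. \<exists>A\<in>T. \<exists>\<sigma>\<^sub>e\<ge>\<sigma>\<^sub>s.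
        pyramid A e \<subseteq> T \<and> infdist A (affine hull e) = \<sigma>\<^sub>e * diameter T \<and>
        (\<forall>x\<in>e. angle (x - A) (face_normal T e) \<le> \<theta>\<^sub>0)) \<and>
     (\<exists>S. \<forall>T\<in>Ts.
        int CARD('d) simplex S T \<and> T \<subseteq> S T \<and> diameter (S T) \<le> \<gamma>\<^sub>s * diameter T \<and>
        (\<exists>z r. 0 < r \<and> ball z r \<subseteq> S T \<and> diameter (S T) \<le> \<rho>\<^sub>S * r) \<and>
        card {T' \<in> Ts - {T}. S T' \<inter> S T \<noteq> {}} \<le> N)"


section \<open>Polynomials and weak finite element spaces\<close>

text \<open>Polynomials of total degree at most \<open>k\<close> in \<open>d\<close> variables, with coefficients in a real vector
  space. For vector or matrix coefficients these are the functions all of whose components are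
  such polynomials.\<close>

definition poly_fun :: "nat \<Rightarrow> (real^'d \<Rightarrow> 'v::real_vector) \<Rightarrow> bool" where
  "poly_fun k p \<longleftrightarrow>
     (\<exists>c. \<forall>x. p x = (\<Sum>\<alpha> \<in> {\<alpha> :: 'd \<Rightarrow> nat. sum \<alpha> UNIV \<le> k}. (\<Prod>i\<in>UNIV. x $ i ^ \<alpha> i) *\<^sub>R c \<alpha>))"

lemma finite_multi_indices: "finite {\<alpha> :: 'd::finite \<Rightarrow> nat. sum \<alpha> UNIV \<le> k}"
proof (rule finite_subset)
  show "{\<alpha> :: 'd \<Rightarrow> nat. sum \<alpha> UNIV \<le> k} \<subseteq> (UNIV :: 'd set) \<rightarrow>\<^sub>E {..k}"
    by (auto simp: PiE_UNIV_domain) (meson UNIV_I finite le_trans member_le_sum zero_le)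
qed (simp add: finite_PiE)

text \<open>The space \<open>P\<^sub>k(S)\<close>, as functions on \<open>S\<close> (undefined elsewhere). For a face \<open>S\<close>, a polynomial in
  \<open>d - 1\<close> coordinates of its hyperplane is the restriction of one in \<open>d\<close> variables of the same
  degree, and conversely.\<close>

definition poly_space :: "nat \<Rightarrow> (real^'d) set \<Rightarrow> (real^'d \<Rightarrow> 'v::real_vector) set" where
  "poly_space k S = {restrict p S | p. poly_fun k p}"

text \<open>A weak function is a pair: a family of functions indexed by the elements and a family
  indexed by the edges/faces. The second component is single-valued because it is indexed by
  the face alone.\<close>

type_synonym ('d, 'v) weak_fun =
  "((real^'d) set \<Rightarrow> real^'d \<Rightarrow> 'v) \<times> ((real^'d) set \<Rightarrow> real^'d \<Rightarrow> 'v)"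

definition weak_space ::
    "nat \<Rightarrow> (real^'d) set set \<Rightarrow> (real^'d) set set \<Rightarrow> ('d, 'v::real_vector) weak_fun set" where
  "weak_space k Ts Es = (\<Pi>\<^sub>E T\<in>Ts. poly_space k T) \<times> (\<Pi>\<^sub>E e\<in>Es. poly_space k e)"

definition W_h ::
    "nat \<Rightarrow> (real^'d) set set \<Rightarrow> (real^'d) set set \<Rightarrow> ('d, real^'d) weak_fun set" where
  "W_h k Ts Es = weak_space k Ts Es"

definition W_h0 ::
    "nat \<Rightarrow> (real^'d) set \<Rightarrow> (real^'d) set set \<Rightarrow> (real^'d) set set
      \<Rightarrow> ('d, real^'d) weak_fun set" where
  "W_h0 k \<Omega> Ts Es = {v \<in> W_h k Ts Es. \<forall>e\<in>boundary_faces \<Omega> Es. \<forall>x\<in>e. snd v e x = 0}"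

definition V_h ::
    "nat \<Rightarrow> (real^'d) set set \<Rightarrow> (real^'d) set set \<Rightarrow> ('d, real^'d^'d) weak_fun set" where
  "V_h k Ts Es = weak_space k Ts Es"


section \<open>Inner products and projections\<close>

definition square_integrable :: "'a measure \<Rightarrow> ('a \<Rightarrow> 'v::euclidean_space) \<Rightarrow> bool" where
  "square_integrable M f \<longleftrightarrow> f \<in> borel_measurable M \<and> integrable M (\<lambda>x. (norm (f x))\<^sup>2)"

text \<open>For matrices, \<open>\<bullet>\<close> is the Frobenius inner product.\<close>

definition elem_inner ::
    "(real^'d) set \<Rightarrow> (real^'d \<Rightarrow> 'v::euclidean_space) \<Rightarrow> (real^'d \<Rightarrow> 'v) \<Rightarrow> real" where
  "elem_inner T f g = (\<integral>x. f x \<bullet> g x \<partial>lebesgue_on T)"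

definition face_inner ::
    "(real^'d) set \<Rightarrow> (real^'d \<Rightarrow> 'v::euclidean_space) \<Rightarrow> (real^'d \<Rightarrow> 'v) \<Rightarrow> real" where
  "face_inner e f g = (\<integral>x. f x \<bullet> g x \<partial>face_measure e)"

text \<open>The inner product on the boundary of \<open>T\<close>, for functions given face by face.\<close>

definition bdry_inner ::
    "(real^'d) set set \<Rightarrow> (real^'d) set \<Rightarrow> ((real^'d) set \<Rightarrow> real^'d \<Rightarrow> 'v::euclidean_space)
      \<Rightarrow> ((real^'d) set \<Rightarrow> real^'d \<Rightarrow> 'v) \<Rightarrow> real" where
  "bdry_inner Es T f g = (\<Sum>e\<in>faces_of Es T. face_inner e (f e) (g e))"

definition L2_proj :: "nat \<Rightarrow> (real^'d) set \<Rightarrow> (real^'d \<Rightarrow> real) \<Rightarrow> (real^'d \<Rightarrow> real)" where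
  "L2_proj k e g =
     (THE q. q \<in> poly_space k e \<and> (\<forall>p. poly_fun k p \<longrightarrow> face_inner e q p = face_inner e g p))"

definition Q_b :: "nat \<Rightarrow> (real^'d) set \<Rightarrow> (real^'d \<Rightarrow> real^'d) \<Rightarrow> (real^'d \<Rightarrow> real^'d)" where
  "Q_b k e g = (\<lambda>x\<in>e. \<chi> i. L2_proj k e (\<lambda>y. g y $ i) x)"


section \<open>Differential operators\<close>

text \<open>Row convention: \<open>(\<nabla>w)\<^sub>i\<^sub>j = \<partial>\<^sub>j w\<^sub>i\<close>, and the divergence of a matrix is taken along its rows, as is
  the product \<open>\<phi> *v n\<close>.\<close>

definition partial :: "'d \<Rightarrow> (real^'d \<Rightarrow> real) \<Rightarrow> real^'d \<Rightarrow> real" where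
  "partial j f x = frechet_derivative f (at x) (axis j 1)"

definition grad :: "(real^'d \<Rightarrow> real) \<Rightarrow> real^'d \<Rightarrow> real^'d" where
  "grad f x = (\<chi> j. partial j f x)"

definition grad_vec :: "(real^'d \<Rightarrow> real^'d) \<Rightarrow> real^'d \<Rightarrow> real^'d^'d" where
  "grad_vec w x = (\<chi> i j. partial j (\<lambda>y. w y $ i) x)"

definition div_mat :: "(real^'d \<Rightarrow> real^'d^'d) \<Rightarrow> real^'d \<Rightarrow> real^'d" where
  "div_mat \<phi> x = (\<chi> i. \<Sum>j\<in>UNIV. partial j (\<lambda>y. \<phi> y $ i $ j) x)"

definition sym_part :: "real^'d^'d \<Rightarrow> real^'d^'d" where
  "sym_part A = (1/2) *\<^sub>R (A + transpose A)"


section \<open>Discrete weak operators\<close>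

definition weak_strain ::
    "nat \<Rightarrow> (real^'d) set set \<Rightarrow> ('d, real^'d) weak_fun \<Rightarrow> (real^'d) set \<Rightarrow> real^'d \<Rightarrow> real^'d^'d"
  where
  "weak_strain k Es v T =
     (THE p. p \<in> poly_space k T \<and>
        (\<forall>\<phi>. poly_fun k \<phi> \<longrightarrow>
           elem_inner T p \<phi> =
             - elem_inner T (fst v T) (div_mat (\<lambda>y. sym_part (\<phi> y)))
             + bdry_inner Es T (snd v) (\<lambda>e x. sym_part (\<phi> x) *v face_normal T e)))"

definition weak_div ::
    "nat \<Rightarrow> (real^'d) set set \<Rightarrow> ('d, real^'d) weak_fun \<Rightarrow> (real^'d) set \<Rightarrow> real^'d \<Rightarrow> real" where
  "weak_div k Es v T =
     (THE p. p \<in> poly_space k T \<and>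
        (\<forall>\<phi>. poly_fun k \<phi> \<longrightarrow>
           elem_inner T p \<phi> =
             - elem_inner T (fst v T) (grad \<phi>)
             + bdry_inner Es T (\<lambda>e x. snd v e x \<bullet> face_normal T e) (\<lambda>e. \<phi>)))"

definition weak_div_mat ::
    "nat \<Rightarrow> (real^'d) set set \<Rightarrow> ('d, real^'d^'d) weak_fun \<Rightarrow> (real^'d) set \<Rightarrow> real^'d \<Rightarrow> real^'d"
  where
  "weak_div_mat k Es \<sigma> T =
     (THE p. p \<in> poly_space k T \<and>
        (\<forall>w. poly_fun k w \<longrightarrow>
           elem_inner T p w =
             - elem_inner T (fst \<sigma> T) (grad_vec w)
             + bdry_inner Es T (\<lambda>e x. snd \<sigma> e x *v face_normal T e) (\<lambda>e. w)))"


section \<open>The least-squares weak Galerkin scheme\<close>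

definition residual ::
    "nat \<Rightarrow> (real^'d) set set \<Rightarrow> real \<Rightarrow> real \<Rightarrow> ('d, real^'d) weak_fun \<Rightarrow> ('d, real^'d^'d) weak_fun
      \<Rightarrow> (real^'d) set \<Rightarrow> real^'d \<Rightarrow> real^'d^'d" where
  "residual k Es \<mu> lam u \<sigma> T x =
     fst \<sigma> T x - (2 * \<mu>) *\<^sub>R weak_strain k Es u T x - (lam * weak_div k Es u T x) *\<^sub>R mat 1"

definition a_form ::
    "nat \<Rightarrow> (real^'d) set set \<Rightarrow> (real^'d) set set \<Rightarrow> real \<Rightarrow> real
      \<Rightarrow> ('d, real^'d) weak_fun \<Rightarrow> ('d, real^'d) weak_fun
      \<Rightarrow> ('d, real^'d^'d) weak_fun \<Rightarrow> ('d, real^'d^'d) weak_fun \<Rightarrow> real" where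
  "a_form k Ts Es \<mu> lam u v \<sigma> \<delta> =
     (\<Sum>T\<in>Ts. elem_inner T (weak_div_mat k Es \<sigma> T) (weak_div_mat k Es \<delta> T)
            + elem_inner T (residual k Es \<mu> lam u \<sigma> T) (residual k Es \<mu> lam v \<delta> T))"

text \<open>The two stabilizers \<open>s\<^sub>1\<close> and \<open>s\<^sub>2\<close> are the instances of this form for vector and matrix values.\<close>

definition stabilizer ::
    "(real^'d) set set \<Rightarrow> (real^'d) set set
      \<Rightarrow> ('d, 'v::euclidean_space) weak_fun \<Rightarrow> ('d, 'v) weak_fun \<Rightarrow> real" where
  "stabilizer Ts Es u v =
     (\<Sum>T\<in>Ts. inverse (diameter T) *
        bdry_inner Es T (\<lambda>e x. fst u T x - snd u e x) (\<lambda>e x. fst v T x - snd v e x))"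

definition lswg_solution ::
    "nat \<Rightarrow> (real^'d) set \<Rightarrow> (real^'d) set set \<Rightarrow> (real^'d) set set \<Rightarrow> real \<Rightarrow> real
      \<Rightarrow> (real^'d \<Rightarrow> real^'d) \<Rightarrow> (real^'d \<Rightarrow> real^'d)
      \<Rightarrow> ('d, real^'d) weak_fun \<Rightarrow> ('d, real^'d^'d) weak_fun \<Rightarrow> bool" where
  "lswg_solution k \<Omega> Ts Es \<mu> lam f g u \<sigma> \<longleftrightarrow>
     u \<in> W_h k Ts Es \<and> \<sigma> \<in> V_h k Ts Es \<and>
     (\<forall>e\<in>boundary_faces \<Omega> Es. snd u e = Q_b k e g) \<and>
     (\<forall>v\<in>W_h0 k \<Omega> Ts Es. \<forall>\<delta>\<in>V_h k Ts Es.
        a_form k Ts Es \<mu> lam u v \<sigma> \<delta> + stabilizer Ts Es u v + stabilizer Ts Es \<sigma> \<delta> =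
          (\<Sum>T\<in>Ts. elem_inner T (\<lambda>x. - f x) (weak_div_mat k Es \<delta> T)))"

end

theory Submission
  imports Defs "HOL-Library.Function_Algebras"
begin

text \<open>The scheme is a square linear system with a symmetric positive semidefinite form, so it
  suffices that the form is definite on the test space. If it vanishes at \<open>(u, \<sigma>)\<close>, then traces
  match, so integration by parts gives \<open>\<epsilon>\<^sub>w(u) = \<epsilon>(u\<^sub>0)\<close> and \<open>\<nabla>\<^sub>w \<cdot> u = \<nabla> \<cdot> u\<^sub>0\<close>, and
  \<open>\<sigma>\<^sub>0 = 2\<mu>\<epsilon>(u\<^sub>0) + \<lambda>(\<nabla> \<cdot> u\<^sub>0)I\<close>. Testing \<open>\<nabla>\<^sub>w \<cdot> \<sigma> = 0\<close> with \<open>u\<^sub>0\<close> and summing over the elements,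
  the face terms cancel, so \<open>\<epsilon>(u\<^sub>0) = 0\<close>. Thus \<open>u\<^sub>0\<close> is a rigid motion on every element, and
  a rigid motion that vanishes on a face is zero. The elements where \<open>u\<^sub>0 \<noteq> 0\<close> therefore form
  a collection without boundary faces, which has volume zero by the divergence theorem.

  The divergence theorem on a nonconvex polytope is proved for directions \<open>v\<close> transversal to all
  faces by the fundamental theorem of calculus on almost every line parallel to \<open>v\<close>: such a line
  meets the boundary only at points where the element is locally a half space.\<close>

section \<open>Finite-dimensional representation and polynomials\<close>

text \<open>Members of \<open>weak_space\<close> are \<open>undefined\<close> off their element or
  face, so the scheme is solved on families of polynomials defined on the whole space. There the
  form is only semidefinite: a polynomial that vanishes on a face has no energy there without being
  zero. Hence existence rests on \<open>riesz_semidefinite\<close>, which asks in addition that the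
  functional kill null vectors; definiteness up to restriction provides this, and uniqueness too.
  The same representation theorem gives meaning to every \<open>THE\<close> in the definitions of
  the weak operators and of the projection of \<open>g\<close>. Elements may be nonconvex, have
  coplanar neighbouring faces and touch themselves, and \<open>face_normal\<close> is a choice at an
  unspecified point. Sets are therefore described by the finitely many planes that cut them out. At
  a point on a single one of these planes, membership depends only on the side of it, and the
  pyramid of (A3) tells which side is inside. Face integrals are volume integrals over prisms, which
  is how Fubini's theorem along lines can produce them.\<close>

instantiation "fun" :: (type, real_vector) real_vector
begin

definition "c *\<^sub>R f = (\<lambda>x. c *\<^sub>R f x)"

instance
  by standard (simp_all add: scaleR_fun_def fun_eq_iff scaleR_add_right scaleR_add_left)

end

lemma scaleR_fun_apply [simp]: "(c *\<^sub>R f) x = c *\<^sub>R f x"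
  by (simp add: scaleR_fun_def)

lemma sum_fun_apply: "(\<Sum>i\<in>I. f i) x = (\<Sum>i\<in>I. f i x)"
  by (induction I rule: infinite_finite_induct) auto

text \<open>Gram-Schmidt for a possibly degenerate form: a new generator \<open>g\<close> is
  replaced by its part \<open>w\<close> orthogonal to the span so far, and the representer is
  corrected along \<open>w\<close>. That \<open>L\<close> kills null vectors settles the case
  \<open>B w w = 0\<close>, where no correction is possible.\<close>

lemma riesz_semidefinite:
  fixes B :: "'x::real_vector \<Rightarrow> 'x \<Rightarrow> real" and L :: "'x \<Rightarrow> real"
  assumes V: "subspace V"
    and add: "\<And>x y z. x \<in> V \<Longrightarrow> y \<in> V \<Longrightarrow> z \<in> V \<Longrightarrow> B (x + y) z = B x z + B y z"
    and scale: "\<And>c x z. x \<in> V \<Longrightarrow> z \<in> V \<Longrightarrow> B (c *\<^sub>R x) z = c * B x z"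
    and sym: "\<And>x y. x \<in> V \<Longrightarrow> y \<in> V \<Longrightarrow> B x y = B y x"
    and pos: "\<And>x. x \<in> V \<Longrightarrow> 0 \<le> B x x"
    and S: "finite S" "S \<subseteq> V"
    and L: "\<And>x y. x \<in> V \<Longrightarrow> y \<in> V \<Longrightarrow> L (x + y) = L x + L y"
      "\<And>c x. x \<in> V \<Longrightarrow> L (c *\<^sub>R x) = c * L x"
      "\<And>x. x \<in> V \<Longrightarrow> B x x = 0 \<Longrightarrow> L x = 0"
  shows "\<exists>c\<in>span S. \<forall>y\<in>span S. B c y = L y"
  using S L
proof (induction S arbitrary: L rule: finite_induct)
  case empty
  have z: "B 0 0 = 0"
    using scale[of 0 0 0] V by (simp add: subspace_0)
  moreover have "L 0 = 0"
    using empty.prems(4)[of 0] z V by (simp add: subspace_0)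
  ultimately show ?case by simp
next
  case (insert g S)
  have g: "g \<in> V" and SV: "span S \<subseteq> V"
    using insert.prems V by (auto simp: span_minimal)
  note cl = subspace_add[OF V] subspace_scale[OF V] subspace_diff[OF V]
  have add': "B z (x + y) = B z x + B z y" if "x \<in> V" "y \<in> V" "z \<in> V" for x y z
    using add[OF that] sym that cl by metis
  have scale': "B z (c *\<^sub>R x) = c * B z x" if "x \<in> V" "z \<in> V" for c x z
    using scale[OF that] sym that cl by metis
  have diff: "B (x - y) z = B x z - B y z" if "x \<in> V" "y \<in> V" "z \<in> V" for x y z
    using add[of "x - y" y z] that cl by auto
  \<comment> \<open>A null vector lies in the radical: otherwise
    \<open>B (g + t *\<^sub>R x) (g + t *\<^sub>R x)\<close> is affine in \<open>t\<close> and not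
    constant. The chosen \<open>t\<close> gives it the value -1.\<close>
  have null: "B g x = 0" if x: "x \<in> V" "B x x = 0" for x
  proof (rule ccontr)
    assume n: "B g x \<noteq> 0"
    define t where "t = - (B g g + 1) / (2 * B g x)"
    have "0 \<le> B (g + t *\<^sub>R x) (g + t *\<^sub>R x)"
      using pos cl g x by blast
    also have "\<dots> = B g g + 2 * t * B g x"
      using g x cl sym[of x g] by (simp add: add add' scale scale')
    also have "\<dots> = -1" using n by (simp add: t_def divide_simps)
    finally show False by simp
  qed
  have "\<exists>d\<in>span S. \<forall>y\<in>span S. B d y = B g y"
    using insert.prems g null by (intro insert.IH) (auto simp: add' scale')
  then obtain d where d: "d \<in> span S" "\<And>y. y \<in> span S \<Longrightarrow> B d y = B g y" by blast
  have "\<exists>c\<in>span S. \<forall>y\<in>span S. B c y = L y"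
    using insert.prems by (intro insert.IH) auto
  then obtain c where c: "c \<in> span S" "\<And>y. y \<in> span S \<Longrightarrow> B c y = L y" by blast
  have dV: "d \<in> V" and cV: "c \<in> V" using d(1) c(1) SV by auto
  \<comment> \<open>By the induction hypothesis for the functional \<open>B g\<close>,
    \<open>d\<close> is the projection of \<open>g\<close> to \<open>span S\<close>, so
    \<open>w\<close> is orthogonal to \<open>span S\<close>.\<close>
  define w where "w = g - d"
  have wV: "w \<in> V" unfolding w_def using g dV cl by blast
  have w0: "B w y = 0" if "y \<in> span S" for y
    using d(2)[OF that] that SV g dV by (auto simp: w_def diff)
  have wg: "B w g = B w w"
    using w0[OF d(1)] g dV wV add'[of w d w] by (simp add: w_def)
  have win: "w \<in> span (insert g S)"
    unfolding w_def by (meson d(1) in_mono insertI1 span_base span_diff span_mono subset_insertI)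
  have cin: "c \<in> span (insert g S)"
    by (meson c(1) in_mono span_mono subset_insertI)
  \<comment> \<open>\<open>c\<close> already represents \<open>L\<close> on \<open>span S\<close>,
    and adding a multiple of \<open>w\<close> does not disturb this; \<open>t\<close> is fixed by
    the one remaining equation, at \<open>g\<close>.\<close>
  obtain t where t: "B c g + t * B w w = L g"
  proof (cases "B w w = 0")
    case True
    have "L w = 0" using insert.prems(4) True wV by blast
    moreover have "L g = L w + L d"
      using insert.prems(2)[of w d] wV dV by (simp add: w_def)
    moreover have "B c g = B c w + B c d"
      using add'[of w d c] wV dV cV by (simp add: w_def)
    moreover have "B c w = 0" using w0[OF c(1)] sym[of w c] wV cV by simp
    ultimately have "B c g = L g" using c(2)[OF d(1)] by simp
    then show ?thesis using that[of 0] by simp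
  next
    case False
    then show ?thesis using that[of "(L g - B c g) / B w w"] by simp
  qed
  have "B (c + t *\<^sub>R w) y = L y" if yin: "y \<in> span (insert g S)" for y
  proof -
    obtain k where "y - k *\<^sub>R g \<in> span S" using yin span_breakdown_eq by blast
    moreover define z where "z = y - k *\<^sub>R g"
    ultimately have z: "z \<in> span S" "z \<in> V" and y: "y = z + k *\<^sub>R g"
      using SV by auto
    have "B (c + t *\<^sub>R w) z = L z"
      using z cV wV cl by (simp add: add scale w0 c(2))
    moreover have "B (c + t *\<^sub>R w) g = L g"
      using t g cV wV cl by (simp add: add scale wg)
    ultimately show ?thesis
      using z g cV wV cl insert.prems(2,3) by (simp add: y add' scale')
  qed
  moreover have "c + t *\<^sub>R w \<in> span (insert g S)"
    using win cin by (intro span_add span_scale)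
  ultimately show ?case by blast
qed

text \<open>The spanning set may lie outside \<open>V\<close>, which keeps products and families
  easy; \<open>fin_dim_subspaceE\<close> moves it inside when \<open>V\<close> is a
  subspace.\<close>

definition fin_dim :: "'x::real_vector set \<Rightarrow> bool" where
  "fin_dim V \<longleftrightarrow> (\<exists>S. finite S \<and> V \<subseteq> span S)"

lemma fin_dim_subspaceE:
  assumes "fin_dim V" "subspace V"
  obtains S where "finite S" "span S = V"
proof -
  obtain S where S: "finite S" "V \<subseteq> span S" using assms by (auto simp: fin_dim_def)
  obtain B where B: "B \<subseteq> V" "independent B" "V \<subseteq> span B"
    using basis_exists by (metis maximal_independent_subset)
  have "finite B"
    using independent_span_bound[OF S(1) B(2)] B S by auto
  then show ?thesis using that[of B] B assms(2) by (metis span_minimal subset_antisym)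
qed

lemma fin_dim_Times:
  assumes "fin_dim V" "fin_dim W"
  shows "fin_dim (V \<times> W)"
proof -
  obtain S where S: "finite S" "V \<subseteq> span S" using assms by (auto simp: fin_dim_def)
  obtain T where T: "finite T" "W \<subseteq> span T" using assms by (auto simp: fin_dim_def)
  have l1: "linear (\<lambda>x::'a. (x, 0::'b))" and l2: "linear (\<lambda>x::'b. (0::'a, x))"
    by (auto intro!: linearI)
  define U where "U = (\<lambda>x::'a. (x, 0::'b)) ` S \<union> (\<lambda>x::'b. (0::'a, x)) ` T"
  have "(v, w) \<in> span U" if "v \<in> V" "w \<in> W" for v w
  proof -
    have "(v, 0) \<in> span ((\<lambda>x::'a. (x, 0::'b)) ` S)"
      using linear_span_image[OF l1, of S] that S by auto
    moreover have "(0, w) \<in> span ((\<lambda>x::'b. (0::'a, x)) ` T)"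
      using linear_span_image[OF l2, of T] that T by auto
    ultimately have "(v, 0) + (0, w) \<in> span U"
      unfolding U_def by (intro span_add) (meson Un_upper1 Un_upper2 in_mono span_mono)+
    then show ?thesis by simp
  qed
  then show ?thesis unfolding fin_dim_def using S T
    by (intro exI[of _ U]) (auto simp: U_def)
qed

text \<open>A family over finitely many indices is the sum of its one-index parts
  \<open>e i (f i)\<close>. The value off \<open>I\<close> is zero, not \<open>undefined\<close>, so
  that such families form a vector space.\<close>

lemma fin_dim_PiE_zero:
  fixes V :: "'i \<Rightarrow> 'x::real_vector set"
  assumes "finite I" "\<And>i. i \<in> I \<Longrightarrow> fin_dim (V i)"
  shows "fin_dim {f. (\<forall>i\<in>I. f i \<in> V i) \<and> (\<forall>i. i \<notin> I \<longrightarrow> f i = 0)}"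
proof -
  obtain S where S: "\<And>i. i \<in> I \<Longrightarrow> finite (S i)" "\<And>i. i \<in> I \<Longrightarrow> V i \<subseteq> span (S i)"
    using assms(2) unfolding fin_dim_def by metis
  define e where "e = (\<lambda>(i::'i) (x::'x) j. if j = i then x else 0)"
  define U where "U = (\<Union>i\<in>I. e i ` S i)"
  have lin: "linear (e i)" for i by (rule linearI) (auto simp: e_def)
  have "f \<in> span U" if f: "\<forall>i\<in>I. f i \<in> V i" "\<forall>i. i \<notin> I \<longrightarrow> f i = 0" for f
  proof -
    have "f = (\<Sum>i\<in>I. e i (f i))"
      using f assms(1) by (auto simp: fun_eq_iff sum_fun_apply e_def if_distrib cong: if_cong)
    also have "\<dots> \<in> span U"
    proof (rule span_sum)
      fix i assume i: "i \<in> I"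
      have "e i (f i) \<in> span (e i ` S i)"
        using linear_span_image[OF lin, of i "S i"] f S i by blast
      then show "e i (f i) \<in> span U"
        unfolding U_def using i by (meson UN_upper in_mono span_mono)
    qed
    finally show ?thesis .
  qed
  then show ?thesis unfolding fin_dim_def using S(1) assms(1)
    by (intro exI[of _ U]) (auto simp: U_def)
qed

section \<open>Polynomials of bounded total degree\<close>

abbreviation monomial :: "('d \<Rightarrow> nat) \<Rightarrow> real^'d \<Rightarrow> real" where
  "monomial \<alpha> x \<equiv> (\<Prod>i\<in>UNIV. x $ i ^ \<alpha> i)"

lemma poly_funE:
  fixes p :: "real^'d \<Rightarrow> 'v::real_vector"
  assumes "poly_fun k p"
  obtains c where "\<forall>x. p x = (\<Sum>\<alpha> | sum \<alpha> UNIV \<le> k. monomial \<alpha> x *\<^sub>R c \<alpha>)"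
proof -
  obtain c where "\<forall>x. p x = (\<Sum>\<alpha> | sum \<alpha> UNIV \<le> k. monomial \<alpha> x *\<^sub>R c \<alpha>)"
    using assms unfolding poly_fun_def by (elim exE)
  then show ?thesis by (rule that)
qed

lemma poly_fun_zero: "poly_fun k (\<lambda>x. 0)"
  unfolding poly_fun_def by (intro exI[of _ "\<lambda>_. 0"]) simp

lemma poly_fun_add:
  assumes "poly_fun k p" "poly_fun k q"
  shows "poly_fun k (\<lambda>x. p x + q x)"
proof -
  obtain c where "\<forall>x. p x = (\<Sum>\<alpha> | sum \<alpha> UNIV \<le> k. monomial \<alpha> x *\<^sub>R c \<alpha>)"
    using assms(1) by (rule poly_funE)
  moreover obtain d where "\<forall>x. q x = (\<Sum>\<alpha> | sum \<alpha> UNIV \<le> k. monomial \<alpha> x *\<^sub>R d \<alpha>)"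
    using assms(2) by (rule poly_funE)
  ultimately show ?thesis unfolding poly_fun_def
    by (intro exI[of _ "\<lambda>\<alpha>. c \<alpha> + d \<alpha>"]) (simp add: scaleR_add_right sum.distrib)
qed

lemma poly_fun_linear:
  assumes "poly_fun k p" "linear f"
  shows "poly_fun k (\<lambda>x. f (p x))"
proof -
  obtain c where "\<forall>x. p x = (\<Sum>\<alpha> | sum \<alpha> UNIV \<le> k. monomial \<alpha> x *\<^sub>R c \<alpha>)"
    using assms(1) by (rule poly_funE)
  then show ?thesis unfolding poly_fun_def
    by (intro exI[of _ "\<lambda>\<alpha>. f (c \<alpha>)"])
      (simp add: linear_sum[OF assms(2)] linear_cmul[OF assms(2)])
qed

lemma poly_fun_scaleR: "poly_fun k p \<Longrightarrow> poly_fun k (\<lambda>x. c *\<^sub>R p x)"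
  by (rule poly_fun_linear) (auto intro: linearI simp: scaleR_add_right)

lemma poly_fun_sum: "(\<And>i. i \<in> I \<Longrightarrow> poly_fun k (f i)) \<Longrightarrow> poly_fun k (\<lambda>x. \<Sum>i\<in>I. f i x)"
  by (induction I rule: infinite_finite_induct) (auto intro: poly_fun_add poly_fun_zero)

lemma subspace_poly_fun: "subspace {p. poly_fun k p}"
  unfolding subspace_def
  by (auto simp: zero_fun_def plus_fun_def scaleR_fun_def
      intro: poly_fun_zero poly_fun_add poly_fun_scaleR)

lemma poly_fun_diff: "poly_fun k p \<Longrightarrow> poly_fun k q \<Longrightarrow> poly_fun k (\<lambda>x. p x - q x)"
  using poly_fun_add[OF _ poly_fun_scaleR[of k q "-1"], of p] by simp

lemma poly_fun_monomial:
  fixes \<alpha> :: "'d::finite \<Rightarrow> nat"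
  assumes "sum \<alpha> UNIV \<le> k"
  shows "poly_fun k (\<lambda>x. monomial \<alpha> x *\<^sub>R v)"
  unfolding poly_fun_def using assms
  by (intro exI[of _ "\<lambda>\<beta>. if \<beta> = \<alpha> then v else 0"])
    (simp add: if_distrib finite_multi_indices cong: if_cong)

lemma poly_fun_component:
  fixes p :: "real^'d \<Rightarrow> ('v::real_vector)^'n"
  assumes "poly_fun k p"
  shows "poly_fun k (\<lambda>x. p x $ i)"
  by (rule poly_fun_linear[OF assms]) (auto intro: linearI)

lemma poly_fun_vector:
  fixes p :: "real^'d \<Rightarrow> ('v::real_vector)^'n"
  assumes "\<And>i. poly_fun k (\<lambda>x. p x $ i)"
  shows "poly_fun k p"
proof -
  have "\<forall>i. \<exists>c. \<forall>x. p x $ i = (\<Sum>\<alpha> | sum \<alpha> UNIV \<le> k. monomial \<alpha> x *\<^sub>R c \<alpha>)"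
    using assms unfolding poly_fun_def by blast
  then obtain c where c: "\<And>i x. p x $ i = (\<Sum>\<alpha> | sum \<alpha> UNIV \<le> k. monomial \<alpha> x *\<^sub>R c i \<alpha>)"
    by (auto dest: choice)
  show ?thesis unfolding poly_fun_def
    by (intro exI[of _ "\<lambda>\<alpha>. \<chi> i. c i \<alpha>"]) (simp add: vec_eq_iff c)
qed

lemma fin_dim_poly_fun: "fin_dim {p :: real^'d \<Rightarrow> 'v::euclidean_space. poly_fun k p}"
proof -
  define S where "S = (\<lambda>(\<alpha>, b). \<lambda>x::real^'d. monomial \<alpha> x *\<^sub>R (b::'v)) ` ({\<alpha>. sum \<alpha> UNIV \<le> k} \<times> Basis)"
  have "p \<in> span S" if "poly_fun k p" for p
  proof -
    obtain c where c: "\<forall>x. p x = (\<Sum>\<alpha> | sum \<alpha> UNIV \<le> k. monomial \<alpha> x *\<^sub>R c \<alpha>)"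
      using \<open>poly_fun k p\<close> by (rule poly_funE)
    have "p = (\<Sum>\<alpha> | sum \<alpha> UNIV \<le> k. \<Sum>b\<in>Basis. (c \<alpha> \<bullet> b) *\<^sub>R (\<lambda>x. monomial \<alpha> x *\<^sub>R b))"
    proof
      fix x
      have "p x = (\<Sum>\<alpha> | sum \<alpha> UNIV \<le> k. monomial \<alpha> x *\<^sub>R (\<Sum>b\<in>Basis. (c \<alpha> \<bullet> b) *\<^sub>R b))"
        by (simp add: c euclidean_representation)
      then show "p x = (\<Sum>\<alpha> | sum \<alpha> UNIV \<le> k. \<Sum>b\<in>Basis. (c \<alpha> \<bullet> b) *\<^sub>R (\<lambda>x. monomial \<alpha> x *\<^sub>R b)) x"
        by (simp add: sum_fun_apply scaleR_sum_right mult.commute)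
    qed
    also have "\<dots> \<in> span S"
      by (intro span_sum span_scale span_base) (force simp: S_def)
    finally show ?thesis .
  qed
  moreover have "finite S" by (simp add: S_def finite_multi_indices)
  ultimately show ?thesis unfolding fin_dim_def by blast
qed

text \<open>The link to the polynomial functions of the library, from which continuity,
  differentiability and composition with affine maps are taken.\<close>

lemma polynomial_function_poly_fun:
  fixes p :: "real^'d \<Rightarrow> 'v::euclidean_space"
  assumes "poly_fun k p"
  shows "polynomial_function p"
proof -
  obtain c where c: "\<forall>x. p x = (\<Sum>\<alpha> | sum \<alpha> UNIV \<le> k. monomial \<alpha> x *\<^sub>R c \<alpha>)"
    using assms by (rule poly_funE)
  have comp: "real_polynomial_function (\<lambda>x::real^'d. x $ i)" for i
    by (intro real_polynomial_function.intros(1) bounded_linear_vec_nth)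
  have "polynomial_function (\<lambda>x. \<Sum>\<alpha> | sum \<alpha> UNIV \<le> k. monomial \<alpha> x *\<^sub>R c \<alpha>)"
    by (intro polynomial_function_sum polynomial_function_mult polynomial_function_const
        finite_multi_indices real_polynomial_function_prod real_polynomial_function_power comp
        real_polynomial_function_eq[THEN iffD1]) auto
  then show ?thesis by (simp add: c[rule_format, abs_def])
qed

lemma continuous_on_poly_fun:
  fixes p :: "real^'d \<Rightarrow> 'v::euclidean_space"
  shows "poly_fun k p \<Longrightarrow> continuous_on S p"
  by (simp add: continuous_on_polymonial_function polynomial_function_poly_fun)

text \<open>On the line through \<open>x0\<close> and \<open>x\<close> each component is a
  polynomial in one variable with infinitely many roots near \<open>x0\<close>; it is therefore
  zero, also at \<open>x\<close>.\<close>

lemma poly_fun_eq_0: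
  fixes p :: "real^'d \<Rightarrow> 'v::euclidean_space"
  assumes p: "poly_fun k p" and U: "open U" "x0 \<in> U" "\<And>x. x \<in> U \<Longrightarrow> p x = 0"
  shows "p x = 0"
proof (rule euclidean_eqI)
  fix b :: 'v assume "b \<in> Basis"
  define q where "q = (\<lambda>s::real. p (x0 + s *\<^sub>R (x - x0)) \<bullet> b)"
  have "polynomial_function (\<lambda>s::real. x0 + s *\<^sub>R (x - x0))"
    by (intro polynomial_function_add polynomial_function_mult polynomial_function_const
        polynomial_function_id real_polynomial_function_eq[THEN iffD2])
  from polynomial_function_compose[OF this polynomial_function_poly_fun[OF p]]
  have "polynomial_function (\<lambda>s::real. p (x0 + s *\<^sub>R (x - x0)))" by (simp add: o_def)
  then have "real_polynomial_function q"
    unfolding q_def using \<open>b \<in> Basis\<close> by (simp add: polynomial_function_iff_Basis_inner)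
  then obtain a n where q: "q = (\<lambda>s. \<Sum>i\<le>n. a i * s ^ i)"
    unfolding real_polynomial_function_iff_sum by blast
  have "open ((\<lambda>s::real. x0 + s *\<^sub>R (x - x0)) -` U)"
    by (intro continuous_open_vimage U continuous_intros)
  moreover have "0 \<in> (\<lambda>s::real. x0 + s *\<^sub>R (x - x0)) -` U" using U by simp
  ultimately obtain r where r: "r > 0" "ball 0 r \<subseteq> (\<lambda>s::real. x0 + s *\<^sub>R (x - x0)) -` U"
    using open_contains_ball by blast
  have "ball 0 r \<subseteq> {s. (\<Sum>i\<le>n. a i * s ^ i) = 0}"
  proof
    fix s :: real assume "s \<in> ball 0 r"
    then have "p (x0 + s *\<^sub>R (x - x0)) = 0" using r U(3) by blast
    then show "s \<in> {s. (\<Sum>i\<le>n. a i * s ^ i) = 0}"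
      using fun_cong[OF q, of s] by (simp add: q_def)
  qed
  moreover have "infinite (ball (0::real) r)"
    using r(1) using finite_imp_not_open[of "ball (0::real) r"] by auto
  ultimately have "infinite {s. (\<Sum>i\<le>n. a i * s ^ i) = 0}"
    using infinite_super by blast
  then have "\<forall>i\<le>n. a i = 0" using polyfun_finite_roots[of a n] by blast
  then have "q 1 = 0" by (simp add: q)
  then show "p x \<bullet> b = 0 \<bullet> b" by (simp add: q_def)
qed

text \<open>For \<open>\<alpha> j = 0\<close> the truncated exponent \<open>\<alpha> j - 1\<close>
  is again 0, and the factor \<open>of_nat (\<alpha> j)\<close> makes the formula correct.\<close>

lemma partial_monomial:
  fixes \<alpha> :: "'d::finite \<Rightarrow> nat"
  shows "\<exists>D. (monomial \<alpha> has_derivative D) (at x) \<and>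
    D (axis j 1) = of_nat (\<alpha> j) * monomial (\<alpha>(j := \<alpha> j - 1)) x"
proof (intro exI conjI)
  define D where "D = (\<lambda>y::real^'d. \<Sum>i\<in>UNIV. (of_nat (\<alpha> i) * (y $ i * x $ i ^ (\<alpha> i - 1))) * (\<Prod>l\<in>UNIV - {i}. x $ l ^ \<alpha> l))"
  have 1: "((\<lambda>x. x $ i ^ \<alpha> i) has_derivative (\<lambda>y. of_nat (\<alpha> i) * (y $ i * x $ i ^ (\<alpha> i - 1)))) (at x)" for i
    by (rule has_derivative_eq_rhs, rule has_derivative_power,
        rule bounded_linear_imp_has_derivative, rule bounded_linear_vec_nth) (simp add: fun_eq_iff)
  show "(monomial \<alpha> has_derivative D) (at x)"
    unfolding D_def by (rule has_derivative_prod[OF 1])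
  have "D (axis j 1) = (of_nat (\<alpha> j) * (x $ j ^ (\<alpha> j - 1))) * (\<Prod>l\<in>UNIV - {j}. x $ l ^ \<alpha> l)"
    unfolding D_def by (subst sum.remove[of _ j]) (auto simp: axis_def intro!: sum.neutral)
  also have "\<dots> = of_nat (\<alpha> j) * monomial (\<alpha>(j := \<alpha> j - 1)) x"
    by (subst prod.remove[of UNIV j "\<lambda>i. x $ i ^ (\<alpha>(j := \<alpha> j - 1)) i"]) (auto intro!: prod.cong)
  finally show "D (axis j 1) = of_nat (\<alpha> j) * monomial (\<alpha>(j := \<alpha> j - 1)) x" .
qed

lemma poly_fun_differentiable:
  fixes p :: "real^'d \<Rightarrow> 'v::euclidean_space"
  shows "poly_fun k p \<Longrightarrow> p differentiable (at x)"
  by (simp add: differentiable_at_polynomial_function polynomial_function_poly_fun)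

text \<open>The bound \<open>k\<close> is kept, since the classical derivatives have to be
  candidates for the weak ones, which are sought in degree at most \<open>k\<close>.\<close>

lemma poly_fun_partial:
  fixes p :: "real^'d \<Rightarrow> real"
  assumes "poly_fun k p"
  shows "poly_fun k (partial j p)"
proof -
  obtain c where c: "\<forall>x. p x = (\<Sum>\<alpha> | sum \<alpha> UNIV \<le> k. monomial \<alpha> x *\<^sub>R c \<alpha>)"
    using assms by (rule poly_funE)
  define P where "P = (\<lambda>(\<alpha> :: 'd \<Rightarrow> nat) x D. (monomial \<alpha> has_derivative D) (at x) \<and>
    D (axis j 1) = of_nat (\<alpha> j) * monomial (\<alpha>(j := \<alpha> j - 1)) x)"
  define D where "D = (\<lambda>\<alpha> x. SOME D. P \<alpha> x D)"
  have "P \<alpha> x (D \<alpha> x)" for \<alpha> x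
    unfolding D_def using partial_monomial[of \<alpha> x j] by (intro someI_ex[of "P \<alpha> x"]) (simp add: P_def)
  then have D: "\<And>\<alpha> x. (monomial \<alpha> has_derivative D \<alpha> x) (at x)"
    "\<And>\<alpha> x. D \<alpha> x (axis j 1) = of_nat (\<alpha> j) * monomial (\<alpha>(j := \<alpha> j - 1)) x"
    unfolding P_def by blast+
  have "(p has_derivative (\<lambda>h. \<Sum>\<alpha> | sum \<alpha> UNIV \<le> k. D \<alpha> x h *\<^sub>R c \<alpha>)) (at x)" for x
    unfolding c[rule_format, abs_def] by (intro has_derivative_sum has_derivative_scaleR_left D)
  from frechet_derivative_at[OF this] have "partial j p x = (\<Sum>\<alpha> | sum \<alpha> UNIV \<le> k. D \<alpha> x (axis j 1) *\<^sub>R c \<alpha>)" for x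
    by (simp add: partial_def fun_eq_iff)
  then have "partial j p = (\<lambda>x. \<Sum>\<alpha> | sum \<alpha> UNIV \<le> k.
      monomial (\<alpha>(j := \<alpha> j - 1)) x *\<^sub>R (of_nat (\<alpha> j) * c \<alpha>))"
    by (auto simp: D fun_eq_iff mult_ac)
  moreover have "poly_fun k \<dots>"
  proof (intro poly_fun_sum poly_fun_monomial)
    fix \<alpha> :: "'d \<Rightarrow> nat" assume "\<alpha> \<in> {\<alpha>. sum \<alpha> UNIV \<le> k}"
    moreover have "sum (\<alpha>(j := \<alpha> j - 1)) UNIV \<le> sum \<alpha> UNIV" by (intro sum_mono) auto
    ultimately show "sum (\<alpha>(j := \<alpha> j - 1)) UNIV \<le> k" by simp
  qed
  ultimately show ?thesis by simp
qed

lemma has_derivative_partial: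
  fixes p :: "real^'d \<Rightarrow> real"
  assumes "p differentiable (at x)"
  shows "(p has_derivative (\<lambda>h. \<Sum>j\<in>UNIV. h $ j * partial j p x)) (at x)"
proof -
  have D: "(p has_derivative frechet_derivative p (at x)) (at x)"
    using assms frechet_derivative_works by blast
  then have l: "linear (frechet_derivative p (at x))" by (rule has_derivative_linear)
  have eq: "frechet_derivative p (at x) h = (\<Sum>j\<in>UNIV. h $ j * partial j p x)" for h
  proof -
    have "frechet_derivative p (at x) h = frechet_derivative p (at x) (\<Sum>j\<in>UNIV. h $ j *\<^sub>R axis j 1)"
      using basis_expansion[of h] by (simp add: scalar_mult_eq_scaleR)
    then show ?thesis by (simp add: linear_sum[OF l] linear_cmul[OF l] partial_def)
  qed
  show ?thesis by (rule has_derivative_eq_rhs[OF D]) (rule ext, rule eq)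
qed

lemma partial_mult:
  fixes p q :: "real^'d \<Rightarrow> real"
  assumes "p differentiable (at x)" "q differentiable (at x)"
  shows "partial j (\<lambda>y. p y * q y) x = partial j p x * q x + p x * partial j q x"
proof -
  have "frechet_derivative (\<lambda>y. p y * q y) (at x) =
      (\<lambda>h. p x * frechet_derivative q (at x) h + frechet_derivative p (at x) h * q x)"
    using assms
    by (intro frechet_derivative_at[symmetric] has_derivative_mult) (auto simp: frechet_derivative_works)
  then show ?thesis by (simp add: partial_def)
qed

section \<open>Integration over elements and faces\<close>

text \<open>An orthogonal change of coordinates taking \<open>axis k 1\<close> to \<open>n\<close>
  turns the map into the identity with column \<open>k\<close> altered, and Cramer's lemma evaluates
  such a determinant.\<close>

lemma det_rank_one_update:
  fixes n w :: "real^'n"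
  assumes "norm n = 1"
  shows "det (matrix (\<lambda>z. z + (n \<bullet> z) *\<^sub>R w)) = 1 + n \<bullet> w"
proof -
  fix k :: 'n
  obtain A where A: "orthogonal_matrix A" "A *v (axis k 1) = n"
    using orthogonal_matrix_exists_basis[OF assms] by blast
  have AA: "transpose A ** A = mat 1" and dA: "det (transpose A) * det A = 1"
    using A(1) det_mul[of "transpose A" A] by (auto simp: orthogonal_matrix)
  define u where "u = transpose A *v w"
  let ?g = "\<lambda>z. z + (n \<bullet> z) *\<^sub>R w"
  have lin: "linear ?g" by (auto intro!: linearI simp: inner_add_right algebra_simps)
  have "(transpose A ** matrix ?g ** A) *v z = z + (axis k 1 \<bullet> z) *\<^sub>R u" for z
  proof -
    have nz: "n \<bullet> (A *v z) = axis k 1 \<bullet> z"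
      unfolding A(2)[symmetric] dot_lmul_matrix[symmetric] transpose_matrix_vector[symmetric]
      by (simp add: matrix_vector_mul_assoc AA)
    have "transpose A *v (?g (A *v z)) = z + (axis k 1 \<bullet> z) *\<^sub>R u"
      unfolding nz by (simp add: AA matrix_vector_right_distrib matrix_vector_mul_assoc u_def
          matrix_vector_mult_scaleR)
    then show ?thesis
      by (simp add: matrix_vector_mul_assoc[symmetric] fun_cong[OF matrix_vector_mul(2)[OF lin]])
  qed
  \<comment> \<open>Written in the form that \<open>cramer_lemma\<close> expects: column
    \<open>k\<close> of the identity is replaced by \<open>axis k 1 + u\<close>.\<close>
  then have eq: "transpose A ** matrix ?g ** A =
      (\<chi> i j. if j = k then (mat 1 *v (axis k 1 + u)) $ i else (mat 1 :: real^'n^'n) $ i $ j)"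
  proof -
    have "(\<chi> i j. if j = k then (mat 1 *v (axis k 1 + u)) $ i else (mat 1 :: real^'n^'n) $ i $ j) =
        (\<chi> i j. (if i = j then 1 else 0) + (if j = k then u $ i else 0))"
      unfolding matrix_vector_mul_lid by (simp add: vec_eq_iff mat_def axis_def)
    moreover have "(\<chi> i j. (if i = j then 1 else 0) + (if j = k then u $ i else 0)) *v z =
        z + (axis k 1 \<bullet> z) *\<^sub>R u" for z
      by (simp add: vec_eq_iff matrix_vector_mult_def distrib_right sum.distrib inner_axis'
          if_distrib[of "\<lambda>c. c * _"] cong: if_cong)
    ultimately show ?thesis
      unfolding matrix_eq using \<open>\<And>z. (transpose A ** matrix ?g ** A) *v z = z + (axis k 1 \<bullet> z) *\<^sub>R u\<close>
      by simp
  qed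
  have "det (transpose A ** matrix ?g ** A) = 1 + u $ k"
    unfolding eq by (subst cramer_lemma) (simp add: axis_def)
  moreover have "u $ k = n \<bullet> w"
    unfolding u_def A(2)[symmetric]
    by (metis cart_eq_inner_axis dot_lmul_matrix inner_commute transpose_matrix_vector)
  moreover have "det (transpose A ** matrix ?g ** A) = det (matrix ?g)"
    using dA by (simp add: det_mul)
  ultimately show ?thesis by simp
qed

lemma lborel_integral_linear:
  fixes g :: "real^'m::{finite,wellorder} \<Rightarrow> real^'m::_" and f :: "real^'m::_ \<Rightarrow> real"
  assumes g: "linear g" and f: "integrable lborel f" and det: "det (matrix g) \<noteq> 0"
  shows "integrable lborel (\<lambda>x. f (g x))" "\<bar>det (matrix g)\<bar> * (\<integral>x. f (g x) \<partial>lborel) = (\<integral>x. f x \<partial>lborel)"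
proof -
  \<comment> \<open>The change of variables used below is stated for vector-valued functions, so
    \<open>F\<close> carries \<open>f\<close> on one coordinate axis.\<close>
  define F where "F = (\<lambda>x. f x *\<^sub>R (axis (undefined::'m) (1::real)))"
  have inj: "inj g" and surj: "range g = UNIV"
    using det g det_nz_iff_inj linear_injective_imp_surjective by auto
  have gm: "g \<in> borel_measurable borel"
    by (intro borel_measurable_continuous_onI linear_continuous_on linear_conv_bounded_linear[THEN iffD1] g)
  have fm: "f \<in> borel_measurable borel" using f by simp
  have li: "integrable lborel h \<longleftrightarrow> (\<lambda>x. h x *\<^sub>R (axis (undefined::'m) (1::real))) absolutely_integrable_on UNIV"
    if "h \<in> borel_measurable borel" for h :: "(real, 'm) vec \<Rightarrow> real"
    using that integrable_bounded_linear[OF bounded_linear_vec_nth[of undefined],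
      of lborel "\<lambda>x. h x *\<^sub>R (axis (undefined::'m) (1::real))"]
    by (auto simp: set_integrable_def integrable_completion axis_def)
  have aF: "F absolutely_integrable_on UNIV"
    unfolding F_def using f fm li by blast
  have aFg: "(\<lambda>x. F (g x)) absolutely_integrable_on UNIV"
    using absolutely_integrable_on_linear_image[OF g, where f=F and S=UNIV] aF surj det
    by (simp add: o_def)
  then show ifg: "integrable lborel (\<lambda>x. f (g x))"
    using fm gm by (subst li) (auto simp: F_def)
  have hi: "(h has_integral (\<integral>x. h x \<partial>lborel)) UNIV" if "integrable lborel h" for h :: "(real, 'm) vec \<Rightarrow> real"
    using that by (rule has_integral_integral_lborel)
  have "integral UNIV F = \<bar>det (matrix g)\<bar> *\<^sub>R integral UNIV (\<lambda>x. F (g x))"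
    using integral_change_of_variables_linear[OF g, where f=F and S=UNIV] aF surj by (simp add: o_def)
  moreover have "integral UNIV F = (\<integral>x. f x \<partial>lborel) *\<^sub>R axis undefined 1"
    unfolding F_def using hi[OF f] by (intro integral_unique has_integral_scaleR_left)
  moreover have "integral UNIV (\<lambda>x. F (g x)) = (\<integral>x. f (g x) \<partial>lborel) *\<^sub>R axis undefined 1"
    unfolding F_def using hi[OF ifg] by (intro integral_unique has_integral_scaleR_left)
  ultimately have "((\<integral>x. f x \<partial>lborel) *\<^sub>R axis undefined (1::real)) $ (undefined::'m) =
      (\<bar>det (matrix g)\<bar> *\<^sub>R (\<integral>x. f (g x) \<partial>lborel) *\<^sub>R axis undefined 1) $ undefined"
    by simp
  then show "\<bar>det (matrix g)\<bar> * (\<integral>x. f (g x) \<partial>lborel) = (\<integral>x. f x \<partial>lborel)"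
    by (simp add: axis_def)
qed

text \<open>Relabelling coordinates takes boxes to boxes with the same side lengths, and agreement
  on boxes characterizes \<open>lborel\<close>.\<close>

lemma lborel_distr_reindex:
  fixes \<phi> :: "'m::finite \<Rightarrow> 'd::finite"
  assumes "bij \<phi>"
  shows "distr lborel borel (\<lambda>x::real^'d. \<chi> i. x $ \<phi> i) = (lborel :: (real^'m) measure)"
proof (rule sym, rule lborel_eqI)
  fix l u :: "real^'m"
  define \<psi> where "\<psi> = inv \<phi>"
  have ph: "\<psi> (\<phi> i) = i" "\<phi> (\<psi> j) = j" for i j
    using assms by (auto simp: \<psi>_def bij_def surj_f_inv_f)
  define l' u' :: "real^'d" where "l' = (\<chi> j. l $ \<psi> j)" and "u' = (\<chi> j. u $ \<psi> j)"
  assume "\<And>b. b \<in> Basis \<Longrightarrow> l \<bullet> b \<le> u \<bullet> b"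
  then have le: "l $ i \<le> u $ i" for i
    by (metis axis_in_Basis_iff cart_eq_inner_axis real_inner_class.inner_commute Basis_real_def insertI1)
  have m: "(\<lambda>x::real^'d. \<chi> i. x $ \<phi> i) \<in> borel_measurable borel"
    by (intro borel_measurable_continuous_onI continuous_intros)
  have vim: "(\<lambda>x::real^'d. \<chi> i. x $ \<phi> i) -` box l u = box l' u'"
    by (auto simp: mem_box_cart l'_def u'_def ph) (metis ph)+
  have pr: "(\<Prod>b\<in>Basis. (u - l) \<bullet> b) = (\<Prod>i\<in>UNIV. u $ i - l $ i)" for u l :: "real^'n"
    by (simp add: Basis_vec_def prod.UNION_disjoint axis_eq_axis inner_axis prod.reindex inj_on_def)
  have "emeasure (distr lborel borel (\<lambda>x::real^'d. \<chi> i. x $ \<phi> i)) (box l u) = emeasure lborel (box l' u')"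
    by (subst emeasure_distr) (use m vim in auto)
  also have "\<dots> = ennreal (\<Prod>b\<in>Basis. (u' - l') \<bullet> b)"
    using le by (intro emeasure_lborel_box) (auto simp: Basis_vec_def inner_axis l'_def u'_def)
  also have "(\<Prod>b\<in>Basis. (u' - l') \<bullet> b) = (\<Prod>j\<in>UNIV. u $ \<psi> j - l $ \<psi> j)"
    unfolding pr by (simp add: l'_def u'_def)
  also have "\<dots> = (\<Prod>i\<in>UNIV. u $ i - l $ i)"
    by (rule prod.reindex_bij_betw) (use assms in \<open>simp add: \<psi>_def bij_imp_bij_inv\<close>)
  finally show "emeasure (distr lborel borel (\<lambda>x::real^'d. \<chi> i. x $ \<phi> i)) (box l u) =
      (\<Prod>b\<in>Basis. (u - l) \<bullet> b)"
    unfolding pr .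
qed simp

text \<open>The library has the linear change of variables only for a well-ordered index type.\<close>

lemma lborel_integral_rank_one_reindex:
  fixes \<phi> :: "'m::{finite,wellorder} \<Rightarrow> 'd::finite" and n w :: "real^'d" and f :: "real^'d \<Rightarrow> real"
  assumes \<phi>: "bij \<phi>" and n: "norm n = 1" and nw: "1 + n \<bullet> w \<noteq> 0"
    and f: "integrable lborel f"
  shows "\<bar>1 + n \<bullet> w\<bar> * (\<integral>z. f (z + (n \<bullet> z) *\<^sub>R w) \<partial>lborel) = (\<integral>y. f y \<partial>lborel)"
proof -
  define \<rho> where "\<rho> = (\<lambda>(x::real^'d). (\<chi> i. x $ \<phi> i) :: (real, 'm) vec)"
  define \<rho>' where "\<rho>' = (\<lambda>(x::(real, 'm) vec). (\<chi> j. x $ inv \<phi> j) :: real^'d)"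
  have inv: "\<rho>' (\<rho> x) = x" for x
    using \<phi> by (simp add: \<rho>_def \<rho>'_def bij_def surj_f_inv_f vec_eq_iff)
  have inv': "\<rho> (\<rho>' x) = x" for x
    using \<phi> by (simp add: \<rho>_def \<rho>'_def bij_def vec_eq_iff)
  have inner: "\<rho> x \<bullet> \<rho> y = x \<bullet> y" for x y
    unfolding inner_vec_def \<rho>_def using sum.reindex_bij_betw[OF \<phi>, of "\<lambda>i. x $ i \<bullet> y $ i"] by simp
  have lin: "\<rho> (x + c *\<^sub>R y) = \<rho> x + c *\<^sub>R \<rho> y" for x y c
    by (simp add: \<rho>_def vec_eq_iff)
  have d: "distr lborel borel \<rho> = lborel" "distr lborel borel \<rho>' = lborel"
    unfolding \<rho>_def \<rho>'_def using \<phi> by (auto intro!: lborel_distr_reindex bij_imp_bij_inv)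
  have m: "\<rho> \<in> borel_measurable borel" "\<rho>' \<in> borel_measurable borel"
    unfolding \<rho>_def \<rho>'_def by (intro borel_measurable_continuous_onI continuous_intros)+
  define g where "g = (\<lambda>z. z + (\<rho> n \<bullet> z) *\<^sub>R \<rho> w)"
  have g: "linear g"
    unfolding g_def by (auto intro!: linearI simp: inner_add_right algebra_simps)
  have "norm (\<rho> n) = 1" using inner[of n n] n by (simp add: norm_eq_sqrt_inner)
  then have det: "det (matrix g) = 1 + n \<bullet> w"
    unfolding g_def using det_rank_one_update[of "\<rho> n" "\<rho> w"] inner by simp
  have fm: "f \<in> borel_measurable borel" using f by simp
  have "integrable (distr lborel borel \<rho>') f" using f d by simp
  then have f': "integrable lborel (\<lambda>z. f (\<rho>' z))"
    using m fm by (subst (asm) integrable_distr_eq) auto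
  have "(\<integral>y. f y \<partial>lborel) = (\<integral>z. f (\<rho>' z) \<partial>lborel)"
    using integral_distr[of \<rho>' lborel borel f] m fm by (simp add: d)
  also have "\<dots> = \<bar>1 + n \<bullet> w\<bar> * (\<integral>z. f (\<rho>' (g z)) \<partial>lborel)"
    using lborel_integral_linear(2)[OF g f'] nw by (simp add: det)
  also have "(\<integral>z. f (\<rho>' (g z)) \<partial>lborel) = (\<integral>z. f (\<rho>' (g (\<rho> z))) \<partial>lborel)"
  proof -
    have "g \<in> borel_measurable borel"
      unfolding g_def by (intro borel_measurable_continuous_onI continuous_intros)
    then have "(\<lambda>z. f (\<rho>' (g z))) \<in> borel_measurable borel" using m fm by simp
    then show ?thesis
      using integral_distr[of \<rho> lborel borel "\<lambda>z. f (\<rho>' (g z))"] m by (simp add: d)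
  qed
  also have "(\<lambda>z. f (\<rho>' (g (\<rho> z)))) = (\<lambda>z. f (z + (n \<bullet> z) *\<^sub>R w))"
    by (simp add: g_def inner lin[symmetric] inv)
  finally show ?thesis by simp
qed

text \<open>In dimension 2 or 3 the index type is in bijection with the numeral type of that size,
  which is well-ordered.\<close>

lemma lborel_integral_rank_one:
  fixes n w :: "real^'d" and f :: "real^'d \<Rightarrow> real"
  assumes "CARD('d) = 2 \<or> CARD('d) = 3" and "norm n = 1" and "1 + n \<bullet> w \<noteq> 0"
    and "integrable lborel f"
  shows "\<bar>1 + n \<bullet> w\<bar> * (\<integral>z. f (z + (n \<bullet> z) *\<^sub>R w) \<partial>lborel) = (\<integral>y. f y \<partial>lborel)"
  using assms(1)
proof
  assume "CARD('d) = 2"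
  then obtain \<phi> :: "2 \<Rightarrow> 'd" where "bij \<phi>"
    using finite_same_card_bij[of "UNIV :: 2 set" "UNIV :: 'd set"] by auto
  then show ?thesis using lborel_integral_rank_one_reindex assms by blast
next
  assume "CARD('d) = 3"
  then obtain \<phi> :: "3 \<Rightarrow> 'd" where "bij \<phi>"
    using finite_same_card_bij[of "UNIV :: 3 set" "UNIV :: 'd set"] by auto
  then show ?thesis using lborel_integral_rank_one_reindex assms by blast
qed

lemma lborel_integral_translate:
  fixes f :: "'a::euclidean_space \<Rightarrow> real"
  assumes "f \<in> borel_measurable borel"
  shows "integrable lborel (\<lambda>x. f (a + x)) \<longleftrightarrow> integrable lborel f"
    "(\<integral>x. f (a + x) \<partial>lborel) = (\<integral>x. f x \<partial>lborel)"
  using integral_distr[of "(+) a" lborel borel f] integrable_distr_eq[of "(+) a" lborel borel f] assms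
  by (simp_all add: lborel_distr_plus)

text \<open>The inner products on an element (with \<open>lebesgue_on T\<close>) and on a face (with
  \<open>face_measure e\<close>) rest on these properties alone, so they are developed once.
  Continuity is asked on \<open>S\<close> only, because functions of \<open>poly_space\<close> are
  \<open>undefined\<close> elsewhere. \<open>definite\<close> will come from \<open>S\<close> lying
  in the closure of its (relative) interior.\<close>

locale integration_support =
  fixes M :: "(real^'d) measure" and S :: "(real^'d) set"
  assumes compact_S: "compact S"
    and integrable_cont: "\<And>f :: real^'d \<Rightarrow> real. continuous_on S f \<Longrightarrow> integrable M f"
    and AE_in: "AE x in M. x \<in> S"
    and definite: "\<And>(f :: real^'d \<Rightarrow> real) x. continuous_on S f \<Longrightarrow> (\<And>x. x \<in> S \<Longrightarrow> 0 \<le> f x) \<Longrightarrow>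
      integral\<^sup>L M f = 0 \<Longrightarrow> x \<in> S \<Longrightarrow> f x = 0"
begin

lemma integral_cong_on:
  fixes f g :: "real^'d \<Rightarrow> real"
  assumes "continuous_on S f" "\<And>x. x \<in> S \<Longrightarrow> f x = g x"
  shows "integral\<^sup>L M f = integral\<^sup>L M g"
proof -
  have "continuous_on S g" using assms continuous_on_cong by metis
  then show ?thesis using assms AE_in
    by (intro integral_cong_AE borel_measurable_integrable integrable_cont) auto
qed

lemma integral_nonneg_on:
  fixes f :: "real^'d \<Rightarrow> real"
  assumes "\<And>x. x \<in> S \<Longrightarrow> 0 \<le> f x"
  shows "0 \<le> integral\<^sup>L M f"
  using AE_in assms by (intro integral_nonneg_AE) auto

definition ip :: "(real^'d \<Rightarrow> 'v::euclidean_space) \<Rightarrow> (real^'d \<Rightarrow> 'v) \<Rightarrow> real" where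
  "ip f g = (\<integral>x. f x \<bullet> g x \<partial>M)"

lemma ip_commute: "ip f g = ip g f"
  by (simp add: ip_def inner_commute)

lemma ip_cong:
  assumes "continuous_on S f" "continuous_on S g" "\<And>x. x \<in> S \<Longrightarrow> f x = f' x" "\<And>x. x \<in> S \<Longrightarrow> g x = g' x"
  shows "ip f g = ip f' g'"
  unfolding ip_def using assms by (intro integral_cong_on continuous_intros) auto

text \<open>Additivity and homogeneity in one identity. \<open>h\<close> has to be the combination
  on \<open>S\<close> only, which allows restricted functions; the later lemmas named
  \<open>comb\<close> follow this pattern.\<close>

lemma ip_comb_left:
  assumes "continuous_on S f" "continuous_on S f'" "continuous_on S g"
    and "\<And>x. x \<in> S \<Longrightarrow> h x = c *\<^sub>R f x + f' x"
  shows "ip h g = c * ip f g + ip f' g"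
proof -
  have "ip h g = ip (\<lambda>x. c *\<^sub>R f x + f' x) g"
    using assms by (intro ip_cong[symmetric] continuous_intros) auto
  also have "\<dots> = (\<integral>x. c * (f x \<bullet> g x) + f' x \<bullet> g x \<partial>M)"
    by (simp add: ip_def inner_add_left)
  also have "\<dots> = (\<integral>x. c * (f x \<bullet> g x) \<partial>M) + (\<integral>x. f' x \<bullet> g x \<partial>M)"
    using assms by (intro Bochner_Integration.integral_add integrable_cont continuous_intros)
  finally show ?thesis by (simp add: ip_def)
qed

lemma ip_add_left:
  "continuous_on S f \<Longrightarrow> continuous_on S f' \<Longrightarrow> continuous_on S g \<Longrightarrow>
    ip (\<lambda>x. f x + f' x) g = ip f g + ip f' g"
  using ip_comb_left[of f f' g "\<lambda>x. f x + f' x" 1] by simp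

lemma ip_scaleR_left: "ip (\<lambda>x. c *\<^sub>R f x) g = c * ip f g"
  by (simp add: ip_def)

lemma ip_nonneg: "0 \<le> ip f f"
  unfolding ip_def by (rule integral_nonneg_on) simp

lemma ip_definite:
  assumes "continuous_on S f" "ip f f = 0" "x \<in> S"
  shows "f x = 0"
  using definite[of "\<lambda>x. f x \<bullet> f x" x] assms by (auto simp: ip_def intro!: continuous_intros)

text \<open>Justifies the \<open>THE\<close> in the definitions of the projections and weak
  operators. \<open>null\<close> says that \<open>L\<close> sees polynomials only through their
  values on \<open>S\<close>; a nonzero polynomial may vanish on a face. For uniqueness, the
  difference of two representers is tested with itself.\<close>

lemma riesz_poly_fun:
  fixes L :: "(real^'d \<Rightarrow> 'v::euclidean_space) \<Rightarrow> real"
  assumes add: "\<And>p q. poly_fun k p \<Longrightarrow> poly_fun k q \<Longrightarrow> L (\<lambda>x. p x + q x) = L p + L q"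
    and scale: "\<And>c p. poly_fun k p \<Longrightarrow> L (\<lambda>x. c *\<^sub>R p x) = c * L p"
    and null: "\<And>p. poly_fun k p \<Longrightarrow> (\<And>x. x \<in> S \<Longrightarrow> p x = 0) \<Longrightarrow> L p = 0"
  shows "\<exists>!q. q \<in> poly_space k S \<and> (\<forall>\<phi>. poly_fun k \<phi> \<longrightarrow> ip q \<phi> = L \<phi>)"
proof (rule ex_ex1I)
  let ?V = "{p :: real^'d \<Rightarrow> 'v. poly_fun k p}"
  note cont = continuous_on_poly_fun
  obtain B where B: "finite B" "span B = ?V"
    using fin_dim_subspaceE[OF fin_dim_poly_fun subspace_poly_fun] by metis
  have "\<exists>c\<in>span B. \<forall>y\<in>span B. ip c y = L y"
  proof (rule riesz_semidefinite[OF subspace_poly_fun[of k]])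
    show "finite B" by (rule B)
    show "B \<subseteq> ?V" using B span_superset by blast
  next
    fix x y z :: "real^'d \<Rightarrow> 'v" assume "x \<in> ?V" "y \<in> ?V" "z \<in> ?V"
    then show "ip (x + y) z = ip x z + ip y z"
      unfolding plus_fun_def by (intro ip_add_left) (auto intro: cont)
  next
    fix x assume "x \<in> ?V" "ip x x = 0"
    then show "L x = 0" using ip_definite[of x] cont[of k x S] by (intro null) auto
  qed (use add scale in \<open>auto simp: scaleR_fun_def plus_fun_def ip_scaleR_left ip_nonneg intro: ip_commute\<close>)
  then obtain q where "q \<in> ?V" "\<forall>p\<in>?V. ip q p = L p" unfolding B by (elim bexE)
  then have q: "poly_fun k q" "\<And>p. poly_fun k p \<Longrightarrow> ip q p = L p" by simp_all
  have "ip (restrict q S) \<phi> = L \<phi>" if "poly_fun k \<phi>" for \<phi>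
  proof -
    have "ip q \<phi> = ip (restrict q S) \<phi>"
      by (rule ip_cong[OF cont[OF q(1)] cont[OF that]]) auto
    then show ?thesis using q(2)[OF that] by (rule subst)
  qed
  moreover have "restrict q S \<in> poly_space k S"
    unfolding poly_space_def using q(1) by blast
  ultimately show "\<exists>q. q \<in> poly_space k S \<and> (\<forall>\<phi>. poly_fun k \<phi> \<longrightarrow> ip q \<phi> = L \<phi>)"
    by (intro exI[of _ "restrict q S"] conjI allI impI)
next
  fix q r assume q: "q \<in> poly_space k S \<and> (\<forall>\<phi>. poly_fun k \<phi> \<longrightarrow> ip q \<phi> = L \<phi>)"
    and r: "r \<in> poly_space k S \<and> (\<forall>\<phi>. poly_fun k \<phi> \<longrightarrow> ip r \<phi> = L \<phi>)"
  note cont = continuous_on_poly_fun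
  obtain q' where q': "poly_fun k q'" "q = restrict q' S"
    using q[THEN conjunct1] unfolding poly_space_def by (elim CollectE exE conjE)
  obtain r' where r': "poly_fun k r'" "r = restrict r' S"
    using r[THEN conjunct1] unfolding poly_space_def by (elim CollectE exE conjE)
  define d where "d = (\<lambda>x. q' x - r' x)"
  have d: "poly_fun k d" unfolding d_def using q' r' by (intro poly_fun_diff)
  have "continuous_on S q" "continuous_on S r"
    using cont[OF q'(1), of S] cont[OF r'(1), of S] by (auto simp: q'(2) r'(2) cong: continuous_on_cong)
  then have "ip d d = (-1) * ip r d + ip q d"
    using q' r' d by (intro ip_comb_left) (auto simp: d_def cont)
  also have "ip r d = L d" using r d by (elim conjE allE impE)
  also have "ip q d = L d" using q d by (elim conjE allE impE)
  finally have "ip d d = 0" by simp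
  then have "d x = 0" if "x \<in> S" for x by (rule ip_definite[OF cont[OF d] _ that])
  then show "q = r" unfolding q' r' by (intro restrict_ext) (simp add: d_def)
qed

end

text \<open>If \<open>f x > 0\<close>, then \<open>f\<close> is positive on \<open>T\<close> near
  \<open>x\<close>. This neighbourhood meets \<open>interior T\<close> even when \<open>x\<close>
  lies on the frontier, so \<open>f\<close> is nonzero on a nonempty open set, which is not
  negligible.\<close>

lemma integration_support_lebesgue_on:
  fixes T :: "(real^'d) set"
  assumes T: "compact T" "T \<subseteq> closure (interior T)"
  shows "integration_support (lebesgue_on T) T"
proof
  have Tm: "T \<in> sets borel" using T(1) by (simp add: borel_closed compact_imp_closed)
  then have Tl: "T \<inter> space lebesgue \<in> sets lebesgue" by simp
  have int: "integrable lebesgue (\<lambda>x. indicator T x *\<^sub>R f x)" if "continuous_on T f" for f :: "real^'d \<Rightarrow> real"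
    using borel_integrable_compact[OF T(1) that] Tm that
    by (subst integrable_completion) (auto intro: borel_measurable_continuous_on_indicator)
  show "integrable (lebesgue_on T) f" if "continuous_on T f" for f :: "real^'d \<Rightarrow> real"
    using int[OF that] by (subst integrable_restrict_space[OF Tl])
  show "AE x in lebesgue_on T. x \<in> T" by (rule AE_I2) simp
  fix f :: "real^'d \<Rightarrow> real" and x
  assume f: "continuous_on T f" "\<And>x. x \<in> T \<Longrightarrow> 0 \<le> f x" "integral\<^sup>L (lebesgue_on T) f = 0" and x: "x \<in> T"
  have "(\<integral>x. indicator T x *\<^sub>R f x \<partial>lebesgue) = 0"
    using f(3) by (simp add: integral_restrict_space[OF Tl])
  then have "AE x in lebesgue. indicator T x *\<^sub>R f x = 0"
    using int[OF f(1)] f(2) by (subst (asm) integral_nonneg_eq_0_iff_AE) (auto simp: indicator_def)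
  then have N: "negligible {x. \<not> (indicator T x *\<^sub>R f x = 0)}"
    by (simp add: negligible_iff_null_sets AE_iff_null_sets completion.AE_iff_null_sets)
  show "f x = 0"
  proof (rule ccontr)
    assume "f x \<noteq> 0"
    then have "f x > 0" using f(2)[OF x] by simp
    then obtain r where r: "r > 0" "\<And>y. y \<in> T \<Longrightarrow> dist y x < r \<Longrightarrow> dist (f y) (f x) < f x"
      using f(1) x unfolding continuous_on_iff by meson
    have "interior T \<inter> ball x r \<noteq> {}"
    proof -
      obtain y where "y \<in> interior T" "dist y x < r"
        using T(2) x r(1) closure_approachable by blast
      then have "y \<in> interior T \<inter> ball x r" by (simp add: dist_commute)
      then show ?thesis by blast
    qed
    moreover have "interior T \<inter> ball x r \<subseteq> {x. \<not> (indicator T x *\<^sub>R f x = 0)}"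
    proof
      fix y assume y: "y \<in> interior T \<inter> ball x r"
      then have yT: "y \<in> T" using interior_subset by blast
      have "dist (f y) (f x) < f x" using y yT by (intro r) (auto simp: dist_commute)
      then show "y \<in> {x. \<not> (indicator T x *\<^sub>R f x = 0)}" using yT by (auto simp: dist_real_def)
    qed
    ultimately show False
      using N open_not_negligible[of "interior T \<inter> ball x r"] negligible_subset by blast
  qed
qed (rule T)

text \<open>The orientation of \<open>n\<close> is left free (see \<open>flip\<close>): it depends
  on the element from which the face is seen.\<close>

locale hyperplane_face =
  fixes e :: "(real^'d) set" and n :: "real^'d" and c :: real
  assumes compact_e: "compact e" and n: "norm n = 1"
    and hull: "affine hull e = {z. n \<bullet> z = c}"
begin

definition cp :: "real^'d \<Rightarrow> real^'d" where "cp y = y - (n \<bullet> y - c) *\<^sub>R n"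

lemma nn [simp]: "n \<bullet> n = 1"
  using n by (simp add: norm_eq_1)

lemma n_cp: "n \<bullet> cp y = c"
  by (simp add: cp_def inner_diff_right)

lemma n_e: "x \<in> e \<Longrightarrow> n \<bullet> x = c"
  using hull hull_subset[of e affine] by auto

lemma closest_point_eq: "closest_point (affine hull e) y = cp y"
proof (rule closest_point_unique[symmetric])
  show "convex (affine hull e)" by (simp add: affine_imp_convex)
  show "closed (affine hull e)" by simp
  show "cp y \<in> affine hull e" by (simp add: hull n_cp)
  show "\<forall>z\<in>affine hull e. dist y (cp y) \<le> dist y z"
  proof
    fix z assume "z \<in> affine hull e"
    then have "n \<bullet> (y - z) = n \<bullet> y - c" by (simp add: hull inner_diff_right)
    then have "\<bar>n \<bullet> y - c\<bar> \<le> norm (y - z)" using Cauchy_Schwarz_ineq2[of n "y - z"] n by simp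
    then show "dist y (cp y) \<le> dist y z" by (simp add: dist_norm cp_def n)
  qed
qed

lemma dist_cp_le: "n \<bullet> z = c \<Longrightarrow> dist (cp y) z \<le> dist y z"
proof -
  assume nz: "n \<bullet> z = c"
  have ny: "n \<bullet> y - c = n \<bullet> (y - z)" by (simp add: inner_diff_right nz)
  have "(norm (cp y - z))\<^sup>2 = (norm (y - z))\<^sup>2 - (n \<bullet> (y - z))\<^sup>2"
    unfolding cp_def ny power2_norm_eq_inner
    by (simp add: algebra_simps power2_eq_square inner_commute)
  then have "(norm (cp y - z))\<^sup>2 \<le> (norm (y - z))\<^sup>2" by simp
  then show ?thesis by (simp add: power2_le_iff_abs_le dist_norm)
qed

lemma prism_eq: "prism e = {y. cp y \<in> e \<and> \<bar>n \<bullet> y - c\<bar> \<le> 1/2}"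
  by (simp add: prism_def closest_point_eq dist_norm cp_def n)

lemma continuous_cp: "continuous_on A cp"
  unfolding cp_def by (intro continuous_intros)

lemma compact_prism: "compact (prism e)"
proof -
  obtain b where b: "\<And>x. x \<in> e \<Longrightarrow> norm x \<le> b"
    using compact_imp_bounded[OF compact_e] bounded_iff by blast
  have "norm y \<le> b + 1/2" if "y \<in> prism e" for y
  proof -
    have "norm y \<le> norm (cp y) + norm ((n \<bullet> y - c) *\<^sub>R n)"
      using norm_triangle_ineq[of "cp y" "(n \<bullet> y - c) *\<^sub>R n"] by (simp add: cp_def)
    also have "\<dots> \<le> b + 1/2" using that b n by (intro add_mono) (auto simp: prism_eq)
    finally show ?thesis .
  qed
  then have "bounded (prism e)" by (auto simp: bounded_iff)
  moreover have "closed (cp -` e)"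
    using compact_e continuous_cp by (intro closed_vimage) (auto simp: compact_imp_closed)
  moreover have "closed {y. \<bar>n \<bullet> y - c\<bar> \<le> 1/2}"
    by (intro closed_Collect_le continuous_intros)
  ultimately show ?thesis
    by (auto simp: compact_eq_bounded_closed prism_eq vimage_def Collect_conj_eq)
qed

lemma prism_sets: "prism e \<in> sets borel"
  using compact_prism by (simp add: borel_closed compact_imp_closed)

lemma cp_measurable: "cp \<in> borel_measurable borel"
  by (intro borel_measurable_continuous_onI continuous_cp)

text \<open>The face measure before completion; integrals are computed here, on Borel sets, and then
  carried over to the completion.\<close>

definition fm :: "(real^'d) measure" where "fm = distr (restrict_space lborel (prism e)) borel cp"

lemma face_measure_eq: "face_measure e = completion fm"
proof -
  have "closest_point (affine hull e) = cp" by (rule ext) (rule closest_point_eq)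
  then show ?thesis by (simp add: face_measure_def fm_def)
qed

lemma e_sets: "e \<in> sets borel"
  using compact_e by (simp add: borel_closed compact_imp_closed)

lemma cp_measurable_restrict: "cp \<in> measurable (restrict_space lborel (prism e)) borel"
  using cp_measurable by (simp add: measurable_restrict_space1)

lemma AE_fm: "AE x in fm. x \<in> e"
  unfolding fm_def using e_sets
  by (subst AE_distr_iff[OF cp_measurable_restrict])
    (auto simp: space_restrict_space prism_eq intro!: AE_I2)

text \<open>Off \<open>e\<close> the function is arbitrary, but the measure is concentrated on
  \<open>e\<close>. So \<open>f\<close> agrees almost everywhere with a Borel function, and
  completeness makes it measurable.\<close>

lemma face_measurable:
  fixes f :: "real^'d \<Rightarrow> real"
  assumes "continuous_on e f"
  shows "f \<in> borel_measurable (face_measure e)"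
proof (rule measurableI)
  fix A :: "real set" assume A: "A \<in> sets borel"
  let ?f = "\<lambda>x. indicator e x *\<^sub>R f x"
  have "?f \<in> borel_measurable borel"
    by (intro borel_measurable_continuous_on_indicator e_sets assms)
  then have "?f -` A \<inter> space borel \<in> sets borel" using A by (rule measurable_sets)
  then have fA: "?f -` A \<in> sets (completion fm)" by (intro sets_completionI_sets) (simp add: fm_def)
  have "f -` A \<in> sets (completion fm)"
  proof (rule completion.in_sets_AE[OF _ fA])
    show "AE x in completion fm. (x \<in> ?f -` A) = (x \<in> f -` A)"
      using AE_completion[OF AE_fm] by eventually_elim auto
  qed (simp add: fm_def)
  then show "f -` A \<inter> space (face_measure e) \<in> sets (face_measure e)"
    by (simp add: face_measure_eq fm_def)
qed auto

lemma continuous_on_cp: "continuous_on e f \<Longrightarrow> continuous_on (prism e) (\<lambda>y. f (cp y))"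
  by (rule continuous_on_compose2[OF _ continuous_cp]) (auto simp: prism_eq)

text \<open>Both facts are shown for the Borel function \<open>f'\<close> that is zero off
  \<open>e\<close> and then transferred to \<open>f\<close>, which equals it almost
  everywhere.\<close>

lemma
  fixes f :: "real^'d \<Rightarrow> real"
  assumes f: "continuous_on e f"
  shows integrable_face: "integrable (face_measure e) f"
    and integral_face: "integral\<^sup>L (face_measure e) f = (\<integral>y. indicator (prism e) y * f (cp y) \<partial>lborel)"
proof -
  define f' where "f' = (\<lambda>x. indicator e x *\<^sub>R f x)"
  have f'm: "f' \<in> borel_measurable borel"
    unfolding f'_def by (intro borel_measurable_continuous_on_indicator e_sets f)
  then have f'fm: "f' \<in> borel_measurable fm" by (simp add: fm_def)
  have ae: "AE x in face_measure e. f x = f' x"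
    unfolding face_measure_eq using AE_completion[OF AE_fm] by eventually_elim (simp add: f'_def)
  have f'c: "f' \<in> borel_measurable (face_measure e)"
    unfolding face_measure_eq by (intro measurable_completion f'fm)
  have ps: "prism e \<inter> space lborel \<in> sets lborel" using prism_sets by simp
  have eq: "indicator (prism e) y *\<^sub>R f' (cp y) = indicator (prism e) y * f (cp y)" for y
    by (auto simp: f'_def indicator_def prism_eq)
  have "integrable lborel (\<lambda>y. indicator (prism e) y * f (cp y))"
    using borel_integrable_compact[OF compact_prism continuous_on_cp[OF f]] by simp
  then have "integrable lborel (\<lambda>y. indicator (prism e) y *\<^sub>R f' (cp y))"
    by (simp only: eq)
  then have "integrable fm f'"
    unfolding fm_def
    by (subst integrable_distr_eq[OF cp_measurable_restrict f'm]) (simp add: integrable_restrict_space[OF ps])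
  then have "integrable (face_measure e) f'"
    unfolding face_measure_eq by (simp add: integrable_completion f'fm)
  then show "integrable (face_measure e) f"
    using integrable_cong_AE[OF face_measurable[OF f] f'c ae] by simp
  have "integral\<^sup>L (face_measure e) f = integral\<^sup>L (face_measure e) f'"
    by (rule integral_cong_AE[OF face_measurable[OF f] f'c ae])
  also have "\<dots> = integral\<^sup>L fm f'"
    unfolding face_measure_eq by (rule integral_completion[OF f'fm])
  also have "\<dots> = (\<integral>y. indicator (prism e) y *\<^sub>R f' (cp y) \<partial>lborel)"
    unfolding fm_def by (subst integral_distr[OF cp_measurable_restrict f'm]) (rule integral_restrict_space[OF ps])
  finally show "integral\<^sup>L (face_measure e) f = (\<integral>y. indicator (prism e) y * f (cp y) \<partial>lborel)"
    by (simp only: eq)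
qed

text \<open>A point with \<open>f x > 0\<close> has a relative interior point \<open>z\<close> of
  \<open>e\<close> nearby, and a whole ball around \<open>z\<close> projects to points of
  \<open>e\<close> where \<open>f\<close> is positive; this contradicts negligibility in the full
  space.\<close>

lemma integration_support_face:
  assumes e: "e \<subseteq> closure (rel_interior e)"
  shows "integration_support (face_measure e) e"
proof
  show "AE x in face_measure e. x \<in> e"
    unfolding face_measure_eq by (rule AE_completion[OF AE_fm])
  fix f :: "real^'d \<Rightarrow> real" and x
  assume f: "continuous_on e f" "\<And>x. x \<in> e \<Longrightarrow> 0 \<le> f x" "integral\<^sup>L (face_measure e) f = 0" and x: "x \<in> e"
  have int: "integrable lborel (\<lambda>y. indicator (prism e) y * f (cp y))"
    using borel_integrable_compact[OF compact_prism continuous_on_cp[OF f(1)]] by simp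
  have "AE y in lborel. indicator (prism e) y * f (cp y) = 0"
    using int f(2,3) unfolding integral_face[OF f(1)]
    by (subst (asm) integral_nonneg_eq_0_iff_AE) (auto simp: indicator_def prism_eq)
  then have "AE y in lebesgue. indicator (prism e) y * f (cp y) = 0"
    by (rule AE_completion)
  then have N: "negligible {y. \<not> (indicator (prism e) y * f (cp y) = 0)}"
    by (simp add: negligible_iff_null_sets completion.AE_iff_null_sets)
  show "f x = 0"
  proof (rule ccontr)
    assume "f x \<noteq> 0"
    then have "f x > 0" using f(2)[OF x] by simp
    then obtain r where r: "r > 0" "\<And>y. y \<in> e \<Longrightarrow> dist y x < r \<Longrightarrow> dist (f y) (f x) < f x"
      using f(1) x unfolding continuous_on_iff by meson
    obtain z where z: "z \<in> rel_interior e" "dist z x < r"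
      using e x r(1) closure_approachable by blast
    obtain s where s: "s > 0" "ball z s \<inter> affine hull e \<subseteq> e"
      using z(1) unfolding mem_rel_interior_ball by blast
    \<comment> \<open>The three bounds keep the projection in \<open>e\<close>, keep it within
      \<open>r\<close> of \<open>x\<close>, and keep the ball inside the prism of half-height
      1/2.\<close>
    define t where "t = min s (min (r - dist z x) (1/2))"
    have t: "t > 0" using s z by (simp add: t_def)
    have "ball z t \<subseteq> {y. \<not> (indicator (prism e) y * f (cp y) = 0)}"
    proof
      fix y assume "y \<in> ball z t"
      then have yz: "norm (y - z) < t" by (simp add: dist_norm norm_minus_commute)
      have nz: "n \<bullet> z = c" using z(1) rel_interior_subset n_e by blast
      have ny: "n \<bullet> y - c = n \<bullet> (y - z)" by (simp add: inner_diff_right nz)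
      then have 1: "\<bar>n \<bullet> y - c\<bar> \<le> 1/2"
        using Cauchy_Schwarz_ineq2[of n "y - z"] n yz by (simp add: t_def)
      have cz: "dist (cp y) z < t" using dist_cp_le[OF nz, of y] yz by (simp add: dist_norm)
      then have ce: "cp y \<in> e"
        using s(2) by (auto simp: hull n_cp t_def dist_commute)
      have "dist (cp y) x < r" using cz dist_triangle[of "cp y" x z] by (simp add: t_def)
      from r(2)[OF ce this] show "y \<in> {y. \<not> (indicator (prism e) y * f (cp y) = 0)}"
        using 1 ce by (auto simp: prism_eq dist_real_def)
    qed
    then have "negligible (ball z t)" by (rule negligible_subset[OF N])
    then show False
      using open_not_negligible[of "ball z t"] t by simp
  qed
qed (auto intro: compact_e integrable_face)

text \<open>Translating \<open>e\<close> along \<open>v\<close> sweeps out a skew prism of height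
  \<open>\<bar>n \<bullet> v\<bar>\<close>. An affine shear carries the right prism that defines
  \<open>face_measure\<close> onto it, and its linear part
  \<open>z + (n \<bullet> z) *\<^sub>R (v - n)\<close> has determinant \<open>n \<bullet> v\<close>.
  The number \<open>s v y\<close> is the multiple of \<open>v\<close> that leads from the plane of
  \<open>e\<close> to \<open>y\<close>.\<close>

lemma integral_face_skew:
  fixes f :: "real^'d \<Rightarrow> real"
  defines "s \<equiv> \<lambda>v y. (n \<bullet> y - c) / (n \<bullet> v)"
  assumes d: "CARD('d) = 2 \<or> CARD('d) = 3" and nv: "n \<bullet> v \<noteq> 0" and f: "continuous_on e f"
  defines "G \<equiv> \<lambda>y. indicator {y. 0 \<le> s v y \<and> s v y \<le> 1 \<and> y - s v y *\<^sub>R v \<in> e} y * f (y - s v y *\<^sub>R v)"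
  shows "integrable lborel G" "integral\<^sup>L lborel G = \<bar>n \<bullet> v\<bar> * integral\<^sup>L (face_measure e) f"
proof -
  define R where "R = {y. 0 \<le> s v y \<and> s v y \<le> 1 \<and> y - s v y *\<^sub>R v \<in> e}"
  have cs: "continuous_on A (s v)" for A unfolding s_def by (intro continuous_intros) (use nv in auto)
  have "compact R"
  proof -
    have "R \<subseteq> (\<lambda>(t, x). x + t *\<^sub>R v) ` ({0..1} \<times> e)"
    proof
      fix y assume "y \<in> R"
      then show "y \<in> (\<lambda>(t, x). x + t *\<^sub>R v) ` ({0..1} \<times> e)"
        by (intro image_eqI[of _ _ "(s v y, y - s v y *\<^sub>R v)"]) (auto simp: R_def)
    qed
    moreover have "compact ((\<lambda>(t::real, x). x + t *\<^sub>R v) ` ({0..1} \<times> e))"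
      by (intro compact_continuous_image compact_Times compact_e)
        (auto simp: case_prod_unfold intro!: continuous_intros)
    ultimately have "bounded R" using bounded_subset compact_imp_bounded by blast
    moreover have "closed {y. 0 \<le> s v y}" "closed {y. s v y \<le> 1}"
      by (intro closed_Collect_le cs continuous_intros)+
    moreover have "closed ((\<lambda>y. y - s v y *\<^sub>R v) -` e)"
      using compact_e by (intro closed_vimage) (auto simp: compact_imp_closed intro!: continuous_intros cs)
    ultimately show ?thesis
      by (auto simp: compact_eq_bounded_closed R_def vimage_def Collect_conj_eq)
  qed
  moreover have "continuous_on R (\<lambda>y. f (y - s v y *\<^sub>R v))"
    by (rule continuous_on_compose2[OF f]) (auto simp: R_def intro!: continuous_intros cs)
  ultimately have "integrable lborel (\<lambda>y. indicator R y *\<^sub>R f (y - s v y *\<^sub>R v))"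
    by (rule borel_integrable_compact)
  then show iG: "integrable lborel G" by (simp add: G_def R_def)
  then have Gm: "G \<in> borel_measurable borel" by simp
  \<comment> \<open>With this shift the shear sends \<open>z\<close> to
    \<open>cp z + (n \<bullet> z - c + 1/2) *\<^sub>R v\<close>: the heights from -1/2 to 1/2 in the
    right prism become the multiples of \<open>v\<close> from 0 to 1.\<close>
  define w where "w = (1/2) *\<^sub>R v - c *\<^sub>R (v - n)"
  have nw: "1 + n \<bullet> (v - n) = n \<bullet> v" by (simp add: inner_diff_right)
  have "integral\<^sup>L lborel G = (\<integral>y. G (w + y) \<partial>lborel)"
    using lborel_integral_translate(2)[OF Gm] by simp
  also have "\<dots> = \<bar>n \<bullet> v\<bar> * (\<integral>z. G (w + (z + (n \<bullet> z) *\<^sub>R (v - n))) \<partial>lborel)"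
    using lborel_integral_rank_one[OF d n, of "v - n" "\<lambda>y. G (w + y)"] nv iG
    by (simp add: nw lborel_integral_translate(1)[OF Gm])
  also have "(\<lambda>z. G (w + (z + (n \<bullet> z) *\<^sub>R (v - n)))) = (\<lambda>z. indicator (prism e) z * f (cp z))"
  proof
    fix z
    define y where "y = w + (z + (n \<bullet> z) *\<^sub>R (v - n))"
    have "n \<bullet> y - c = (n \<bullet> v) * (n \<bullet> z - c + 1/2)"
      by (simp add: y_def w_def algebra_simps)
    then have sy: "s v y = n \<bullet> z - c + 1/2" using nv by (simp add: s_def)
    have py: "y - s v y *\<^sub>R v = cp z"
      unfolding sy by (simp add: y_def w_def cp_def algebra_simps)
    have "0 \<le> s v y \<and> s v y \<le> 1 \<longleftrightarrow> \<bar>n \<bullet> z - c\<bar> \<le> 1/2"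
      unfolding sy abs_le_iff by linarith
    then have "y \<in> R \<longleftrightarrow> z \<in> prism e"
      unfolding R_def prism_eq mem_Collect_eq py by blast
    then show "G (w + (z + (n \<bullet> z) *\<^sub>R (v - n))) = indicator (prism e) z * f (cp z)"
      unfolding G_def y_def[symmetric] R_def[symmetric] py by (simp add: indicator_def)
  qed
  finally show "integral\<^sup>L lborel G = \<bar>n \<bullet> v\<bar> * integral\<^sup>L (face_measure e) f"
    by (simp add: integral_face[OF f])
qed

end

section \<open>Generic points and normals of polytopal faces\<close>

text \<open>A pair \<open>(a, b)\<close> stands for the hyperplane \<open>a \<bullet> y = b\<close>.\<close>

definition determined_by :: "((real^'d) \<times> real) set \<Rightarrow> (real^'d) set \<Rightarrow> bool" where
  "determined_by H S \<longleftrightarrow>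
    (\<forall>y z. (\<forall>(a, b)\<in>H. sgn (a \<bullet> y - b) = sgn (a \<bullet> z - b)) \<longrightarrow> y \<in> S \<longrightarrow> z \<in> S)"

text \<open>No plane of \<open>H\<close> passes through \<open>x\<close> except possibly the one
  with normal \<open>n\<close>. A set with \<open>determined_by H S\<close> is a union of cells of
  the arrangement \<open>H\<close>, so near a generic point membership depends only on the position
  relative to that one plane.\<close>

definition generic_at :: "((real^'d) \<times> real) set \<Rightarrow> real^'d \<Rightarrow> real^'d \<Rightarrow> bool" where
  "generic_at H x n \<longleftrightarrow> (\<forall>(a, b)\<in>H. a \<bullet> x = b \<longrightarrow> (\<exists>\<kappa>. a = \<kappa> *\<^sub>R n))"

lemma determined_by_mono: "determined_by H S \<Longrightarrow> H \<subseteq> H' \<Longrightarrow> determined_by H' S"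
  unfolding determined_by_def by blast

lemma determined_by_Union: "(\<And>S. S \<in> \<S> \<Longrightarrow> determined_by H S) \<Longrightarrow> determined_by H (\<Union>\<S>)"
  unfolding determined_by_def by blast

lemma determined_by_common:
  assumes "finite \<S>" "\<And>S. S \<in> \<S> \<Longrightarrow> \<exists>H. finite H \<and> (\<forall>(a, b)\<in>H. a \<noteq> 0) \<and> determined_by H S"
  shows "\<exists>H. finite H \<and> (\<forall>(a, b)\<in>H. a \<noteq> 0) \<and> (\<forall>S\<in>\<S>. determined_by H S)"
  using assms
proof (induction \<S> rule: finite_induct)
  case empty
  then show ?case by blast
next
  case (insert S \<S>)
  obtain H where H: "finite H" "\<forall>(a, b)\<in>H. a \<noteq> 0" "determined_by H S" using insert.prems by blast
  obtain K where K: "finite K" "\<forall>(a, b)\<in>K. a \<noteq> 0" "\<forall>S\<in>\<S>. determined_by K S"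
    using insert.IH insert.prems by blast
  show ?case
    by (rule exI[of _ "H \<union> K"]) (use H K in \<open>auto intro: determined_by_mono\<close>)
qed

text \<open>A polytope is a finite intersection of half spaces, and the sign of
  \<open>a \<bullet> x - b\<close> decides membership in each of them.\<close>

lemma polytope_determined_by:
  fixes P :: "(real^'d) set"
  assumes "polytope P"
  shows "\<exists>H. finite H \<and> (\<forall>(a, b)\<in>H. a \<noteq> 0) \<and> determined_by H P"
proof -
  obtain F where F: "finite F" "P = \<Inter>F" "\<forall>h\<in>F. \<exists>a b. a \<noteq> 0 \<and> h = {x. a \<bullet> x \<le> b}"
    using polytope_imp_polyhedron[OF assms] unfolding polyhedron_def by blast
  obtain a b where ab: "\<And>h. h \<in> F \<Longrightarrow> a h \<noteq> 0 \<and> h = {x. a h \<bullet> x \<le> b h}"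
    using F(3) by metis
  have "determined_by ((\<lambda>h. (a h, b h)) ` F) P"
    unfolding determined_by_def
  proof (intro allI impI)
    fix y z assume s: "\<forall>(a, b)\<in>(\<lambda>h. (a h, b h)) ` F. sgn (a \<bullet> y - b) = sgn (a \<bullet> z - b)"
      and y: "y \<in> P"
    have "z \<in> h" if h: "h \<in> F" for h
    proof -
      have "a h \<bullet> y \<le> b h" using y F(2) h ab[OF h] by blast
      moreover have "sgn (a h \<bullet> y - b h) = sgn (a h \<bullet> z - b h)" using s h by auto
      ultimately have "a h \<bullet> z \<le> b h" by (auto simp: sgn_if split: if_splits)
      then show ?thesis using ab[OF h] by blast
    qed
    then show "z \<in> P" using F(2) by blast
  qed
  then show ?thesis using F(1) ab by (intro exI[of _ "(\<lambda>h. (a h, b h)) ` F"]) auto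
qed

lemma polytopal_determined_by:
  assumes "polytopal m S"
  shows "\<exists>H. finite H \<and> (\<forall>(a, b)\<in>H. a \<noteq> 0) \<and> determined_by H S"
proof -
  obtain \<P> where P: "finite \<P>" "\<And>P. P \<in> \<P> \<Longrightarrow> polytope P" "S = \<Union>\<P>"
    using assms unfolding polytopal_def by blast
  have "\<exists>H. finite H \<and> (\<forall>(a, b)\<in>H. a \<noteq> 0) \<and> (\<forall>P\<in>\<P>. determined_by H P)"
    using P(1) polytope_determined_by[OF P(2)] by (rule determined_by_common)
  then show ?thesis unfolding P(3) using determined_by_Union by blast
qed

lemma polytopal_compact: "polytopal m S \<Longrightarrow> compact S"
  unfolding polytopal_def by (auto intro!: compact_Union simp: polytope_imp_compact)

text \<open>Each convex piece has the same dimension, hence the same affine hull, as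
  \<open>S\<close>. Its relative interior then lies in that of \<open>S\<close>, and a convex piece
  is in the closure of its relative interior.\<close>

lemma polytopal_closure_rel_interior:
  assumes "polytopal m S"
  shows "S \<subseteq> closure (rel_interior S)"
proof -
  obtain \<P> where P: "\<And>P. P \<in> \<P> \<Longrightarrow> polytope P" "\<And>P. P \<in> \<P> \<Longrightarrow> aff_dim P = int m" "S = \<Union>\<P>"
    using assms unfolding polytopal_def by blast
  have "P \<subseteq> closure (rel_interior S)" if "P \<in> \<P>" for P
  proof -
    have "P \<subseteq> S" using P that by blast
    moreover have "affine hull P = affine hull S"
      using aff_dim_eq_full_gen[OF \<open>P \<subseteq> S\<close>] P(2)[OF that] assms by (simp add: polytopal_def)
    ultimately have "rel_interior P \<subseteq> rel_interior S" by (rule rel_interior_mono)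
    moreover have "P \<subseteq> closure (rel_interior P)"
      using P(1)[OF that] convex_closure_rel_interior closure_subset polytope_imp_convex by metis
    ultimately show ?thesis using closure_mono by blast
  qed
  then show ?thesis using P(3) by blast
qed

lemma polytopal_rel_interior_nonempty:
  assumes "polytopal m S"
  shows "rel_interior S \<noteq> {}"
proof -
  \<comment> \<open>The empty set has affine dimension -1, which differs from
    \<open>int m\<close>.\<close>
  have "S \<noteq> {}" using assms unfolding polytopal_def by (metis aff_dim_empty int_ops(1) less_eq_nat.simps(1) negative_zle nle_le of_nat_0_le_iff zero_neq_neg_one le_minus_one_simps(3))
  then show ?thesis using polytopal_closure_rel_interior[OF assms] by fastforce
qed

lemma polytopal_full_interior:
  fixes S :: "(real^'d) set"
  assumes "polytopal CARD('d) S"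
  shows "S \<subseteq> closure (interior S)" "interior S \<noteq> {}"
  using polytopal_closure_rel_interior[OF assms] polytopal_rel_interior_nonempty[OF assms]
    interior_rel_interior[of S] assms by (simp_all add: polytopal_def)

lemma polytopal_hyperplane:
  fixes e :: "(real^'d) set"
  assumes "polytopal (CARD('d) - 1) e"
  shows "\<exists>n c. hyperplane_face e n c"
proof -
  have "aff_dim e = DIM(real^'d) - 1"
    using assms by (simp add: polytopal_def of_nat_diff Suc_leI)
  then obtain a b where a: "a \<noteq> 0" "affine hull e = {x. a \<bullet> x = b}"
    using aff_dim_eq_hyperplane[of e] by auto
  have "hyperplane_face e (a /\<^sub>R norm a) (b / norm a)"
  proof
    show "compact e" using assms by (rule polytopal_compact)
    show "affine hull e = {z. (a /\<^sub>R norm a) \<bullet> z = b / norm a}" using a by (simp add: field_simps)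
  qed (use a in simp)
  then show ?thesis by blast
qed

lemma eventually_nhds_sgn:
  fixes a :: "'a::euclidean_space"
  assumes "finite H"
  shows "\<forall>\<^sub>F y in nhds x. \<forall>(a, b)\<in>H. a \<bullet> x \<noteq> b \<longrightarrow> sgn (a \<bullet> y - b) = sgn (a \<bullet> (x::'a) - b)"
  using assms
proof (rule eventually_ball_finite, intro ballI)
  fix h assume "h \<in> H"
  obtain a b where h: "h = (a, b)" by fastforce
  have lim: "((\<lambda>y. a \<bullet> y - b) \<longlongrightarrow> a \<bullet> x - b) (nhds x)"
    by (intro tendsto_intros) (simp add: filterlim_ident)
  show "\<forall>\<^sub>F y in nhds x. case h of (a, b) \<Rightarrow> a \<bullet> x \<noteq> b \<longrightarrow> sgn (a \<bullet> y - b) = sgn (a \<bullet> x - b)"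
  proof (cases "a \<bullet> x - b" "0::real" rule: linorder_cases)
    case less
    show ?thesis using order_tendstoD(2)[OF lim less] by eventually_elim (use less in \<open>simp add: h\<close>)
  next
    case equal
    then show ?thesis by (simp add: h)
  next
    case greater
    show ?thesis using order_tendstoD(1)[OF lim greater] by eventually_elim (use greater in \<open>simp add: h\<close>)
  qed
qed

text \<open>Close to \<open>x\<close> the planes not through \<open>x\<close> keep their sign, and
  the others have normals parallel to \<open>n\<close>, so the sign of
  \<open>n \<bullet> (y - x)\<close> is all that remains.\<close>

lemma determined_by_local:
  fixes x :: "real^'d"
  assumes "finite H" "determined_by H S" "generic_at H x n"
  obtains r where "r > 0" "\<And>y z. y \<in> ball x r \<Longrightarrow> z \<in> ball x r \<Longrightarrow>
    sgn (n \<bullet> (y - x)) = sgn (n \<bullet> (z - x)) \<Longrightarrow> y \<in> S \<Longrightarrow> z \<in> S"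
proof -
  obtain r where r0: "r > 0" "\<forall>y. dist y x < r \<longrightarrow>
      (\<forall>(a, b)\<in>H. a \<bullet> x \<noteq> b \<longrightarrow> sgn (a \<bullet> y - b) = sgn (a \<bullet> x - b))"
    using eventually_nhds_sgn[OF assms(1), of x] unfolding eventually_nhds_metric by (elim exE conjE)
  then have r: "r > 0" "\<And>y. y \<in> ball x r \<Longrightarrow>
      \<forall>(a, b)\<in>H. a \<bullet> x \<noteq> b \<longrightarrow> sgn (a \<bullet> y - b) = sgn (a \<bullet> x - b)"
    by (simp_all add: dist_commute)
  have "z \<in> S" if yz: "y \<in> ball x r" "z \<in> ball x r" "sgn (n \<bullet> (y - x)) = sgn (n \<bullet> (z - x))" "y \<in> S" for y z
  proof -
    have "sgn (a \<bullet> y - b) = sgn (a \<bullet> z - b)" if ab: "(a, b) \<in> H" for a b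
    proof (cases "a \<bullet> x = b")
      case True
      then obtain \<kappa> where k: "a = \<kappa> *\<^sub>R n" using assms(3) ab unfolding generic_at_def by blast
      have "a \<bullet> w - b = \<kappa> * (n \<bullet> (w - x))" for w
        using True by (simp add: k inner_diff_right algebra_simps)
      then show ?thesis using yz(3) by (simp add: sgn_mult)
    next
      case False
      then show ?thesis using r(2)[OF yz(1)] r(2)[OF yz(2)] ab by fastforce
    qed
    then show ?thesis using assms(2) yz(4) unfolding determined_by_def by blast
  qed
  then show ?thesis by (rule that[OF r(1)])
qed

text \<open>For step sizes: scaling a vector of norm \<open>a\<close> by
  \<open>r / (2 * (a + 1))\<close> makes it shorter than \<open>r\<close>; the summand 1 covers
  \<open>a = 0\<close>.\<close>

lemma scaled_less:
  fixes a r :: real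
  assumes "0 < r" "0 \<le> a"
  shows "r / (2 * (a + 1)) * a < r"
proof -
  have "a / (2 * (a + 1)) < 1" using assms(2) by (simp add: divide_simps)
  then have "r * (a / (2 * (a + 1))) < r * 1" using assms(1) by (intro mult_strict_left_mono)
  then show ?thesis by simp
qed

section \<open>Relative interior, generic points and normals of a single face\<close>

context hyperplane_face
begin

lemma rel_interiorI:
  assumes "x \<in> e" "r > 0" "\<And>y. y \<in> ball x r \<Longrightarrow> n \<bullet> y = c \<Longrightarrow> y \<in> e"
  shows "x \<in> rel_interior e"
  unfolding mem_rel_interior_ball using assms by (auto simp: hull)

lemma rel_interiorE:
  assumes "x \<in> rel_interior e"
  obtains r where "r > 0" "\<And>y. y \<in> ball x r \<Longrightarrow> n \<bullet> y = c \<Longrightarrow> y \<in> e"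
proof -
  obtain r where r: "r > 0" "ball x r \<inter> affine hull e \<subseteq> e"
    using assms unfolding mem_rel_interior_ball by blast
  show ?thesis by (rule that[OF r(1)]) (use r(2) hull in blast)
qed

text \<open>Almost every point of the face avoids the planes of \<open>H\<close> not parallel to it.
  To argue with volume in the full space, a point \<open>y\<close> near \<open>x0\<close> is taken
  off a negligible set and then projected to the face.\<close>

lemma generic_point_exists:
  assumes H: "finite H" and x0: "x0 \<in> rel_interior e"
  shows "\<exists>x\<in>rel_interior e. generic_at H x n"
proof -
  obtain s where s: "s > 0" "\<And>y. y \<in> ball x0 s \<Longrightarrow> n \<bullet> y = c \<Longrightarrow> y \<in> e"
    using x0 by (rule rel_interiorE) blast
  have nx0: "n \<bullet> x0 = c" using x0 rel_interior_subset n_e by blast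
  \<comment> \<open>\<open>a' a\<close> is the part of \<open>a\<close> tangential to the face. When
    it is nonzero, \<open>a \<bullet> cp y = b\<close> is the equation of a hyperplane in
    \<open>y\<close>.\<close>
  define a' where "a' = (\<lambda>a. a - (a \<bullet> n) *\<^sub>R n)"
  define N where "N = (\<Union>(a, b)\<in>{h \<in> H. a' (fst h) \<noteq> 0}. {y. a' a \<bullet> y = b - (a \<bullet> n) * c})"
  have "negligible N"
    unfolding N_def using H by (intro negligible_Union finite_imageI) (auto intro!: negligible_hyperplane)
  then have "\<not> ball x0 s \<subseteq> N"
    using open_not_negligible[of "ball x0 s"] negligible_subset[of N "ball x0 s"] s(1) by auto
  then obtain y where y: "y \<in> ball x0 s" "y \<notin> N" by blast
  define x where "x = cp y"
  have xs: "x \<in> ball x0 s" using dist_cp_le[OF nx0, of y] y(1) by (simp add: x_def dist_commute)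
  have "x \<in> rel_interior e"
  proof (rule rel_interiorI)
    show "x \<in> e" using s(2)[OF xs] n_cp by (simp add: x_def)
    show "s - dist x0 x > 0" using xs by simp
    show "z \<in> e" if "z \<in> ball x (s - dist x0 x)" "n \<bullet> z = c" for z
      using that dist_triangle[of x0 z x] by (intro s(2)) auto
  qed
  moreover have "generic_at H x n"
    unfolding generic_at_def
  proof (clarify)
    fix a assume ab: "(a, a \<bullet> x) \<in> H"
    have "a \<bullet> x = a' a \<bullet> y + (a \<bullet> n) * c"
      by (simp add: x_def cp_def a'_def algebra_simps inner_commute)
    then have "a' a = 0" using y(2) ab unfolding N_def by force
    then have "a = (a \<bullet> n) *\<^sub>R n" by (simp add: a'_def)
    then show "\<exists>\<kappa>. a = \<kappa> *\<^sub>R n" by blast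
  qed
  ultimately show ?thesis by blast
qed

lemma pyramid_point:
  assumes "pyramid A e \<subseteq> T" "x \<in> e" "r > 0"
  obtains t where "0 < t" "t \<le> 1" "x + t *\<^sub>R (A - x) \<in> T" "x + t *\<^sub>R (A - x) \<in> ball x r"
proof -
  define t where "t = min 1 (r / (2 * (norm (A - x) + 1)))"
  have t: "0 < t" "t \<le> 1" using assms(3) by (auto simp: t_def add_nonneg_pos)
  have "x + t *\<^sub>R (A - x) = (1 - (1 - t)) *\<^sub>R A + (1 - t) *\<^sub>R x"
    by (simp add: algebra_simps)
  then have "x + t *\<^sub>R (A - x) \<in> pyramid A e"
    unfolding pyramid_def using t assms(2)
    by (intro CollectI exI[of _ "1 - t"] exI[of _ x]) auto
  moreover have "t * norm (A - x) < r"
  proof -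
    have "t * norm (A - x) \<le> r / (2 * (norm (A - x) + 1)) * norm (A - x)"
      by (intro mult_right_mono) (auto simp: t_def)
    also have "\<dots> < r" using assms(3) by (intro scaled_less) auto
    finally show ?thesis .
  qed
  then have "x + t *\<^sub>R (A - x) \<in> ball x r" using t by (simp add: dist_norm)
  ultimately show ?thesis using that t assms(1) by blast
qed

text \<open>Near \<open>x\<close> membership in \<open>T\<close> depends only on the sign of
  \<open>n \<bullet> (y - x)\<close>. The sign 0 is inside because \<open>x\<close> is, the negative
  sign because points of the pyramid are, and the positive sign is outside because otherwise
  \<open>x\<close> would be an interior point.\<close>

lemma outward_normal_generic:
  assumes H: "finite H" "determined_by H T" "generic_at H x n" and x: "x \<in> e"
    and e: "e \<subseteq> frontier T" and T: "closed T" and A: "pyramid A e \<subseteq> T" "n \<bullet> A < c"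
  shows "outward_normal_at T x n"
proof -
  obtain r where r: "r > 0" "\<And>y z. y \<in> ball x r \<Longrightarrow> z \<in> ball x r \<Longrightarrow>
      sgn (n \<bullet> (y - x)) = sgn (n \<bullet> (z - x)) \<Longrightarrow> y \<in> T \<Longrightarrow> z \<in> T"
    using H by (rule determined_by_local) blast
  have xT: "x \<in> T" using x e T frontier_subset_closed by blast
  have xi: "x \<notin> interior T" using x e by (auto simp: frontier_def)
  obtain t where t: "0 < t" "x + t *\<^sub>R (A - x) \<in> T" "x + t *\<^sub>R (A - x) \<in> ball x r"
    using A(1) x r(1) by (rule pyramid_point)
  have st: "sgn (n \<bullet> (x + t *\<^sub>R (A - x) - x)) = -1"
    using t(1) A(2) n_e[OF x] by (simp add: inner_diff_right mult_pos_neg)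
  have neg: "y \<in> T" if "y \<in> ball x r" "n \<bullet> (y - x) \<le> 0" for y
  proof (cases "n \<bullet> (y - x) = 0")
    case True
    then show ?thesis using r(2)[of x y] that xT r(1) by simp
  next
    case False
    then have "sgn (n \<bullet> (y - x)) = -1" using that by simp
    then show ?thesis using r(2)[OF t(3) that(1) _ t(2)] st by simp
  qed
  have "\<not> n \<bullet> (y - x) > 0" if y: "y \<in> ball x r" "y \<in> T" for y
  proof
    assume p: "n \<bullet> (y - x) > 0"
    have "z \<in> T" if "z \<in> ball x r" for z
      using r(2)[OF y(1) that _ y(2)] neg[OF that] p by (cases "n \<bullet> (z - x) > 0") auto
    then have "ball x r \<subseteq> T" by blast
    then show False using xi r(1) mem_interior by blast
  qed
  then have "T \<inter> ball x r = {y \<in> ball x r. (y - x) \<bullet> n \<le> 0}"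
    using neg by (auto simp: inner_commute not_less)
  then show ?thesis unfolding outward_normal_at_def using n r(1) by blast
qed

text \<open>Needed because \<open>face_normal\<close> is chosen at some relative interior point that
  need not be generic. Near it the face is a flat piece of \<open>T\<close>, so a normal is
  orthogonal to all tangential directions, and the apex of the pyramid fixes its sign.\<close>

lemma outward_normal_unique:
  assumes out: "outward_normal_at T x \<nu>" and x: "x \<in> rel_interior e"
    and e: "e \<subseteq> T" and A: "pyramid A e \<subseteq> T" "n \<bullet> A < c"
  shows "\<nu> = n"
proof -
  obtain r where nu: "norm \<nu> = 1" and r: "r > 0" "T \<inter> ball x r = {y \<in> ball x r. (y - x) \<bullet> \<nu> \<le> 0}"
    using out unfolding outward_normal_at_def by blast
  obtain s where s: "s > 0" "\<And>y. y \<in> ball x s \<Longrightarrow> n \<bullet> y = c \<Longrightarrow> y \<in> e"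
    using x by (rule rel_interiorE) blast
  have xe: "x \<in> e" using x rel_interior_subset by blast
  have le: "w \<bullet> \<nu> \<le> 0" if w: "n \<bullet> w = 0" for w
  proof -
    define t where "t = min r s / (2 * (norm w + 1))"
    have t: "t > 0" using r s by (simp add: t_def add_nonneg_pos)
    have "t * norm w < min r s"
      unfolding t_def by (intro scaled_less) (use r(1) s(1) in auto)
    then have b: "x + t *\<^sub>R w \<in> ball x r" "x + t *\<^sub>R w \<in> ball x s" using t by (auto simp: dist_norm)
    have "x + t *\<^sub>R w \<in> e" using b(2) n_e[OF xe] w by (intro s(2)) (auto simp: inner_add_right)
    then have "x + t *\<^sub>R w \<in> T \<inter> ball x r" using e b(1) by blast
    then have "(x + t *\<^sub>R w - x) \<bullet> \<nu> \<le> 0" unfolding r(2) by blast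
    then show ?thesis using t by (simp add: mult_le_0_iff)
  qed
  define w where "w = \<nu> - (\<nu> \<bullet> n) *\<^sub>R n"
  have nw: "n \<bullet> w = 0" by (simp add: w_def inner_diff_right inner_commute)
  have "w \<bullet> \<nu> = 0" using le[OF nw] le[of "-w"] nw by simp
  moreover have "w \<bullet> w = w \<bullet> \<nu> - (\<nu> \<bullet> n) * (n \<bullet> w)"
    by (simp add: w_def algebra_simps inner_commute)
  ultimately have "w \<bullet> w = 0" using nw by simp
  then have nu_eq: "\<nu> = (\<nu> \<bullet> n) *\<^sub>R n" by (simp add: w_def)
  then have a1: "\<bar>\<nu> \<bullet> n\<bar> = 1" using nu n by (metis abs_1 mult.right_neutral norm_scaleR)
  obtain t where t: "0 < t" "x + t *\<^sub>R (A - x) \<in> T" "x + t *\<^sub>R (A - x) \<in> ball x r"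
    using A(1) xe r(1) by (rule pyramid_point)
  then have "x + t *\<^sub>R (A - x) \<in> T \<inter> ball x r" by blast
  then have "(x + t *\<^sub>R (A - x) - x) \<bullet> \<nu> \<le> 0" unfolding r(2) by blast
  then have "(A - x) \<bullet> \<nu> \<le> 0" using t(1) by (simp add: mult_le_0_iff)
  moreover have "(A - x) \<bullet> \<nu> = (\<nu> \<bullet> n) * (n \<bullet> A - c)"
    by (subst nu_eq) (simp add: inner_diff_left inner_diff_right n_e[OF xe, symmetric] inner_commute)
  ultimately have "\<nu> \<bullet> n \<ge> 0" using A(2) by (simp add: mult_le_0_iff)
  then show ?thesis using a1 nu_eq by simp
qed

lemma flip: "hyperplane_face e (- n) (- c)"
  by unfold_locales (auto simp: compact_e n hull)

end

section \<open>The divergence theorem on an element\<close>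

text \<open>The fundamental theorem on a set \<open>S\<close> of times that switches at finitely
  many \<open>s j\<close>, where \<open>\<epsilon> j = 1\<close> marks an end of \<open>S\<close>
  and \<open>\<epsilon> j = -1\<close> a beginning. The description is local, so the switching times
  need not be ordered.\<close>

lemma has_integral_indicator_deriv:
  fixes q q' :: "real \<Rightarrow> real" and s \<epsilon> :: "'j \<Rightarrow> real"
  assumes J: "finite J" "\<And>j. j \<in> J \<Longrightarrow> 0 < s j \<and> s j < 1" "inj_on s J" "\<And>j. j \<in> J \<Longrightarrow> \<epsilon> j = 1 \<or> \<epsilon> j = -1"
    and off: "\<And>t. t \<in> {0..1} \<Longrightarrow> t \<notin> s ` J \<Longrightarrow> \<forall>\<^sub>F u in nhds t. u \<in> S \<longleftrightarrow> t \<in> S"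
    and on: "\<And>j. j \<in> J \<Longrightarrow> \<forall>\<^sub>F u in nhds (s j). u \<in> S \<longleftrightarrow> \<epsilon> j * (u - s j) \<le> 0"
    and q: "\<And>t. (q has_real_derivative q' t) (at t)"
  shows "((\<lambda>t. indicator S t * q' t) has_integral
    q 1 * indicator S 1 - q 0 * indicator S 0 + (\<Sum>j\<in>J. \<epsilon> j * q (s j))) {0..1}"
proof -
  \<comment> \<open>\<open>g j\<close> is a step function cancelling the jump of
    \<open>q t * indicator S t\<close> at \<open>s j\<close>. As \<open>s j\<close> itself belongs
    to \<open>S\<close>, the inequality is strict at an end of \<open>S\<close> and not strict at a
    beginning.\<close>
  define g where "g = (\<lambda>j t. if \<epsilon> j = 1 then (if s j < t then q (s j) else 0)
      else (if s j \<le> t then - q (s j) else 0))"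
  define G where "G = (\<lambda>t. q t * indicator S t + (\<Sum>j\<in>J. g j t))"
  have lc: "\<forall>\<^sub>F u in nhds t. g j u = g j t" if "t \<noteq> s j" for j t
  proof (cases "s j < t")
    case True
    show ?thesis using order_tendstoD(1)[OF filterlim_ident True] by eventually_elim (use True in \<open>simp add: g_def\<close>)
  next
    case False
    then have "t < s j" using that by simp
    from order_tendstoD(2)[OF filterlim_ident this] show ?thesis
      by eventually_elim (use \<open>t < s j\<close> in \<open>simp add: g_def\<close>)
  qed
  have der: "(G has_real_derivative indicator S t * q' t) (at t)" if t: "t \<in> {0..1}" "t \<notin> s ` J" for t
  proof -
    have "\<forall>\<^sub>F u in nhds t. \<forall>j\<in>J. g j u = g j t"
      using J(1) t(2) by (intro eventually_ball_finite ballI lc) auto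
    with off[OF t] have ev: "\<forall>\<^sub>F u in nhds t. G u = q u * indicator S t + (\<Sum>j\<in>J. g j t)"
      by eventually_elim (simp add: G_def indicator_def)
    have "((\<lambda>u. q u * indicator S t + (\<Sum>j\<in>J. g j t)) has_real_derivative indicator S t * q' t) (at t)"
      using q[of t] by (auto intro!: derivative_eq_intros)
    then show ?thesis using DERIV_cong_ev[OF refl ev refl] by simp
  qed
  have cont: "isCont G t" if t: "t \<in> {0..1}" for t
  proof (cases "t \<in> s ` J")
    case False
    then show ?thesis using der[OF t] DERIV_isCont by blast
  next
    case True
    then obtain j where j: "j \<in> J" "t = s j" by blast
    have "\<forall>\<^sub>F u in nhds t. \<forall>i\<in>J - {j}. g i u = g i t"
      using J(1,3) j by (intro eventually_ball_finite ballI lc) (auto simp: inj_on_def)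
    \<comment> \<open>Near \<open>t\<close>, up to a constant, \<open>G\<close> is \<open>q\<close>
      frozen after \<open>t\<close> (at an end) or before \<open>t\<close> (at a beginning), hence
      continuous.\<close>
    with on[OF j(1), folded j(2)]
    have ev: "\<forall>\<^sub>F u in nhds t. G u = (if \<epsilon> j = 1 then q (min u t) else q (max u t) - q t) + (\<Sum>i\<in>J - {j}. g i t)"
    proof eventually_elim
      case (elim u)
      have "G u = q u * indicator S u + g j u + (\<Sum>i\<in>J - {j}. g i t)"
        unfolding G_def using J(1) j(1) elim(2) by (simp add: sum.remove)
      also have "q u * indicator S u + g j u = (if \<epsilon> j = 1 then q (min u t) else q (max u t) - q t)"
        using elim(1) J(4)[OF j(1)] j(2) by (auto simp: g_def indicator_def min_def max_def)
      finally show ?case .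
    qed
    have qc: "isCont q t" for t using q DERIV_isCont by blast
    have "isCont (\<lambda>u. (if \<epsilon> j = 1 then q (min u t) else q (max u t) - q t) + (\<Sum>i\<in>J - {j}. g i t)) t"
      by (cases "\<epsilon> j = 1") (auto intro!: continuous_intros isCont_o2[of _ _ q] qc)
    then show ?thesis using isCont_cong[OF ev] by simp
  qed
  have "((\<lambda>t. indicator S t * q' t) has_integral G 1 - G 0) {0..1}"
  proof (rule fundamental_theorem_of_calculus_interior_strong[of "s ` J"])
    show "continuous_on {0..1} G" using cont by (simp add: continuous_at_imp_continuous_on)
    show "(G has_vector_derivative indicator S x * q' x) (at x)" if "x \<in> {0<..<1} - s ` J" for x
      using der[of x] that by (simp add: has_real_derivative_iff_has_vector_derivative)
  qed (use J(1) in auto)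
  moreover have "(\<Sum>j\<in>J. g j 1) = (\<Sum>j\<in>J. \<epsilon> j * q (s j))"
    using J(2,4) by (intro sum.cong) (force simp: g_def)+
  moreover have "(\<Sum>j\<in>J. g j 0) = 0"
    using J(2) by (intro sum.neutral) (force simp: g_def)
  ultimately show ?thesis by (simp add: G_def algebra_simps)
qed

text \<open>What the divergence theorem needs of an element. One arrangement \<open>H\<close>
  contains the planes of the faces and determines the faces themselves. The normal is prescribed
  only at points generic for \<open>H\<close>, since elsewhere \<open>T\<close> may touch
  itself.\<close>

locale flat_boundary =
  fixes T :: "(real^'d) set" and F :: "(real^'d) set set" and \<nu> :: "(real^'d) set \<Rightarrow> real^'d"
    and c :: "(real^'d) set \<Rightarrow> real" and H :: "((real^'d) \<times> real) set"
  assumes card_d: "CARD('d) = 2 \<or> CARD('d) = 3"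
    and compact_T: "compact T"
    and finite_F: "finite F"
    and frontier_T: "frontier T = \<Union>F"
    and face: "\<And>e. e \<in> F \<Longrightarrow> hyperplane_face e (\<nu> e) (c e)"
    and H: "finite H" "\<And>a b. (a, b) \<in> H \<Longrightarrow> a \<noteq> 0"
    and H_face: "\<And>e. e \<in> F \<Longrightarrow> (\<nu> e, c e) \<in> H" "\<And>e. e \<in> F \<Longrightarrow> determined_by H e"
    and normal: "\<And>e x. e \<in> F \<Longrightarrow> x \<in> rel_interior e \<Longrightarrow> generic_at H x (\<nu> e) \<Longrightarrow> outward_normal_at T x (\<nu> e)"
    and disjoint: "pairwise (\<lambda>e e'. rel_interior e \<inter> rel_interior e' = {}) F"
begin

text \<open>\<open>h (y - t *\<^sub>R v)\<close> is integrated over all \<open>y\<close> and over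
  \<open>t\<close> from 0 to 1. Integrating over \<open>y\<close> first gives the volume integral.
  Integrating over \<open>t\<close> first gives \<open>P y - P (y - v) + B y\<close>: the two values
  of \<open>P\<close> cancel after integration by translation invariance, and \<open>B\<close>
  collects the crossings of faces, whose integrals are those of skew prisms.\<close>

lemma divergence_transversal:
  fixes p :: "real^'d \<Rightarrow> real"
  assumes v: "\<And>a b. (a, b) \<in> H \<Longrightarrow> a \<bullet> v \<noteq> 0"
    and p: "\<And>x. (p has_derivative p' x) (at x)"
    and p': "continuous_on UNIV (\<lambda>x. p' x v)"
  shows "(\<integral>x. p' x v \<partial>lebesgue_on T) = (\<Sum>e\<in>F. (\<nu> e \<bullet> v) * integral\<^sup>L (face_measure e) p)"
proof -
  have pc: "continuous_on A p" for A
    using p has_derivative_continuous continuous_at_imp_continuous_on by blast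
  have p'c: "continuous_on A (\<lambda>x. p' x v)" for A using p' continuous_on_subset by blast
  have T_sets: "T \<in> sets borel" using compact_T by (simp add: borel_closed compact_imp_closed)
  have closed_T: "closed T" using compact_T compact_imp_closed by blast
  define s where "s = (\<lambda>e y. (\<nu> e \<bullet> y - c e) / (\<nu> e \<bullet> v))"
  \<comment> \<open>\<open>y \<in> R e\<close> means that the segment from \<open>y\<close> to
    \<open>y - v\<close> meets \<open>e\<close>, which happens at the parameter
    \<open>s e y\<close>.\<close>
  define R where "R = (\<lambda>e. {y. 0 \<le> s e y \<and> s e y \<le> 1 \<and> y - s e y *\<^sub>R v \<in> e})"
  define G where "G = (\<lambda>e y. indicator (R e) y * p (y - s e y *\<^sub>R v))"
  define h where "h = (\<lambda>x. indicator T x * p' x v)"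
  define P where "P = (\<lambda>x. indicator T x * p x)"
  define B where "B = (\<lambda>y. \<Sum>e\<in>F. sgn (\<nu> e \<bullet> v) * G e y)"
  define \<Phi> where "\<Phi> = (\<lambda>t y. indicator {0..1::real} t * h (y - t *\<^sub>R v))"
  have nv: "\<nu> e \<bullet> v \<noteq> 0" if "e \<in> F" for e using v H_face(1)[OF that] by blast
  have G: "integrable lborel (G e)" "integral\<^sup>L lborel (G e) = \<bar>\<nu> e \<bullet> v\<bar> * integral\<^sup>L (face_measure e) p"
    if "e \<in> F" for e
    using hyperplane_face.integral_face_skew[OF face[OF that] card_d nv[OF that] pc]
    by (simp_all add: G_def R_def s_def)
  have hi: "integrable lborel h"
    using borel_integrable_compact[OF compact_T p'c] by (simp add: h_def)
  have Pi: "integrable lborel P"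
    using borel_integrable_compact[OF compact_T pc] by (simp add: P_def)
  have hm: "h \<in> borel_measurable borel" and Pm: "P \<in> borel_measurable borel" using hi Pi by simp_all

  text \<open>Outside \<open>N\<close>, the segment from \<open>y\<close> to \<open>y - v\<close> has no end point on a hyperplane and does not
    meet two different hyperplanes at the same point.\<close>
  define N where "N = (\<Union>(a, b)\<in>H. {y. a \<bullet> y = b} \<union> {y. a \<bullet> y = b + a \<bullet> v}) \<union>
    (\<Union>(z, z')\<in>{(z, z') \<in> H \<times> H. fst z /\<^sub>R (fst z \<bullet> v) - fst z' /\<^sub>R (fst z' \<bullet> v) \<noteq> 0}.
      {y. (fst z /\<^sub>R (fst z \<bullet> v) - fst z' /\<^sub>R (fst z' \<bullet> v)) \<bullet> y = snd z / (fst z \<bullet> v) - snd z' / (fst z' \<bullet> v)})"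
  have "finite {(z, z') \<in> H \<times> H. fst z /\<^sub>R (fst z \<bullet> v) - fst z' /\<^sub>R (fst z' \<bullet> v) \<noteq> 0}"
    using H(1) by (intro finite_subset[OF _ finite_cartesian_product[OF H(1) H(1)]]) auto
  then have "negligible N"
    unfolding N_def using H
    by (intro negligible_Un negligible_Union finite_imageI) (auto intro!: negligible_hyperplane negligible_Un)
  then have AE_N: "AE y in lborel. y \<notin> N"
    unfolding negligible_iff_null_sets using AE_not_in AE_completion_iff by blast
  have cross: "generic_at H (y - t *\<^sub>R v) (\<nu> e)" "t = s e y"
    if y: "y \<notin> N" and e: "e \<in> F" and on: "\<nu> e \<bullet> (y - t *\<^sub>R v) = c e" for y t e
  proof -
    show t: "t = s e y" using on nv[OF e] by (simp add: s_def inner_diff_right field_simps)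
    show "generic_at H (y - t *\<^sub>R v) (\<nu> e)"
      unfolding generic_at_def
    proof (clarify)
      fix a assume ab: "(a, a \<bullet> (y - t *\<^sub>R v)) \<in> H"
      define b where "b = a \<bullet> (y - t *\<^sub>R v)"
      have av: "a \<bullet> v \<noteq> 0" using v ab by blast
      have "t = (a \<bullet> y - b) / (a \<bullet> v)" using av by (simp add: b_def inner_diff_right)
      then have "(a \<bullet> y - b) / (a \<bullet> v) = (\<nu> e \<bullet> y - c e) / (\<nu> e \<bullet> v)" using t by (simp add: s_def)
      then have "(a /\<^sub>R (a \<bullet> v) - \<nu> e /\<^sub>R (\<nu> e \<bullet> v)) \<bullet> y = b / (a \<bullet> v) - c e / (\<nu> e \<bullet> v)"
        by (simp add: inner_diff_left divide_inverse_commute right_diff_distrib)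
      then have "a /\<^sub>R (a \<bullet> v) - \<nu> e /\<^sub>R (\<nu> e \<bullet> v) = 0"
        using y ab H_face(1)[OF e] unfolding N_def b_def[symmetric] by fastforce
      then have "a /\<^sub>R (a \<bullet> v) = \<nu> e /\<^sub>R (\<nu> e \<bullet> v)" by simp
      then have "(a \<bullet> v) *\<^sub>R (a /\<^sub>R (a \<bullet> v)) = (a \<bullet> v) *\<^sub>R (\<nu> e /\<^sub>R (\<nu> e \<bullet> v))" by simp
      then have "a = ((a \<bullet> v) / (\<nu> e \<bullet> v)) *\<^sub>R \<nu> e" using av by (simp add: divide_inverse)
      then show "\<exists>\<kappa>. a = \<kappa> *\<^sub>R \<nu> e" by blast
    qed
  qed
  \<comment> \<open>By genericity all points of the plane near the crossing belong to
    \<open>e\<close> together with it, so the relative boundary of the face is missed. The first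
    part of \<open>N\<close> rules out the parameters 0 and 1.\<close>
  have cross_interior: "y - t *\<^sub>R v \<in> rel_interior e" "0 < t \<and> t < 1"
    if y: "y \<notin> N" and e: "e \<in> F" and on: "y - t *\<^sub>R v \<in> e" and t: "0 \<le> t" "t \<le> 1" for y t e
  proof -
    interpret hyperplane_face e "\<nu> e" "c e" by (rule face[OF e])
    have hull: "\<nu> e \<bullet> (y - t *\<^sub>R v) = c e" using on by (rule n_e)
    obtain r where r: "r > 0" "\<And>x z. x \<in> ball (y - t *\<^sub>R v) r \<Longrightarrow> z \<in> ball (y - t *\<^sub>R v) r \<Longrightarrow>
      sgn (\<nu> e \<bullet> (x - (y - t *\<^sub>R v))) = sgn (\<nu> e \<bullet> (z - (y - t *\<^sub>R v))) \<Longrightarrow> x \<in> e \<Longrightarrow> z \<in> e"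
      using H(1) H_face(2)[OF e] cross(1)[OF y e hull] by (rule determined_by_local) blast
    show "y - t *\<^sub>R v \<in> rel_interior e"
    proof (rule rel_interiorI[OF on r(1)])
      fix z assume "z \<in> ball (y - t *\<^sub>R v) r" "\<nu> e \<bullet> z = c e"
      then show "z \<in> e" using r hull on by (intro r(2)[of "y - t *\<^sub>R v" z]) (auto simp: inner_diff_right)
    qed
    have "t \<noteq> 0" "t \<noteq> 1"
      using hull y H_face(1)[OF e] unfolding N_def by (force simp: inner_diff_right)+
    then show "0 < t \<and> t < 1" using t by simp
  qed
  have line: "((\<lambda>t. \<Phi> t y) has_integral P y - P (y - v) + B y) UNIV" if y: "y \<notin> N" for y
  proof -
    define J where "J = {e \<in> F. y \<in> R e}"
    define S where "S = {t. y - t *\<^sub>R v \<in> T}"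
    have Je: "e \<in> F" "0 \<le> s e y" "s e y \<le> 1" "y - s e y *\<^sub>R v \<in> e" if "e \<in> J" for e
      using that by (auto simp: J_def R_def)
    \<comment> \<open>The line is run through in direction \<open>-v\<close>, hence the minus sign
      of the derivative. With \<open>\<nu> e \<bullet> v > 0\<close> it enters \<open>T\<close>
      through \<open>e\<close>, so the switch has the sign
      \<open>- sgn (\<nu> e \<bullet> v)\<close>.\<close>
    have "((\<lambda>t. indicator S t * (- p' (y - t *\<^sub>R v) v)) has_integral
        p (y - 1 *\<^sub>R v) * indicator S 1 - p (y - 0 *\<^sub>R v) * indicator S 0 +
        (\<Sum>e\<in>J. - sgn (\<nu> e \<bullet> v) * p (y - s e y *\<^sub>R v))) {0..1}"
    proof (rule has_integral_indicator_deriv[where q = "\<lambda>t. p (y - t *\<^sub>R v)"])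
      show "finite J" using finite_F by (simp add: J_def)
      show "0 < s e y \<and> s e y < 1" if "e \<in> J" for e
        using cross_interior(2)[OF y Je(1,4,2,3)] that by blast
      show "inj_on (\<lambda>e. s e y) J"
      proof (rule inj_onI)
        fix e e' assume e: "e \<in> J" "e' \<in> J" "s e y = s e' y"
        have "y - s e y *\<^sub>R v \<in> rel_interior e" "y - s e y *\<^sub>R v \<in> rel_interior e'"
          using cross_interior(1)[OF y Je(1,4,2,3)] e by metis+
        then show "e = e'" using disjoint Je(1) e unfolding pairwise_def by blast
      qed
      show "- sgn (\<nu> e \<bullet> v) = 1 \<or> - sgn (\<nu> e \<bullet> v) = - 1" if "e \<in> J" for e
        using nv[OF Je(1)[OF that]] by (auto simp: sgn_if)
      show "\<forall>\<^sub>F u in nhds t. (u \<in> S) = (t \<in> S)" if t: "t \<in> {0..1}" "t \<notin> (\<lambda>e. s e y) ` J" for t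
      proof -
        have "y - t *\<^sub>R v \<notin> frontier T"
        proof
          assume "y - t *\<^sub>R v \<in> frontier T"
          then obtain e where e: "e \<in> F" "y - t *\<^sub>R v \<in> e" using frontier_T by blast
          have "t = s e y" by (rule cross(2)[OF y e(1) hyperplane_face.n_e[OF face[OF e(1)] e(2)]])
          then show False using t e by (auto simp: J_def R_def)
        qed
        then have "y - t *\<^sub>R v \<in> interior T \<or> y - t *\<^sub>R v \<in> - T"
          using closed_T by (auto simp: frontier_def)
        moreover have lim: "((\<lambda>u. y - u *\<^sub>R v) \<longlongrightarrow> y - t *\<^sub>R v) (nhds t)"
          by (intro tendsto_intros filterlim_ident)
        moreover have "\<forall>\<^sub>F u in nhds t. (u \<in> S) = (t \<in> S)" if "y - t *\<^sub>R v \<in> interior T"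
          using topological_tendstoD[OF lim open_interior that]
          by eventually_elim (use that interior_subset in \<open>auto simp: S_def\<close>)
        moreover have "\<forall>\<^sub>F u in nhds t. (u \<in> S) = (t \<in> S)" if "y - t *\<^sub>R v \<in> - T"
          using topological_tendstoD[OF lim _ that] closed_T that
          by (auto simp: S_def elim!: eventually_mono)
        ultimately show ?thesis by blast
      qed
      show "\<forall>\<^sub>F u in nhds (s e y). (u \<in> S) = (- sgn (\<nu> e \<bullet> v) * (u - s e y) \<le> 0)" if "e \<in> J" for e
      proof -
        note e = Je[OF that]
        define x where "x = y - s e y *\<^sub>R v"
        have "\<nu> e \<bullet> x = c e" unfolding x_def by (rule hyperplane_face.n_e[OF face[OF e(1)] e(4)])
        then have "outward_normal_at T x (\<nu> e)"
          using cross(1)[OF y e(1)] cross_interior(1)[OF y e(1) e(4) e(2,3)]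
          by (intro normal e(1)) (auto simp: x_def)
        then obtain r where r: "r > 0" "T \<inter> ball x r = {z \<in> ball x r. (z - x) \<bullet> \<nu> e \<le> 0}"
          unfolding outward_normal_at_def by blast
        have lim: "((\<lambda>u. y - u *\<^sub>R v) \<longlongrightarrow> x) (nhds (s e y))"
          unfolding x_def by (intro tendsto_intros filterlim_ident)
        have "\<forall>\<^sub>F u in nhds (s e y). y - u *\<^sub>R v \<in> ball x r"
          using topological_tendstoD[OF lim open_ball] r(1) by simp
        then show ?thesis
        proof eventually_elim
          case (elim u)
          have "u \<in> S \<longleftrightarrow> (y - u *\<^sub>R v - x) \<bullet> \<nu> e \<le> 0"
            using r(2) elim unfolding S_def by blast
          also have "(y - u *\<^sub>R v - x) \<bullet> \<nu> e = - (\<nu> e \<bullet> v) * (u - s e y)"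
            by (simp add: x_def inner_diff_left inner_commute algebra_simps)
          also have "\<dots> = \<bar>\<nu> e \<bullet> v\<bar> * (- sgn (\<nu> e \<bullet> v) * (u - s e y))"
            by (simp add: sgn_if)
          finally show ?case using nv[OF e(1)] by (simp add: mult_le_0_iff zero_le_mult_iff)
        qed
      qed
      show "((\<lambda>t. p (y - t *\<^sub>R v)) has_real_derivative - p' (y - t *\<^sub>R v) v) (at t)" for t
      proof -
        have "((\<lambda>t. y - t *\<^sub>R v) has_derivative (\<lambda>h. - (h *\<^sub>R v))) (at t)"
          by (auto intro!: derivative_eq_intros)
        from has_derivative_compose[OF this p]
        have "((\<lambda>t. p (y - t *\<^sub>R v)) has_derivative (\<lambda>h. p' (y - t *\<^sub>R v) (- (h *\<^sub>R v)))) (at t)" .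
        moreover have "(\<lambda>h. p' (y - t *\<^sub>R v) (- (h *\<^sub>R v))) = (*) (- p' (y - t *\<^sub>R v) v)"
          using has_derivative_linear[OF p, of "y - t *\<^sub>R v"]
          by (auto simp: linear_neg linear_cmul)
        ultimately show ?thesis by (simp add: has_field_derivative_def)
      qed
    qed
    from has_integral_neg[OF this]
    have "((\<lambda>t. indicator S t * p' (y - t *\<^sub>R v) v) has_integral
        - (p (y - 1 *\<^sub>R v) * indicator S 1 - p (y - 0 *\<^sub>R v) * indicator S 0 +
        (\<Sum>e\<in>J. - sgn (\<nu> e \<bullet> v) * p (y - s e y *\<^sub>R v)))) {0..1}"
      by simp
    also have "- (p (y - 1 *\<^sub>R v) * indicator S 1 - p (y - 0 *\<^sub>R v) * indicator S 0 +
        (\<Sum>e\<in>J. - sgn (\<nu> e \<bullet> v) * p (y - s e y *\<^sub>R v))) =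
        P y - P (y - v) + (\<Sum>e\<in>J. sgn (\<nu> e \<bullet> v) * p (y - s e y *\<^sub>R v))"
      by (auto simp: P_def S_def indicator_def sum_negf)
    finally have "((\<lambda>t. indicator S t * p' (y - t *\<^sub>R v) v) has_integral
        P y - P (y - v) + (\<Sum>e\<in>J. sgn (\<nu> e \<bullet> v) * p (y - s e y *\<^sub>R v))) {0..1}" .
    moreover have "(\<Sum>e\<in>J. sgn (\<nu> e \<bullet> v) * p (y - s e y *\<^sub>R v)) = B y"
      unfolding B_def G_def using finite_F
      by (auto simp: J_def indicator_def sum.inter_filter if_distrib intro!: sum.cong cong: if_cong)
    ultimately have "((\<lambda>t. h (y - t *\<^sub>R v)) has_integral P y - P (y - v) + B y) {0..1}"
      by (simp add: h_def S_def indicator_def cong: if_cong)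
    then have "((\<lambda>t. if t \<in> {0..1} then h (y - t *\<^sub>R v) else 0) has_integral P y - P (y - v) + B y) UNIV"
      by (simp only: has_integral_restrict_UNIV)
    moreover have "(\<lambda>t. if t \<in> {0..1} then h (y - t *\<^sub>R v) else 0) = (\<lambda>t. \<Phi> t y)"
      by (auto simp: \<Phi>_def indicator_def fun_eq_iff)
    ultimately show ?thesis by simp
  qed

  have \<Phi>m: "case_prod \<Phi> \<in> borel_measurable (lborel \<Otimes>\<^sub>M lborel)"
    unfolding \<Phi>_def case_prod_unfold using hm by measurable
  have hneg: "integrable lborel (\<lambda>y. k (y - t *\<^sub>R v))" "(\<integral>y. k (y - t *\<^sub>R v) \<partial>lborel) = integral\<^sup>L lborel k"
    if "integrable lborel k" for k :: "real^'d \<Rightarrow> real" and t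
    using lborel_integral_translate[of k "- t *\<^sub>R v"] that by (simp_all add: algebra_simps)
  \<comment> \<open>Fubini applies because, by translation invariance, the integral of the norm over
    \<open>y\<close> is the same for every \<open>t\<close> between 0 and 1.\<close>
  have \<Phi>i: "integrable (lborel \<Otimes>\<^sub>M lborel) (case_prod \<Phi>)"
  proof (rule lborel_pair.Fubini_integrable[OF \<Phi>m])
    have "(\<integral>y. norm (case_prod \<Phi> (t, y)) \<partial>lborel) = indicator {0..1} t * (\<integral>y. norm (h y) \<partial>lborel)" for t
      using hneg(2)[OF integrable_norm[OF hi], of t] by (simp add: \<Phi>_def abs_mult)
    then show "integrable lborel (\<lambda>t. \<integral>y. norm (case_prod \<Phi> (t, y)) \<partial>lborel)" by simp
    show "AE t in lborel. integrable lborel (\<lambda>y. case_prod \<Phi> (t, y))"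
      by (simp add: \<Phi>_def hneg(1)[OF hi])
  qed
  have "AE y in lborel. (\<integral>t. \<Phi> t y \<partial>lborel) = P y - P (y - v) + B y"
    using AE_N lborel_pair.AE_integrable_snd[OF \<Phi>i]
  proof eventually_elim
    case (elim y)
    show ?case
      using has_integral_unique[OF has_integral_integral_lborel[OF elim(2)] line[OF elim(1)]] .
  qed
  moreover have Bi: "integrable lborel B" unfolding B_def using G(1) by auto
  ultimately have "(\<integral>y. (\<integral>t. \<Phi> t y \<partial>lborel) \<partial>lborel) = (\<integral>y. P y - P (y - v) + B y \<partial>lborel)"
    using lborel_pair.integrable_snd[OF \<Phi>i] Pi hneg(1)[OF Pi, of 1]
    by (intro integral_cong_AE) auto
  also have "\<dots> = integral\<^sup>L lborel B"
    using Pi hneg[OF Pi, of 1] Bi by simp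
  also have "\<dots> = (\<Sum>e\<in>F. (\<nu> e \<bullet> v) * integral\<^sup>L (face_measure e) p)"
    unfolding B_def using G
    by (subst Bochner_Integration.integral_sum) (auto intro!: sum.cong simp: sgn_mult_abs mult.assoc[symmetric])
  finally have 1: "(\<integral>y. (\<integral>t. \<Phi> t y \<partial>lborel) \<partial>lborel) = (\<Sum>e\<in>F. (\<nu> e \<bullet> v) * integral\<^sup>L (face_measure e) p)" .
  have "(\<integral>y. (\<integral>t. \<Phi> t y \<partial>lborel) \<partial>lborel) = (\<integral>t. (\<integral>y. \<Phi> t y \<partial>lborel) \<partial>lborel)"
    by (rule lborel_pair.Fubini_integral[OF \<Phi>i])
  also have "\<dots> = (\<integral>t. indicator {0..1::real} t * integral\<^sup>L lborel h \<partial>lborel)"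
    by (simp add: \<Phi>_def hneg(2)[OF hi])
  also have "\<dots> = integral\<^sup>L lborel h" by simp
  also have "\<dots> = (\<integral>x. p' x v \<partial>lebesgue_on T)"
    using T_sets hm
    by (subst integral_restrict_space) (auto simp: h_def[symmetric] integral_completion)
  finally show ?thesis using 1 by simp
qed

end

text \<open>Every direction is a multiple of a difference of two transversal ones.\<close>

lemma transversal_directions:
  fixes w :: "real^'d" and H :: "((real^'d) \<times> real) set"
  assumes "finite H" "\<forall>(a, b)\<in>H. a \<noteq> 0"
  shows "\<exists>v t. t \<noteq> 0 \<and> (\<forall>(a, b)\<in>H. a \<bullet> v \<noteq> 0 \<and> a \<bullet> (v + t *\<^sub>R w) \<noteq> 0)"
proof -
  have "negligible (\<Union>(a, b)\<in>H. {v. a \<bullet> v = 0})"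
    using assms by (intro negligible_Union finite_imageI) (auto intro!: negligible_hyperplane)
  then have "(\<Union>(a, b)\<in>H. {v. a \<bullet> v = 0}) \<noteq> UNIV" by auto
  then obtain v where v: "v \<notin> (\<Union>(a, b)\<in>H. {v. a \<bullet> v = 0})" by blast
  have "finite (insert 0 ((\<lambda>(a, b). - (a \<bullet> v) / (a \<bullet> w)) ` H))" using assms(1) by simp
  \<comment> \<open>The excluded values are the zeros of
    \<open>a \<bullet> (v + t *\<^sub>R w)\<close>. If \<open>a \<bullet> w = 0\<close>, division
    yields 0, and nothing has to be excluded because the product is then
    \<open>a \<bullet> v\<close>.\<close>
  then obtain t where t: "t \<notin> insert 0 ((\<lambda>(a, b). - (a \<bullet> v) / (a \<bullet> w)) ` H)"
    using ex_new_if_finite[OF infinite_UNIV_char_0] by metis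
  have av: "a \<bullet> v \<noteq> 0" if "(a, b) \<in> H" for a b using v that by auto
  have "a \<bullet> (v + t *\<^sub>R w) \<noteq> 0" if ab: "(a, b) \<in> H" for a b
  proof
    assume z: "a \<bullet> (v + t *\<^sub>R w) = 0"
    then have aw: "a \<bullet> w \<noteq> 0" using av[OF ab] by (auto simp: inner_add_right)
    have "t = - (a \<bullet> v) / (a \<bullet> w)" using z aw by (simp add: inner_add_right field_simps)
    then show False using t ab by force
  qed
  then show ?thesis using t av by (intro exI[of _ v] exI[of _ t]) auto
qed

context flat_boundary
begin

text \<open>Both sides are linear in the direction, so the identity for \<open>v\<close> subtracted
  from that for \<open>v + t *\<^sub>R w\<close> leaves \<open>t\<close> times the identity for
  \<open>w\<close>.\<close>

theorem divergence_theorem: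
  fixes p :: "real^'d \<Rightarrow> real"
  assumes p: "\<And>x. (p has_derivative p' x) (at x)"
    and p': "\<And>v. continuous_on UNIV (\<lambda>x. p' x v)"
    and int: "\<And>f :: real^'d \<Rightarrow> real. continuous_on T f \<Longrightarrow> integrable (lebesgue_on T) f"
  shows "(\<integral>x. p' x w \<partial>lebesgue_on T) = (\<Sum>e\<in>F. (\<nu> e \<bullet> w) * integral\<^sup>L (face_measure e) p)"
proof -
  have "\<forall>(a, b)\<in>H. a \<noteq> 0" using H(2) by auto
  from transversal_directions[OF H(1) this, of w]
  obtain v t where t: "t \<noteq> 0" and *: "\<forall>(a, b)\<in>H. a \<bullet> v \<noteq> 0 \<and> a \<bullet> (v + t *\<^sub>R w) \<noteq> 0"
    by (elim exE conjE)
  then have v: "\<And>a b. (a, b) \<in> H \<Longrightarrow> a \<bullet> v \<noteq> 0"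
    and vt: "\<And>a b. (a, b) \<in> H \<Longrightarrow> a \<bullet> (v + t *\<^sub>R w) \<noteq> 0" by auto
  have lin: "linear (p' x)" for x using p has_derivative_linear by blast
  have i: "integrable (lebesgue_on T) (\<lambda>x. p' x v)" for v
    using int p' continuous_on_subset by blast
  have "(\<integral>x. p' x (v + t *\<^sub>R w) \<partial>lebesgue_on T) = (\<integral>x. p' x v + t * p' x w \<partial>lebesgue_on T)"
    by (simp add: linear_add[OF lin] linear_cmul[OF lin])
  also have "\<dots> = (\<integral>x. p' x v \<partial>lebesgue_on T) + t * (\<integral>x. p' x w \<partial>lebesgue_on T)"
    using i by simp
  finally have "t * (\<integral>x. p' x w \<partial>lebesgue_on T) =
      (\<Sum>e\<in>F. (\<nu> e \<bullet> (v + t *\<^sub>R w)) * integral\<^sup>L (face_measure e) p) -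
      (\<Sum>e\<in>F. (\<nu> e \<bullet> v) * integral\<^sup>L (face_measure e) p)"
    using divergence_transversal[OF v p p'] divergence_transversal[OF vt p p'] by simp
  also have "\<dots> = t * (\<Sum>e\<in>F. (\<nu> e \<bullet> w) * integral\<^sup>L (face_measure e) p)"
    by (simp add: sum_subtractf[symmetric] sum_distrib_left inner_add_right algebra_simps)
  finally show ?thesis using t by simp
qed

end

section \<open>Geometry of a shape-regular mesh: planes, normals and neighbours\<close>

locale regular_mesh =
  fixes \<Omega> :: "(real^'d) set" and Ts Es :: "(real^'d) set set"
    and \<rho>\<^sub>v \<rho>\<^sub>e \<kappa> \<sigma>\<^sub>s \<theta>\<^sub>0 \<gamma>\<^sub>s \<rho>\<^sub>S :: real and N :: nat
  assumes card_d: "CARD('d) = 2 \<or> CARD('d) = 3"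
    and mesh: "polytopal_mesh \<Omega> Ts Es"
    and regular: "shape_regular \<rho>\<^sub>v \<rho>\<^sub>e \<kappa> \<sigma>\<^sub>s \<theta>\<^sub>0 \<gamma>\<^sub>s \<rho>\<^sub>S N Ts Es"
begin

lemma finite_Ts: "finite Ts" and finite_Es: "finite Es"
  and polytopal_T: "T \<in> Ts \<Longrightarrow> polytopal CARD('d) T"
  and polytopal_e: "e \<in> Es \<Longrightarrow> polytopal (CARD('d) - 1) e"
  and frontier_T: "T \<in> Ts \<Longrightarrow> frontier T = \<Union>(faces_of Es T)"
  and disjoint_interiors: "pairwise (\<lambda>T T'. interior T \<inter> interior T' = {}) Ts"
  and face_of_some: "e \<in> Es \<Longrightarrow> \<exists>T\<in>Ts. e \<in> faces_of Es T"
  and face_of_two: "e \<in> Es - boundary_faces \<Omega> Es \<Longrightarrow> card {T\<in>Ts. e \<in> faces_of Es T} = 2"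
  using mesh unfolding polytopal_mesh_def by blast+

lemma faces_ofD: "e \<in> faces_of Es T \<Longrightarrow> e \<in> Es" "e \<in> faces_of Es T \<Longrightarrow> e \<subseteq> frontier T"
  by (auto simp: faces_of_def)

lemma finite_faces: "finite (faces_of Es T)"
  using finite_Es by (simp add: faces_of_def)

lemma compact_T: "T \<in> Ts \<Longrightarrow> compact T" and compact_e: "e \<in> Es \<Longrightarrow> compact e"
  using polytopal_compact polytopal_T polytopal_e by blast+

lemma interior_T: "T \<in> Ts \<Longrightarrow> interior T \<noteq> {}"
  using polytopal_full_interior polytopal_T by blast

lemma elem_support: "T \<in> Ts \<Longrightarrow> integration_support (lebesgue_on T) T"
  by (intro integration_support_lebesgue_on compact_T polytopal_full_interior polytopal_T)

lemma diameter_pos: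
  assumes "T \<in> Ts"
  shows "diameter T > 0"
proof -
  obtain x where "x \<in> interior T" using interior_T[OF assms] by blast
  then obtain r where r: "r > 0" "cball x r \<subseteq> T" by (meson mem_interior_cball)
  fix k :: 'd
  have "x + r *\<^sub>R axis k 1 \<in> cball x r" using r(1) by (simp add: dist_norm)
  then have "dist x (x + r *\<^sub>R axis k 1) \<le> diameter T"
    using r compact_imp_bounded[OF compact_T[OF assms]] by (intro diameter_bounded_bound) auto
  then show ?thesis using r(1) by (simp add: dist_norm)
qed

text \<open>A single arrangement for the whole mesh, so that two elements sharing a face can be
  compared at a common generic point. Each face plane is included with both orientations, because
  the outward normal depends on the element.\<close>

definition planes :: "((real^'d) \<times> real) set" where
  "planes = (SOME H. finite H \<and> (\<forall>(a, b)\<in>H. a \<noteq> 0) \<and> (\<forall>S\<in>Ts \<union> Es. determined_by H S) \<and>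
    (\<forall>e\<in>Es. \<exists>n c. hyperplane_face e n c \<and> (n, c) \<in> H \<and> (-n, -c) \<in> H))"

lemma planes: "finite planes" "\<And>a b. (a, b) \<in> planes \<Longrightarrow> a \<noteq> 0"
    "\<And>S. S \<in> Ts \<union> Es \<Longrightarrow> determined_by planes S"
    "\<And>e. e \<in> Es \<Longrightarrow> \<exists>n c. hyperplane_face e n c \<and> (n, c) \<in> planes \<and> (-n, -c) \<in> planes"
proof -
  have "\<exists>H. finite H \<and> (\<forall>(a, b)\<in>H. a \<noteq> 0) \<and> (\<forall>S\<in>Ts \<union> Es. determined_by H S)"
  proof (rule determined_by_common)
    show "finite (Ts \<union> Es)" using finite_Ts finite_Es by simp
    show "\<exists>H. finite H \<and> (\<forall>(a, b)\<in>H. a \<noteq> 0) \<and> determined_by H S" if "S \<in> Ts \<union> Es" for S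
      using that polytopal_T polytopal_e polytopal_determined_by by blast
  qed
  then obtain H where H: "finite H" "\<forall>(a, b)\<in>H. a \<noteq> 0" "\<forall>S\<in>Ts \<union> Es. determined_by H S"
    by blast
  obtain n c where nc: "\<And>e. e \<in> Es \<Longrightarrow> hyperplane_face e (n e) (c e)"
    using polytopal_hyperplane polytopal_e by metis
  define K where "K = H \<union> (\<lambda>e. (n e, c e)) ` Es \<union> (\<lambda>e. (- n e, - c e)) ` Es"
  have n0: "n e \<noteq> 0" if "e \<in> Es" for e using hyperplane_face.n[OF nc[OF that]] by auto
  have "finite K \<and> (\<forall>(a, b)\<in>K. a \<noteq> 0) \<and> (\<forall>S\<in>Ts \<union> Es. determined_by K S) \<and>
    (\<forall>e\<in>Es. \<exists>n c. hyperplane_face e n c \<and> (n, c) \<in> K \<and> (-n, -c) \<in> K)"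
  proof (intro conjI ballI)
    show "finite K" using H(1) finite_Es by (simp add: K_def)
    show "case z of (a, b) \<Rightarrow> a \<noteq> 0" if "z \<in> K" for z using that H(2) n0 by (auto simp: K_def)
    show "determined_by K S" if "S \<in> Ts \<union> Es" for S
      using H(3) that by (auto simp: K_def intro: determined_by_mono)
    show "\<exists>n c. hyperplane_face e n c \<and> (n, c) \<in> K \<and> (-n, -c) \<in> K" if "e \<in> Es" for e
      using nc that by (intro exI[of _ "n e"] exI[of _ "c e"]) (auto simp: K_def)
  qed
  from someI[where P = "\<lambda>H. finite H \<and> (\<forall>(a, b)\<in>H. a \<noteq> 0) \<and> (\<forall>S\<in>Ts \<union> Es. determined_by H S) \<and>
    (\<forall>e\<in>Es. \<exists>n c. hyperplane_face e n c \<and> (n, c) \<in> H \<and> (-n, -c) \<in> H)", OF this]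
  have *: "finite planes \<and> (\<forall>(a, b)\<in>planes. a \<noteq> 0) \<and> (\<forall>S\<in>Ts \<union> Es. determined_by planes S) \<and>
    (\<forall>e\<in>Es. \<exists>n c. hyperplane_face e n c \<and> (n, c) \<in> planes \<and> (-n, -c) \<in> planes)"
    unfolding planes_def .
  show "finite planes" "\<And>a b. (a, b) \<in> planes \<Longrightarrow> a \<noteq> 0"
    "\<And>S. S \<in> Ts \<union> Es \<Longrightarrow> determined_by planes S"
    "\<And>e. e \<in> Es \<Longrightarrow> \<exists>n c. hyperplane_face e n c \<and> (n, c) \<in> planes \<and> (-n, -c) \<in> planes"
    using * by auto
qed

lemma generic_face_point:
  assumes "e \<in> Es" "hyperplane_face e n c"
  obtains x where "x \<in> rel_interior e" "generic_at planes x n"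
  using hyperplane_face.generic_point_exists[OF assms(2) planes(1)]
    polytopal_rel_interior_nonempty[OF polytopal_e[OF assms(1)]] by blast

lemma face_support: "e \<in> Es \<Longrightarrow> integration_support (face_measure e) e"
  using polytopal_hyperplane[OF polytopal_e] hyperplane_face.integration_support_face
    polytopal_closure_rel_interior[OF polytopal_e] by blast

text \<open>The apex from (A3) has positive distance from the plane of \<open>e\<close>, so the
  plane can be oriented with the apex on its negative side. This orientation is an outward normal at
  every generic point, and uniqueness identifies it with the chosen
  \<open>face_normal T e\<close>.\<close>

lemma face_normal:
  assumes T: "T \<in> Ts" and e: "e \<in> faces_of Es T"
  shows "\<exists>c. hyperplane_face e (face_normal T e) c \<and> (face_normal T e, c) \<in> planes \<and>
    (\<forall>x\<in>rel_interior e. generic_at planes x (face_normal T e) \<longrightarrow> outward_normal_at T x (face_normal T e))"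
proof -
  have eE: "e \<in> Es" and eF: "e \<subseteq> frontier T" using faces_ofD[OF e] by blast+
  obtain n0 c0 where 0: "hyperplane_face e n0 c0" "(n0, c0) \<in> planes" "(-n0, -c0) \<in> planes"
    using planes(4)[OF eE] by blast
  obtain A \<sigma>\<^sub>e where A: "A \<in> T" "\<sigma>\<^sub>e \<ge> \<sigma>\<^sub>s" "pyramid A e \<subseteq> T" "infdist A (affine hull e) = \<sigma>\<^sub>e * diameter T"
    using regular T e unfolding shape_regular_def by meson
  have "\<sigma>\<^sub>s > 0" using regular unfolding shape_regular_def by blast
  then have "infdist A (affine hull e) > 0" using A(2,4) diameter_pos[OF T] by simp
  then have "A \<notin> affine hull e" by (metis infdist_zero less_irrefl)
  then have "n0 \<bullet> A \<noteq> c0" using hyperplane_face.hull[OF 0(1)] by blast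
  then obtain n c where nc: "hyperplane_face e n c" "(n, c) \<in> planes" "n \<bullet> A < c"
    using 0 hyperplane_face.flip[OF 0(1)] by (metis inner_minus_left linorder_neqE_linordered_idom neg_less_iff_less)
  interpret hyperplane_face e n c by (rule nc)
  have closed: "closed T" using compact_T[OF T] compact_imp_closed by blast
  have eT: "e \<subseteq> T" using eF closed frontier_subset_closed by blast
  have out: "outward_normal_at T x n" if "x \<in> rel_interior e" "generic_at planes x n" for x
    using outward_normal_generic[OF planes(1) planes(3) that(2) _ eF closed A(3) nc(3)] T that(1)
      rel_interior_subset by blast
  obtain x where "x \<in> rel_interior e" "generic_at planes x n"
    using generic_face_point[OF eE nc(1)] .
  then have "\<exists>\<nu>. \<exists>x\<in>rel_interior e. outward_normal_at T x \<nu>" using out by blast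
  then have "\<exists>x\<in>rel_interior e. outward_normal_at T x (face_normal T e)"
    unfolding face_normal_def by (rule someI_ex)
  then have "face_normal T e = n"
    using outward_normal_unique[OF _ _ eT A(3) nc(3)] by blast
  then show ?thesis using nc out by blast
qed

definition off :: "(real^'d) set \<Rightarrow> (real^'d) set \<Rightarrow> real" where
  "off T e = (SOME c. hyperplane_face e (face_normal T e) c \<and> (face_normal T e, c) \<in> planes \<and>
    (\<forall>x\<in>rel_interior e. generic_at planes x (face_normal T e) \<longrightarrow> outward_normal_at T x (face_normal T e)))"

lemma off:
  assumes T: "T \<in> Ts" and e: "e \<in> faces_of Es T"
  shows "hyperplane_face e (face_normal T e) (off T e)" "(face_normal T e, off T e) \<in> planes"
    "\<And>x. x \<in> rel_interior e \<Longrightarrow> generic_at planes x (face_normal T e) \<Longrightarrow> outward_normal_at T x (face_normal T e)"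
  using someI_ex[OF face_normal[OF assms]] unfolding off_def[symmetric] by blast+

lemma flat_boundary:
  assumes T: "T \<in> Ts"
  shows "flat_boundary T (faces_of Es T) (face_normal T) (off T) planes"
proof (rule flat_boundary.intro)
  show "pairwise (\<lambda>e e'. rel_interior e \<inter> rel_interior e' = {}) (faces_of Es T)"
    using mesh unfolding polytopal_mesh_def by (auto intro: pairwise_subset simp: faces_of_def)
  show "hyperplane_face e (face_normal T e) (off T e)" "(face_normal T e, off T e) \<in> planes"
    if "e \<in> faces_of Es T" for e using off[OF T that] by blast+
  show "outward_normal_at T x (face_normal T e)"
    if "e \<in> faces_of Es T" "x \<in> rel_interior e" "generic_at planes x (face_normal T e)" for e x
    using off(3)[OF T that] .
  show "determined_by planes e" if "e \<in> faces_of Es T" for e using planes(3) faces_ofD[OF that] by blast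
qed (rule card_d compact_T finite_faces frontier_T planes T | assumption)+

text \<open>Two unit normals of the same plane agree up to sign. If they were equal, both elements
  would contain the same half ball at a generic point of the face, against the disjointness of their
  interiors.\<close>

lemma opposite_normals:
  assumes T: "T \<in> Ts" "e \<in> faces_of Es T" and T': "T' \<in> Ts" "e \<in> faces_of Es T'" and ne: "T \<noteq> T'"
  shows "face_normal T' e = - face_normal T e"
proof -
  define n n' where "n = face_normal T e" and "n' = face_normal T' e"
  note o = off[OF T, folded n_def] and o' = off[OF T', folded n'_def]
  interpret hyperplane_face e n "off T e" by (rule o)
  interpret H': hyperplane_face e n' "off T' e" by (rule o')
  have eE: "e \<in> Es" using T faces_ofD by blast
  obtain x where x: "x \<in> rel_interior e" "generic_at planes x n" using generic_face_point[OF eE o(1)] .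
  have xe: "x \<in> e" using x(1) rel_interior_subset by blast
  define w where "w = n' - (n' \<bullet> n) *\<^sub>R n"
  have nw: "n \<bullet> w = 0" by (simp add: w_def inner_diff_right inner_commute)
  have "x + w \<in> affine hull e" using n_e[OF xe] nw by (simp add: hull inner_add_right)
  then have "n' \<bullet> w = 0" using H'.n_e[OF xe] by (simp add: H'.hull inner_add_right)
  moreover have "w \<bullet> w = n' \<bullet> w - (n' \<bullet> n) * (n \<bullet> w)"
    by (simp add: w_def algebra_simps inner_commute)
  ultimately have "w \<bullet> w = 0" using nw by simp
  then have eq: "n' = (n' \<bullet> n) *\<^sub>R n" by (simp add: w_def)
  then have a1: "\<bar>n' \<bullet> n\<bar> = 1" using n H'.n by (metis abs_1 mult.right_neutral norm_scaleR)
  have "n' \<noteq> n"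
  proof
    assume nn': "n' = n"
    obtain r where r: "r > 0" "T \<inter> ball x r = {y \<in> ball x r. (y - x) \<bullet> n \<le> 0}"
      using o(3)[OF x] unfolding outward_normal_at_def by blast
    obtain r' where r': "r' > 0" "T' \<inter> ball x r' = {y \<in> ball x r'. (y - x) \<bullet> n \<le> 0}"
      using o'(3) x unfolding outward_normal_at_def nn' by blast
    \<comment> \<open>The part of a small ball on the inner side of the face: it is nonempty and
      would be interior to both elements.\<close>
    define U where "U = ball x (min r r') \<inter> {y. n \<bullet> y < n \<bullet> x}"
    have "open U" unfolding U_def by (intro open_Int open_ball open_Collect_less continuous_intros)
    moreover have "U \<subseteq> {y \<in> ball x r. (y - x) \<bullet> n \<le> 0}" "U \<subseteq> {y \<in> ball x r'. (y - x) \<bullet> n \<le> 0}"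
      by (auto simp: U_def inner_diff_left inner_commute[of n])
    then have "U \<subseteq> T" "U \<subseteq> T'" using r(2) r'(2) by blast+
    ultimately have "U \<subseteq> interior T \<inter> interior T'" by (simp add: interior_maximal)
    moreover have "x - (min r r' / 2) *\<^sub>R n \<in> U"
      using r(1) r'(1) n by (auto simp: U_def dist_norm inner_diff_right min_def)
    moreover have "interior T \<inter> interior T' = {}"
      using disjoint_interiors T(1) T'(1) ne by (rule pairwiseD)
    ultimately show False by (metis empty_iff subsetD)
  qed
  then have "n' \<bullet> n \<noteq> 1" using eq by auto
  then have "n' \<bullet> n = -1" using a1 by linarith
  then have "n' = - n" using eq by simp
  then show ?thesis by (simp add: n_def n'_def)
qed

end

section \<open>Discrete weak operators\<close>

lemma continuous_on_poly_space:
  fixes q :: "real^'d \<Rightarrow> 'v::euclidean_space"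
  assumes "q \<in> poly_space k S"
  shows "continuous_on S q"
proof -
  obtain p where p: "poly_fun k p" "q = restrict p S" using assms unfolding poly_space_def by blast
  have "continuous_on S p" by (rule continuous_on_poly_fun[OF p(1)])
  then show ?thesis by (simp add: p(2) cong: continuous_on_cong)
qed

lemma restrict_in_poly_space: "poly_fun k p \<Longrightarrow> restrict p S \<in> poly_space k S"
  unfolding poly_space_def by blast

lemma poly_spaceE:
  assumes "q \<in> poly_space k S"
  obtains p where "poly_fun k p" "q = restrict p S"
  using assms unfolding poly_space_def by blast

lemma poly_fun_comb: "poly_fun k p \<Longrightarrow> poly_fun k q \<Longrightarrow> poly_fun k (\<lambda>x. c *\<^sub>R p x + q x)"
  by (intro poly_fun_add poly_fun_scaleR)

lemma partial_comb:
  fixes p q :: "real^'d \<Rightarrow> real"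
  assumes "poly_fun k p" "poly_fun k q"
  shows "partial j (\<lambda>y. c * p y + q y) x = c * partial j p x + partial j q x"
proof -
  have "((\<lambda>y. c * p y + q y) has_derivative
      (\<lambda>h. c * frechet_derivative p (at x) h + frechet_derivative q (at x) h)) (at x)"
    using poly_fun_differentiable[OF assms(1)] poly_fun_differentiable[OF assms(2)]
    by (intro derivative_intros) (simp_all add: frechet_derivative_works)
  from frechet_derivative_at[OF this] show ?thesis by (simp add: partial_def fun_eq_iff)
qed

lemma linear_sym_part: "linear sym_part"
  by (rule linearI) (simp_all add: sym_part_def transpose_def vec_eq_iff algebra_simps)

lemma poly_fun_entry:
  fixes \<phi> :: "real^'d \<Rightarrow> real^'n^'m"
  shows "poly_fun k \<phi> \<Longrightarrow> poly_fun k (\<lambda>x. \<phi> x $ i $ j)"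
  by (intro poly_fun_component)

lemma poly_fun_sym_part: "poly_fun k \<phi> \<Longrightarrow> poly_fun k (\<lambda>y. sym_part (\<phi> y))"
  by (rule poly_fun_linear[OF _ linear_sym_part])

lemma poly_fun_div_mat: "poly_fun k \<phi> \<Longrightarrow> poly_fun k (div_mat \<phi>)"
  by (intro poly_fun_vector) (simp add: div_mat_def poly_fun_sum poly_fun_partial poly_fun_entry)

lemma poly_fun_grad: "poly_fun k p \<Longrightarrow> poly_fun k (grad p)"
  by (intro poly_fun_vector) (simp add: grad_def poly_fun_partial)

lemma poly_fun_grad_vec: "poly_fun k w \<Longrightarrow> poly_fun k (grad_vec w)"
  by (intro poly_fun_vector) (simp add: grad_vec_def poly_fun_partial poly_fun_component)

lemma div_mat_comb:
  assumes "poly_fun k \<phi>" "poly_fun k \<psi>"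
  shows "div_mat (\<lambda>x. c *\<^sub>R \<phi> x + \<psi> x) x = c *\<^sub>R div_mat \<phi> x + div_mat \<psi> x"
  using assms
  by (simp add: div_mat_def vec_eq_iff partial_comb[where k = k] poly_fun_entry sum.distrib sum_distrib_left)

lemma grad_comb:
  assumes "poly_fun k \<phi>" "poly_fun k \<psi>"
  shows "grad (\<lambda>x. c *\<^sub>R \<phi> x + \<psi> x) x = c *\<^sub>R grad \<phi> x + grad \<psi> x"
  using assms by (simp add: grad_def vec_eq_iff partial_comb[where k = k])

lemma grad_vec_comb:
  assumes "poly_fun k \<phi>" "poly_fun k \<psi>"
  shows "grad_vec (\<lambda>x. c *\<^sub>R \<phi> x + \<psi> x) x = c *\<^sub>R grad_vec \<phi> x + grad_vec \<psi> x"
  using assms by (simp add: grad_vec_def vec_eq_iff partial_comb[where k = k] poly_fun_component)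

text \<open>\<open>sym_part\<close> is an orthogonal projection for the Frobenius product:
  self-adjoint because transposition is, and idempotent.\<close>

lemma sym_part_inner:
  fixes A B :: "real^'d^'d"
  shows "sym_part A \<bullet> B = A \<bullet> sym_part B" "sym_part A \<bullet> sym_part B = sym_part A \<bullet> B"
proof -
  have t: "transpose A \<bullet> B = A \<bullet> transpose B" for A B :: "real^'d^'d"
    unfolding inner_vec_def transpose_def
    by (simp, subst sum.swap) (simp add: inner_commute)
  show 1: "sym_part A \<bullet> B = A \<bullet> sym_part B" for A B :: "real^'d^'d"
    by (simp add: sym_part_def inner_add_left inner_add_right t)
  have "sym_part (sym_part B) = sym_part B" for B :: "real^'d^'d"
    by (simp add: sym_part_def transpose_def vec_eq_iff field_simps)
  then show "sym_part A \<bullet> sym_part B = sym_part A \<bullet> B" using 1 by metis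
qed

section \<open>Weak operators as Riesz representers\<close>

context regular_mesh
begin

lemma elem_inner_ip:
  assumes "T \<in> Ts"
  shows "elem_inner T f g = integration_support.ip (lebesgue_on T) f g"
  by (simp add: elem_inner_def integration_support.ip_def[OF elem_support[OF assms]])

lemma face_inner_ip:
  assumes "e \<in> Es"
  shows "face_inner e f g = integration_support.ip (face_measure e) f g"
  by (simp add: face_inner_def integration_support.ip_def[OF face_support[OF assms]])

lemma elem_inner_commute: "elem_inner T f g = elem_inner T g f"
  by (simp add: elem_inner_def inner_commute)

lemma face_inner_commute: "face_inner e f g = face_inner e g f"
  by (simp add: face_inner_def inner_commute)

lemma elem_inner_comb:
  assumes "T \<in> Ts" "continuous_on T f" "continuous_on T f'" "continuous_on T g"
    "\<And>x. x \<in> T \<Longrightarrow> h x = c *\<^sub>R f x + f' x"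
  shows "elem_inner T h g = c * elem_inner T f g + elem_inner T f' g"
  unfolding elem_inner_ip[OF assms(1)]
  by (rule integration_support.ip_comb_left[OF elem_support]) (use assms in auto)

lemma face_inner_comb:
  assumes "e \<in> Es" "continuous_on e f" "continuous_on e f'" "continuous_on e g"
    "\<And>x. x \<in> e \<Longrightarrow> h x = c *\<^sub>R f x + f' x"
  shows "face_inner e h g = c * face_inner e f g + face_inner e f' g"
  unfolding face_inner_ip[OF assms(1)]
  by (rule integration_support.ip_comb_left[OF face_support]) (use assms in auto)

lemma elem_inner_cong:
  assumes "T \<in> Ts" "continuous_on T f" "continuous_on T g"
    "\<And>x. x \<in> T \<Longrightarrow> f x = f' x" "\<And>x. x \<in> T \<Longrightarrow> g x = g' x"
  shows "elem_inner T f g = elem_inner T f' g'"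
  unfolding elem_inner_ip[OF assms(1)]
  by (rule integration_support.ip_cong[OF elem_support]) (use assms in auto)

lemma face_inner_cong:
  assumes "e \<in> Es" "continuous_on e f" "continuous_on e g"
    "\<And>x. x \<in> e \<Longrightarrow> f x = f' x" "\<And>x. x \<in> e \<Longrightarrow> g x = g' x"
  shows "face_inner e f g = face_inner e f' g'"
  unfolding face_inner_ip[OF assms(1)]
  by (rule integration_support.ip_cong[OF face_support]) (use assms in auto)

lemma elem_inner_nonneg: "T \<in> Ts \<Longrightarrow> 0 \<le> elem_inner T f f"
  by (simp add: elem_inner_ip integration_support.ip_nonneg[OF elem_support])

lemma face_inner_nonneg: "e \<in> Es \<Longrightarrow> 0 \<le> face_inner e f f"
  by (simp add: face_inner_ip integration_support.ip_nonneg[OF face_support])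

lemma elem_inner_definite:
  assumes "T \<in> Ts" "continuous_on T f" "elem_inner T f f = 0" "x \<in> T"
  shows "f x = 0"
  using assms(3) unfolding elem_inner_ip[OF assms(1)]
  by (rule integration_support.ip_definite[OF elem_support[OF assms(1)] assms(2) _ assms(4)])

lemma face_inner_definite:
  assumes "e \<in> Es" "continuous_on e f" "face_inner e f f = 0" "x \<in> e"
  shows "f x = 0"
  using assms(3) unfolding face_inner_ip[OF assms(1)]
  by (rule integration_support.ip_definite[OF face_support[OF assms(1)] assms(2) _ assms(4)])

lemma poly_fun_zero_on_elem:
  fixes p :: "real^'d \<Rightarrow> 'v::euclidean_space"
  assumes "T \<in> Ts" "poly_fun k p" "\<And>x. x \<in> T \<Longrightarrow> p x = 0"
  shows "p x = 0"
proof -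
  obtain x0 where "x0 \<in> interior T" using interior_T[OF assms(1)] by blast
  then show ?thesis
    using poly_fun_eq_0[OF assms(2) open_interior, of x0 T x] assms(3) interior_subset by blast
qed

text \<open>All three discrete weak operators are instances, for suitable \<open>D\<close> and \<open>B\<close>.\<close>

definition weak_op ::
    "nat \<Rightarrow> (real^'d) set \<Rightarrow> ((real^'d \<Rightarrow> 'v::euclidean_space) \<Rightarrow> real^'d \<Rightarrow> 'a::euclidean_space) \<Rightarrow>
      ((real^'d) set \<Rightarrow> (real^'d \<Rightarrow> 'v) \<Rightarrow> real^'d \<Rightarrow> 'b::euclidean_space) \<Rightarrow>
      (real^'d \<Rightarrow> 'a) \<Rightarrow> ((real^'d) set \<Rightarrow> real^'d \<Rightarrow> 'b) \<Rightarrow> real^'d \<Rightarrow> 'v" where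
  "weak_op k T D B u g = (THE q. q \<in> poly_space k T \<and>
    (\<forall>\<phi>. poly_fun k \<phi> \<longrightarrow> elem_inner T q \<phi> =
      - elem_inner T u (D \<phi>) + (\<Sum>e\<in>faces_of Es T. face_inner e (g e) (B e \<phi>))))"

text \<open>Continuity makes the integrals in the defining equation exist, and compatibility with
  combinations makes its right-hand side linear in \<open>\<phi>\<close>.\<close>

definition admissible ::
    "nat \<Rightarrow> (real^'d) set \<Rightarrow> ((real^'d \<Rightarrow> 'v::euclidean_space) \<Rightarrow> real^'d \<Rightarrow> 'a::euclidean_space) \<Rightarrow>
      ((real^'d) set \<Rightarrow> (real^'d \<Rightarrow> 'v) \<Rightarrow> real^'d \<Rightarrow> 'b::euclidean_space) \<Rightarrow> bool" where
  "admissible k T D B \<longleftrightarrow> T \<in> Ts \<and>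
    (\<forall>\<phi>. poly_fun k \<phi> \<longrightarrow> continuous_on T (D \<phi>) \<and> (\<forall>e\<in>faces_of Es T. continuous_on e (B e \<phi>))) \<and>
    (\<forall>\<phi> \<psi> c. poly_fun k \<phi> \<longrightarrow> poly_fun k \<psi> \<longrightarrow>
      (\<forall>x. D (\<lambda>x. c *\<^sub>R \<phi> x + \<psi> x) x = c *\<^sub>R D \<phi> x + D \<psi> x) \<and>
      (\<forall>e x. B e (\<lambda>x. c *\<^sub>R \<phi> x + \<psi> x) x = c *\<^sub>R B e \<phi> x + B e \<psi> x))"

text \<open>\<open>riesz_poly_fun\<close> on the element. Its condition \<open>null\<close> holds
  although \<open>L\<close> involves derivatives and face values: since \<open>T\<close> has
  interior points, a polynomial vanishing on \<open>T\<close> is the zero polynomial.\<close>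

lemma weak_op_unique_existence:
  assumes "admissible k T D B" "continuous_on T u" "\<And>e. e \<in> faces_of Es T \<Longrightarrow> continuous_on e (g e)"
  shows "\<exists>!q. q \<in> poly_space k T \<and>
    (\<forall>\<phi>. poly_fun k \<phi> \<longrightarrow> elem_inner T q \<phi> =
      - elem_inner T u (D \<phi>) + (\<Sum>e\<in>faces_of Es T. face_inner e (g e) (B e \<phi>)))"
proof -
  define L where "L = (\<lambda>\<phi>. - elem_inner T u (D \<phi>) + (\<Sum>e\<in>faces_of Es T. face_inner e (g e) (B e \<phi>)))"
  have T: "T \<in> Ts" using assms(1) by (simp add: admissible_def)
  have comb: "L (\<lambda>x. c *\<^sub>R \<phi> x + \<psi> x) = c * L \<phi> + L \<psi>" if \<phi>: "poly_fun k \<phi>" and \<psi>: "poly_fun k \<psi>" for c \<phi> \<psi>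
  proof -
    have D: "continuous_on T (D \<phi>)" "continuous_on T (D \<psi>)"
        "\<And>x. D (\<lambda>x. c *\<^sub>R \<phi> x + \<psi> x) x = c *\<^sub>R D \<phi> x + D \<psi> x"
      and B: "\<And>e. e \<in> faces_of Es T \<Longrightarrow> continuous_on e (B e \<phi>)" "\<And>e. e \<in> faces_of Es T \<Longrightarrow> continuous_on e (B e \<psi>)"
        "\<And>e x. B e (\<lambda>x. c *\<^sub>R \<phi> x + \<psi> x) x = c *\<^sub>R B e \<phi> x + B e \<psi> x"
      using assms(1) \<phi> \<psi> unfolding admissible_def by blast+
    have "elem_inner T u (D (\<lambda>x. c *\<^sub>R \<phi> x + \<psi> x)) = c * elem_inner T u (D \<phi>) + elem_inner T u (D \<psi>)"
      unfolding elem_inner_commute[of T u] by (rule elem_inner_comb[OF T D(1,2) assms(2) D(3)])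
    moreover have "face_inner e (g e) (B e (\<lambda>x. c *\<^sub>R \<phi> x + \<psi> x)) =
        c * face_inner e (g e) (B e \<phi>) + face_inner e (g e) (B e \<psi>)" if e: "e \<in> faces_of Es T" for e
      unfolding face_inner_commute[of e "g e"]
      by (rule face_inner_comb[OF faces_ofD(1)[OF e] B(1,2)[OF e] assms(3)[OF e] B(3)])
    ultimately show ?thesis
      by (simp add: L_def sum.distrib sum_distrib_left algebra_simps)
  qed
  interpret integration_support "lebesgue_on T" T by (rule elem_support[OF T])
  have z: "L (\<lambda>x. 0) = 0"
    using comb[OF poly_fun_zero poly_fun_zero, of 1] by simp
  have "\<exists>!q. q \<in> poly_space k T \<and> (\<forall>\<phi>. poly_fun k \<phi> \<longrightarrow> ip q \<phi> = L \<phi>)"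
  proof (rule riesz_poly_fun)
    show "L (\<lambda>x. p x + q x) = L p + L q" if "poly_fun k p" "poly_fun k q" for p q
      using comb[OF that, of 1] by simp
    show "L (\<lambda>x. c *\<^sub>R p x) = c * L p" if "poly_fun k p" for c p
      using comb[OF that poly_fun_zero, of c] z by simp
    show "L p = 0" if p: "poly_fun k p" "\<And>x. x \<in> T \<Longrightarrow> p x = 0" for p
    proof -
      have "p = (\<lambda>x. 0)" by (rule ext) (rule poly_fun_zero_on_elem[OF T p])
      then show ?thesis using z by simp
    qed
  qed
  then show ?thesis unfolding L_def by (simp only: elem_inner_ip[OF T])
qed

lemma weak_op:
  assumes "admissible k T D B" "continuous_on T u" "\<And>e. e \<in> faces_of Es T \<Longrightarrow> continuous_on e (g e)"
  shows "weak_op k T D B u g \<in> poly_space k T"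
    "poly_fun k \<phi> \<Longrightarrow> elem_inner T (weak_op k T D B u g) \<phi> =
      - elem_inner T u (D \<phi>) + (\<Sum>e\<in>faces_of Es T. face_inner e (g e) (B e \<phi>))"
  using theI'[OF weak_op_unique_existence[OF assms]] unfolding weak_op_def[symmetric] by blast+

text \<open>The way to recognize a weak operator: any polynomial of degree at most \<open>k\<close>
  passing the tests is it on \<open>T\<close>. It serves for linearity and for the comparison with
  classical derivatives.\<close>

lemma weak_op_eqI:
  assumes "admissible k T D B" "continuous_on T u" "\<And>e. e \<in> faces_of Es T \<Longrightarrow> continuous_on e (g e)"
    and q: "poly_fun k q" "\<And>\<phi>. poly_fun k \<phi> \<Longrightarrow> elem_inner T q \<phi> =
      - elem_inner T u (D \<phi>) + (\<Sum>e\<in>faces_of Es T. face_inner e (g e) (B e \<phi>))"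
    and x: "x \<in> T"
  shows "weak_op k T D B u g x = q x"
proof -
  have T: "T \<in> Ts" using assms(1) by (simp add: admissible_def)
  have "elem_inner T (restrict q T) \<phi> =
      - elem_inner T u (D \<phi>) + (\<Sum>e\<in>faces_of Es T. face_inner e (g e) (B e \<phi>))"
    if \<phi>: "poly_fun k \<phi>" for \<phi>
  proof -
    have "elem_inner T (restrict q T) \<phi> = elem_inner T q \<phi>"
      by (rule elem_inner_cong[OF T, symmetric]) (use q(1) \<phi> in \<open>auto intro: continuous_on_poly_fun\<close>)
    then show ?thesis using q(2)[OF \<phi>] by simp
  qed
  moreover define P where "P = (\<lambda>q. q \<in> poly_space k T \<and> (\<forall>\<phi>. poly_fun k \<phi> \<longrightarrow> elem_inner T q \<phi> =
      - elem_inner T u (D \<phi>) + (\<Sum>e\<in>faces_of Es T. face_inner e (g e) (B e \<phi>))))"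
  ultimately have r: "P (restrict q T)"
    using restrict_in_poly_space[OF q(1)] by simp
  have w: "P (weak_op k T D B u g)"
    unfolding P_def using weak_op[OF assms(1-3)] by blast
  have "\<exists>!q. P q" unfolding P_def by (rule weak_op_unique_existence[OF assms(1-3)])
  then have "weak_op k T D B u g = restrict q T" using r w by blast
  then show ?thesis using x by simp
qed

text \<open>The combination of the two weak operators satisfies the tests for the combined data, so
  uniqueness applies. The data have to be combined only on the element and its faces.\<close>

lemma weak_op_comb:
  fixes D :: "(real^'d \<Rightarrow> 'v::euclidean_space) \<Rightarrow> real^'d \<Rightarrow> 'a::euclidean_space"
  assumes ad: "admissible k T D B"
    and u: "continuous_on T u" "continuous_on T u'" "\<And>x. x \<in> T \<Longrightarrow> w x = c *\<^sub>R u x + u' x"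
    and g: "\<And>e. e \<in> faces_of Es T \<Longrightarrow> continuous_on e (g e)" "\<And>e. e \<in> faces_of Es T \<Longrightarrow> continuous_on e (g' e)"
      "\<And>e x. e \<in> faces_of Es T \<Longrightarrow> x \<in> e \<Longrightarrow> h e x = c *\<^sub>R g e x + g' e x"
    and x: "x \<in> T"
  shows "weak_op k T D B w h x = c *\<^sub>R weak_op k T D B u g x + weak_op k T D B u' g' x"
proof -
  have T: "T \<in> Ts" using ad by (simp add: admissible_def)
  obtain q where q: "poly_fun k q" "weak_op k T D B u g = restrict q T"
    using weak_op(1)[OF ad u(1) g(1)] by (rule poly_spaceE)
  obtain q' where q': "poly_fun k q'" "weak_op k T D B u' g' = restrict q' T"
    using weak_op(1)[OF ad u(2) g(2)] by (rule poly_spaceE)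
  note cont = continuous_on_poly_fun
  have qc: "continuous_on T (restrict q T)" "continuous_on T (restrict q' T)"
    by (rule continuous_on_poly_space[OF restrict_in_poly_space[OF q(1)]]
        continuous_on_poly_space[OF restrict_in_poly_space[OF q'(1)]])+
  have "continuous_on T (\<lambda>x. c *\<^sub>R u x + u' x)" using u by (intro continuous_intros)
  then have wc: "continuous_on T w" by (simp add: u(3) cong: continuous_on_cong)
  have hc: "continuous_on e (h e)" if e: "e \<in> faces_of Es T" for e
  proof -
    have "continuous_on e (\<lambda>x. c *\<^sub>R g e x + g' e x)" using g e by (intro continuous_intros)
    then show ?thesis by (simp add: g(3)[OF e] cong: continuous_on_cong)
  qed
  have "weak_op k T D B w h x = c *\<^sub>R q x + q' x"
  proof (rule weak_op_eqI[OF ad wc hc _ _ x])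
    show "poly_fun k (\<lambda>x. c *\<^sub>R q x + q' x)" by (rule poly_fun_comb[OF q(1) q'(1)])
    fix \<phi> :: "real^'d \<Rightarrow> 'v" assume \<phi>: "poly_fun k \<phi>"
    have D: "continuous_on T (D \<phi>)" and B: "\<And>e. e \<in> faces_of Es T \<Longrightarrow> continuous_on e (B e \<phi>)"
      using ad \<phi> unfolding admissible_def by blast+
    have "elem_inner T (\<lambda>x. c *\<^sub>R q x + q' x) \<phi> = c * elem_inner T (restrict q T) \<phi> + elem_inner T (restrict q' T) \<phi>"
      by (rule elem_inner_comb[OF T qc cont[OF \<phi>]]) simp
    moreover have "elem_inner T (restrict q T) \<phi> =
        - elem_inner T u (D \<phi>) + (\<Sum>e\<in>faces_of Es T. face_inner e (g e) (B e \<phi>))"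
      using weak_op(2)[OF ad u(1) g(1) \<phi>] by (simp only: q(2))
    moreover have "elem_inner T (restrict q' T) \<phi> =
        - elem_inner T u' (D \<phi>) + (\<Sum>e\<in>faces_of Es T. face_inner e (g' e) (B e \<phi>))"
      using weak_op(2)[OF ad u(2) g(2) \<phi>] by (simp only: q'(2))
    moreover have "elem_inner T w (D \<phi>) = c * elem_inner T u (D \<phi>) + elem_inner T u' (D \<phi>)"
      by (rule elem_inner_comb[OF T u(1,2) D u(3)])
    moreover have "(\<Sum>e\<in>faces_of Es T. face_inner e (h e) (B e \<phi>)) =
        (\<Sum>e\<in>faces_of Es T. c * face_inner e (g e) (B e \<phi>) + face_inner e (g' e) (B e \<phi>))"
    proof (rule sum.cong[OF refl])
      fix e assume e: "e \<in> faces_of Es T"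
      show "face_inner e (h e) (B e \<phi>) = c * face_inner e (g e) (B e \<phi>) + face_inner e (g' e) (B e \<phi>)"
        by (rule face_inner_comb[OF faces_ofD(1)[OF e] g(1)[OF e] g(2)[OF e] B[OF e] g(3)[OF e]])
    qed
    ultimately show "elem_inner T (\<lambda>x. c *\<^sub>R q x + q' x) \<phi> =
        - elem_inner T w (D \<phi>) + (\<Sum>e\<in>faces_of Es T. face_inner e (h e) (B e \<phi>))"
      by (simp add: sum.distrib sum_distrib_left algebra_simps)
  qed
  then show ?thesis using q q' x by simp
qed

text \<open>The divergence theorem for the product of \<open>p\<close> and \<open>q\<close> in the
  direction of the \<open>j\<close>-th axis.\<close>

lemma integration_by_parts:
  fixes p q :: "real^'d \<Rightarrow> real"
  assumes T: "T \<in> Ts" and p: "poly_fun k p" and q: "poly_fun l q"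
  shows "(\<integral>x. p x * partial j q x \<partial>lebesgue_on T) = - (\<integral>x. partial j p x * q x \<partial>lebesgue_on T) +
    (\<Sum>e\<in>faces_of Es T. face_normal T e $ j * (\<integral>x. p x * q x \<partial>face_measure e))"
proof -
  interpret flat_boundary T "faces_of Es T" "face_normal T" "off T" planes by (rule flat_boundary[OF T])
  interpret I: integration_support "lebesgue_on T" T by (rule elem_support[OF T])
  define pq where "pq = (\<lambda>x. p x * q x)"
  have diff: "p differentiable (at x)" "q differentiable (at x)" for x
    using p q by (auto intro: poly_fun_differentiable)
  have pr: "partial i pq x = partial i p x * q x + p x * partial i q x" for i x
    unfolding pq_def by (rule partial_mult[OF diff])
  note cont = continuous_on_poly_fun[OF p] continuous_on_poly_fun[OF q]
    continuous_on_poly_fun[OF poly_fun_partial[OF p]] continuous_on_poly_fun[OF poly_fun_partial[OF q]]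
  have pc: "continuous_on UNIV (\<lambda>x. \<Sum>i\<in>UNIV. v $ i * partial i pq x)" for v
    unfolding pr by (intro continuous_intros cont)
  have "pq differentiable (at x)" for x unfolding pq_def by (intro derivative_intros diff)
  then have "(\<integral>x. (\<Sum>i\<in>UNIV. axis j 1 $ i * partial i pq x) \<partial>lebesgue_on T) =
      (\<Sum>e\<in>faces_of Es T. (face_normal T e \<bullet> axis j 1) * integral\<^sup>L (face_measure e) pq)"
    using I.integrable_cont pc
    by (intro divergence_theorem has_derivative_partial) blast+
  moreover have "(\<Sum>i\<in>UNIV. axis j 1 $ i * partial i pq x) = partial j p x * q x + p x * partial j q x" for x
    by (simp add: pr axis_def if_distrib[of "\<lambda>c. c * _"] cong: if_cong)
  moreover have "(\<integral>x. partial j p x * q x + p x * partial j q x \<partial>lebesgue_on T) =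
      (\<integral>x. partial j p x * q x \<partial>lebesgue_on T) + (\<integral>x. p x * partial j q x \<partial>lebesgue_on T)"
    by (intro Bochner_Integration.integral_add I.integrable_cont continuous_intros cont)
  ultimately show ?thesis by (simp add: inner_axis pq_def)
qed

end

lemma linear_matrix_vector_left: "linear (\<lambda>A :: real^'n^'m. A *v x)"
  by (rule linearI) (simp_all add: matrix_vector_mult_add_rdistrib scaleR_matrix_vector_assoc)

lemma continuous_on_matrix_vector_left:
  fixes f :: "'a::topological_space \<Rightarrow> real^'n^'m"
  assumes "continuous_on S f"
  shows "continuous_on S (\<lambda>y. f y *v x)"
  using linear_matrix_vector_left[of x] linear_conv_bounded_linear bounded_linear.continuous_on assms by blast

lemma poly_fun_matrix_vector_left: "poly_fun k \<phi> \<Longrightarrow> poly_fun k (\<lambda>y. \<phi> y *v x)"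
  for \<phi> :: "real^'d \<Rightarrow> real^'n^'m"
  by (rule poly_fun_linear[OF _ linear_matrix_vector_left])

lemma inner_mat_1: "mat 1 \<bullet> (A :: real^'n^'n) = (\<Sum>i\<in>UNIV. A $ i $ i)"
  by (simp add: inner_vec_def mat_def if_distrib[of "\<lambda>c. c * _"] cong: if_cong)

section \<open>Matrix integration by parts and bilinearity of the least-squares form\<close>

context regular_mesh
begin

text \<open>The scalar identity for each entry of \<open>\<psi>\<close> with the matching component
  of \<open>U\<close>, summed over all entries; the normal components of a row add up to the product
  with the normal.\<close>

lemma integration_by_parts_matrix:
  fixes U :: "real^'d \<Rightarrow> real^'d" and \<psi> :: "real^'d \<Rightarrow> real^'d^'d"
  assumes T: "T \<in> Ts" and U: "poly_fun k U" and \<psi>: "poly_fun l \<psi>"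
  shows "elem_inner T (grad_vec U) \<psi> = - elem_inner T U (div_mat \<psi>) +
    (\<Sum>e\<in>faces_of Es T. face_inner e U (\<lambda>x. \<psi> x *v face_normal T e))"
proof -
  interpret I: integration_support "lebesgue_on T" T by (rule elem_support[OF T])
  have Ui: "poly_fun k (\<lambda>x. U x $ i)" and \<psi>i: "poly_fun l (\<lambda>x. \<psi> x $ i $ j)" for i j
    using U \<psi> by (auto intro: poly_fun_component poly_fun_entry)
  note cont = continuous_on_poly_fun[OF Ui] continuous_on_poly_fun[OF \<psi>i]
    continuous_on_poly_fun[OF poly_fun_partial[OF Ui]] continuous_on_poly_fun[OF poly_fun_partial[OF \<psi>i]]
  have "elem_inner T (grad_vec U) \<psi> =
      (\<integral>x. (\<Sum>i\<in>UNIV. \<Sum>j\<in>UNIV. \<psi> x $ i $ j * partial j (\<lambda>y. U y $ i) x) \<partial>lebesgue_on T)"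
    by (simp add: elem_inner_def grad_vec_def inner_vec_def mult.commute)
  also have "\<dots> = (\<Sum>i\<in>UNIV. \<Sum>j\<in>UNIV. \<integral>x. \<psi> x $ i $ j * partial j (\<lambda>y. U y $ i) x \<partial>lebesgue_on T)"
    by (simp add: Bochner_Integration.integral_sum I.integrable_cont continuous_intros cont)
  also have "\<dots> = (\<Sum>i\<in>UNIV. \<Sum>j\<in>UNIV. - (\<integral>x. partial j (\<lambda>y. \<psi> y $ i $ j) x * U x $ i \<partial>lebesgue_on T) +
      (\<Sum>e\<in>faces_of Es T. face_normal T e $ j * (\<integral>x. \<psi> x $ i $ j * U x $ i \<partial>face_measure e)))"
    by (intro sum.cong refl integration_by_parts[OF T \<psi>i Ui])
  also have "\<dots> = - (\<Sum>i\<in>UNIV. \<Sum>j\<in>UNIV. \<integral>x. partial j (\<lambda>y. \<psi> y $ i $ j) x * U x $ i \<partial>lebesgue_on T) +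
      (\<Sum>i\<in>UNIV. \<Sum>j\<in>UNIV. \<Sum>e\<in>faces_of Es T. face_normal T e $ j * (\<integral>x. \<psi> x $ i $ j * U x $ i \<partial>face_measure e))"
    by (simp only: sum.distrib sum_negf)
  also have "(\<Sum>i\<in>UNIV. \<Sum>j\<in>UNIV. \<integral>x. partial j (\<lambda>y. \<psi> y $ i $ j) x * U x $ i \<partial>lebesgue_on T) = elem_inner T U (div_mat \<psi>)"
    by (simp add: elem_inner_def div_mat_def inner_vec_def sum_distrib_left mult.commute
        Bochner_Integration.integral_sum I.integrable_cont continuous_intros cont)
  also have "(\<Sum>i\<in>UNIV. \<Sum>j\<in>UNIV. \<Sum>e\<in>faces_of Es T. face_normal T e $ j * (\<integral>x. \<psi> x $ i $ j * U x $ i \<partial>face_measure e)) =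
      (\<Sum>e\<in>faces_of Es T. \<Sum>i\<in>UNIV. \<Sum>j\<in>UNIV. face_normal T e $ j * (\<integral>x. \<psi> x $ i $ j * U x $ i \<partial>face_measure e))"
    by (simp only: sum.swap[of _ "faces_of Es T"])
  also have "\<dots> = (\<Sum>e\<in>faces_of Es T. face_inner e U (\<lambda>x. \<psi> x *v face_normal T e))"
  proof (rule sum.cong[OF refl])
    fix e assume "e \<in> faces_of Es T"
    then interpret J: integration_support "face_measure e" e by (intro face_support faces_ofD)
    have "face_inner e U (\<lambda>x. \<psi> x *v face_normal T e) =
        (\<integral>x. (\<Sum>i\<in>UNIV. \<Sum>j\<in>UNIV. face_normal T e $ j * (\<psi> x $ i $ j * U x $ i)) \<partial>face_measure e)"
      by (simp add: face_inner_def inner_vec_def matrix_vector_mult_def sum_distrib_left mult_ac)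
    also have "\<dots> = (\<Sum>i\<in>UNIV. \<Sum>j\<in>UNIV. face_normal T e $ j * (\<integral>x. \<psi> x $ i $ j * U x $ i \<partial>face_measure e))"
      by (simp add: Bochner_Integration.integral_sum J.integrable_cont continuous_intros cont)
    finally show "(\<Sum>i\<in>UNIV. \<Sum>j\<in>UNIV. face_normal T e $ j * (\<integral>x. \<psi> x $ i $ j * U x $ i \<partial>face_measure e)) =
        face_inner e U (\<lambda>x. \<psi> x *v face_normal T e)" by simp
  qed
  finally show ?thesis .
qed

lemma weak_strain_weak_op:
  "weak_strain k Es v T = weak_op k T (\<lambda>\<phi>. div_mat (\<lambda>y. sym_part (\<phi> y)))
    (\<lambda>e \<phi> x. sym_part (\<phi> x) *v face_normal T e) (fst v T) (snd v)"
  by (simp add: weak_strain_def weak_op_def bdry_inner_def)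

lemma weak_div_weak_op:
  "weak_div k Es v T = weak_op k T grad (\<lambda>e \<phi>. \<phi>) (fst v T) (\<lambda>e x. snd v e x \<bullet> face_normal T e)"
  by (simp add: weak_div_def weak_op_def bdry_inner_def)

lemma weak_div_mat_weak_op:
  "weak_div_mat k Es v T = weak_op k T grad_vec (\<lambda>e w. w) (fst v T) (\<lambda>e x. snd v e x *v face_normal T e)"
  by (simp add: weak_div_mat_def weak_op_def bdry_inner_def)

lemma admissible_strain:
  "T \<in> Ts \<Longrightarrow> admissible k T (\<lambda>\<phi>. div_mat (\<lambda>y. sym_part (\<phi> y))) (\<lambda>e \<phi> x. sym_part (\<phi> x) *v face_normal T e)"
  unfolding admissible_def
  by (auto intro!: continuous_on_poly_fun[of k] poly_fun_matrix_vector_left poly_fun_div_mat poly_fun_sym_part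
      simp: linear_add[OF linear_sym_part] linear_cmul[OF linear_sym_part] div_mat_comb[of k] poly_fun_sym_part
        linear_add[OF linear_matrix_vector_left] linear_cmul[OF linear_matrix_vector_left])

lemma admissible_div: "T \<in> Ts \<Longrightarrow> admissible k T grad (\<lambda>e \<phi>. \<phi>)"
  unfolding admissible_def
  by (auto intro!: continuous_on_poly_fun[of k] poly_fun_grad simp: grad_comb[of k, unfolded real_scaleR_def])

lemma admissible_div_mat: "T \<in> Ts \<Longrightarrow> admissible k T grad_vec (\<lambda>e w. w)"
  unfolding admissible_def
  by (auto intro!: continuous_on_poly_fun[of k] poly_fun_grad_vec simp: grad_vec_comb[of k])

definition weak_cont :: "('d, 'v::euclidean_space) weak_fun \<Rightarrow> bool" where
  "weak_cont v \<longleftrightarrow> (\<forall>T\<in>Ts. continuous_on T (fst v T)) \<and> (\<forall>e\<in>Es. continuous_on e (snd v e))"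

text \<open>A relation instead of an equation: pointwise sums do not respect the value
  \<open>undefined\<close> off the elements and faces, and the form depends only on the values on
  them.\<close>

definition is_comb :: "real \<Rightarrow> ('d, 'v::euclidean_space) weak_fun \<Rightarrow> ('d, 'v) weak_fun \<Rightarrow> ('d, 'v) weak_fun \<Rightarrow> bool" where
  "is_comb c x y z \<longleftrightarrow>
    (\<forall>T\<in>Ts. \<forall>p\<in>T. fst z T p = c *\<^sub>R fst x T p + fst y T p) \<and>
    (\<forall>e\<in>Es. \<forall>p\<in>e. snd z e p = c *\<^sub>R snd x e p + snd y e p)"

lemma face_subset_elem: "T \<in> Ts \<Longrightarrow> e \<in> faces_of Es T \<Longrightarrow> e \<subseteq> T"
  using faces_ofD(2) frontier_subset_closed compact_imp_closed[OF compact_T] by blast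

lemma weak_contD:
  assumes "weak_cont v"
  shows "T \<in> Ts \<Longrightarrow> continuous_on T (fst v T)" "e \<in> Es \<Longrightarrow> continuous_on e (snd v e)"
    "e \<in> faces_of Es T \<Longrightarrow> continuous_on e (snd v e)" "T \<in> Ts \<Longrightarrow> e \<in> faces_of Es T \<Longrightarrow> continuous_on e (fst v T)"
proof -
  show 1: "T \<in> Ts \<Longrightarrow> continuous_on T (fst v T)" "e \<in> Es \<Longrightarrow> continuous_on e (snd v e)"
    "e \<in> faces_of Es T \<Longrightarrow> continuous_on e (snd v e)"
    using assms faces_ofD by (auto simp: weak_cont_def)
  assume "T \<in> Ts" "e \<in> faces_of Es T"
  moreover from this have "e \<subseteq> T" by (rule face_subset_elem)
  ultimately show "continuous_on e (fst v T)" using 1(1) continuous_on_subset by blast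
qed

lemma is_combD:
  assumes "is_comb c x y z"
  shows "T \<in> Ts \<Longrightarrow> p \<in> T \<Longrightarrow> fst z T p = c *\<^sub>R fst x T p + fst y T p"
    "e \<in> Es \<Longrightarrow> q \<in> e \<Longrightarrow> snd z e q = c *\<^sub>R snd x e q + snd y e q"
    "e \<in> faces_of Es T \<Longrightarrow> q \<in> e \<Longrightarrow> snd z e q = c *\<^sub>R snd x e q + snd y e q"
  using assms faces_ofD by (auto simp: is_comb_def)

lemma weak_cont_comb:
  assumes "weak_cont x" "weak_cont y" "is_comb c x y z"
  shows "weak_cont z"
  unfolding weak_cont_def
proof (intro conjI ballI)
  fix T assume T: "T \<in> Ts"
  have "continuous_on T (\<lambda>p. c *\<^sub>R fst x T p + fst y T p)"
    by (intro continuous_intros weak_contD(1)[OF assms(1) T] weak_contD(1)[OF assms(2) T])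
  then show "continuous_on T (fst z T)" by (simp add: is_combD(1)[OF assms(3) T] cong: continuous_on_cong)
next
  fix e assume e: "e \<in> Es"
  have "continuous_on e (\<lambda>p. c *\<^sub>R snd x e p + snd y e p)"
    by (intro continuous_intros weak_contD(2)[OF assms(1) e] weak_contD(2)[OF assms(2) e])
  then show "continuous_on e (snd z e)" by (simp add: is_combD(2)[OF assms(3) e] cong: continuous_on_cong)
qed

lemma weak_strain_comb:
  assumes "weak_cont x" "weak_cont y" "is_comb c x y z" and T: "T \<in> Ts" "p \<in> T"
  shows "weak_strain k Es z T p = c *\<^sub>R weak_strain k Es x T p + weak_strain k Es y T p"
  unfolding weak_strain_weak_op
  by (rule weak_op_comb[OF admissible_strain[OF T(1)] _ _ _ _ _ _ T(2)])
    (use assms in \<open>auto intro: weak_contD is_combD\<close>)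

lemma weak_div_comb:
  assumes "weak_cont x" "weak_cont y" "is_comb c x y z" and T: "T \<in> Ts" "p \<in> T"
  shows "weak_div k Es z T p = c * weak_div k Es x T p + weak_div k Es y T p"
proof -
  have "weak_div k Es z T p = c *\<^sub>R weak_div k Es x T p + weak_div k Es y T p"
    unfolding weak_div_weak_op
    by (rule weak_op_comb[OF admissible_div[OF T(1)] _ _ _ _ _ _ T(2)])
      (use assms in \<open>auto intro!: weak_contD is_combD continuous_intros simp: is_combD(3)[OF assms(3)] inner_add_left\<close>)
  then show ?thesis by simp
qed

lemma weak_div_mat_comb:
  assumes "weak_cont x" "weak_cont y" "is_comb c x y z" and T: "T \<in> Ts" "p \<in> T"
  shows "weak_div_mat k Es z T p = c *\<^sub>R weak_div_mat k Es x T p + weak_div_mat k Es y T p"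
  unfolding weak_div_mat_weak_op
  by (rule weak_op_comb[OF admissible_div_mat[OF T(1)] _ _ _ _ _ _ T(2)])
    (use assms in \<open>auto intro!: weak_contD is_combD continuous_on_matrix_vector_left simp: is_combD(3)[OF assms(3)]
      linear_add[OF linear_matrix_vector_left] linear_cmul[OF linear_matrix_vector_left]\<close>)

lemma weak_strain_cont: "weak_cont v \<Longrightarrow> T \<in> Ts \<Longrightarrow> continuous_on T (weak_strain k Es v T)"
  unfolding weak_strain_weak_op
  by (intro continuous_on_poly_space[of _ k] weak_op(1) admissible_strain weak_contD)

lemma weak_div_cont: "weak_cont v \<Longrightarrow> T \<in> Ts \<Longrightarrow> continuous_on T (weak_div k Es v T)"
  unfolding weak_div_weak_op
  by (intro continuous_on_poly_space[of _ k] weak_op(1) admissible_div weak_contD continuous_intros)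

lemma weak_div_mat_poly_space: "weak_cont v \<Longrightarrow> T \<in> Ts \<Longrightarrow> weak_div_mat k Es v T \<in> poly_space k T"
  unfolding weak_div_mat_weak_op
  by (intro weak_op(1) admissible_div_mat weak_contD continuous_on_matrix_vector_left)

lemma weak_div_mat_cont: "weak_cont v \<Longrightarrow> T \<in> Ts \<Longrightarrow> continuous_on T (weak_div_mat k Es v T)"
  by (rule continuous_on_poly_space[OF weak_div_mat_poly_space])

lemma residual_cont:
  assumes "weak_cont u" "weak_cont \<sigma>" "T \<in> Ts"
  shows "continuous_on T (residual k Es \<mu> lam u \<sigma> T)"
  unfolding residual_def
  by (intro continuous_intros weak_strain_cont weak_div_cont weak_contD(1) assms)

lemma residual_comb:
  assumes "weak_cont u" "weak_cont u'" "is_comb c u u' w" "weak_cont \<sigma>" "weak_cont \<sigma>'" "is_comb c \<sigma> \<sigma>' \<tau>"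
    and T: "T \<in> Ts" "p \<in> T"
  shows "residual k Es \<mu> lam w \<tau> T p =
    c *\<^sub>R residual k Es \<mu> lam u \<sigma> T p + residual k Es \<mu> lam u' \<sigma>' T p"
  unfolding residual_def weak_strain_comb[OF assms(1-3) T] weak_div_comb[OF assms(1-3) T]
    is_combD(1)[OF assms(6) T]
  by (simp add: algebra_simps)

lemma stabilizer_comb:
  assumes x: "weak_cont x" "weak_cont y" "is_comb c x y z" and w: "weak_cont w"
  shows "stabilizer Ts Es z w = c * stabilizer Ts Es x w + stabilizer Ts Es y w"
proof -
  have "face_inner e (\<lambda>p. fst z T p - snd z e p) (\<lambda>p. fst w T p - snd w e p) =
      c * face_inner e (\<lambda>p. fst x T p - snd x e p) (\<lambda>p. fst w T p - snd w e p) +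
      face_inner e (\<lambda>p. fst y T p - snd y e p) (\<lambda>p. fst w T p - snd w e p)"
    if T: "T \<in> Ts" and e: "e \<in> faces_of Es T" for T e
  proof (rule face_inner_comb[OF faces_ofD(1)[OF e]])
    fix p assume p: "p \<in> e"
    then have "p \<in> T" using face_subset_elem[OF T e] by blast
    then show "fst z T p - snd z e p = c *\<^sub>R (fst x T p - snd x e p) + (fst y T p - snd y e p)"
      using is_combD(1)[OF x(3) T] is_combD(3)[OF x(3) e p] by (simp add: algebra_simps)
  qed (intro continuous_intros weak_contD(3)[OF _ e] weak_contD(4)[OF _ T e] x w)+
  then show ?thesis
    by (simp add: stabilizer_def bdry_inner_def sum.distrib sum_distrib_left algebra_simps)
qed

text \<open>The left-hand side of the scheme as one form in the pair of displacement and stress, the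
  shape \<open>riesz_semidefinite\<close> expects.\<close>

definition lsform ::
    "nat \<Rightarrow> real \<Rightarrow> real \<Rightarrow> ('d, real^'d) weak_fun \<times> ('d, real^'d^'d) weak_fun \<Rightarrow>
      ('d, real^'d) weak_fun \<times> ('d, real^'d^'d) weak_fun \<Rightarrow> real" where
  "lsform k \<mu> lam x y = a_form k Ts Es \<mu> lam (fst x) (fst y) (snd x) (snd y) +
    stabilizer Ts Es (fst x) (fst y) + stabilizer Ts Es (snd x) (snd y)"

lemma lsform_commute: "lsform k \<mu> lam x y = lsform k \<mu> lam y x"
  by (simp add: lsform_def a_form_def stabilizer_def bdry_inner_def elem_inner_commute face_inner_commute
      cong: sum.cong)

lemma lsform_comb:
  assumes x: "weak_cont (fst x)" "weak_cont (snd x)" and y: "weak_cont (fst y)" "weak_cont (snd y)"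
    and z: "is_comb c (fst x) (fst y) (fst z)" "is_comb c (snd x) (snd y) (snd z)"
    and w: "weak_cont (fst w)" "weak_cont (snd w)"
  shows "lsform k \<mu> lam z w = c * lsform k \<mu> lam x w + lsform k \<mu> lam y w"
proof -
  have "elem_inner T (weak_div_mat k Es (snd z) T) (weak_div_mat k Es (snd w) T) =
      c * elem_inner T (weak_div_mat k Es (snd x) T) (weak_div_mat k Es (snd w) T) +
      elem_inner T (weak_div_mat k Es (snd y) T) (weak_div_mat k Es (snd w) T)" if T: "T \<in> Ts" for T
    by (rule elem_inner_comb[OF T weak_div_mat_cont[OF x(2) T] weak_div_mat_cont[OF y(2) T]
        weak_div_mat_cont[OF w(2) T] weak_div_mat_comb[OF x(2) y(2) z(2) T]])
  moreover have "elem_inner T (residual k Es \<mu> lam (fst z) (snd z) T) (residual k Es \<mu> lam (fst w) (snd w) T) =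
      c * elem_inner T (residual k Es \<mu> lam (fst x) (snd x) T) (residual k Es \<mu> lam (fst w) (snd w) T) +
      elem_inner T (residual k Es \<mu> lam (fst y) (snd y) T) (residual k Es \<mu> lam (fst w) (snd w) T)" if T: "T \<in> Ts" for T
    by (rule elem_inner_comb[OF T residual_cont[OF x T] residual_cont[OF y T]
        residual_cont[OF w T] residual_comb[OF x(1) y(1) z(1) x(2) y(2) z(2) T]])
  ultimately have "a_form k Ts Es \<mu> lam (fst z) (fst w) (snd z) (snd w) =
      c * a_form k Ts Es \<mu> lam (fst x) (fst w) (snd x) (snd w) + a_form k Ts Es \<mu> lam (fst y) (fst w) (snd y) (snd w)"
    by (simp add: a_form_def sum.distrib sum_distrib_left algebra_simps)
  then show ?thesis
    unfolding lsform_def stabilizer_comb[OF x(1) y(1) z(1) w(1)] stabilizer_comb[OF x(2) y(2) z(2) w(2)]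
    by (simp add: algebra_simps)
qed

lemma stabilizer_nonneg: "0 \<le> stabilizer Ts Es x x"
  unfolding stabilizer_def bdry_inner_def
  by (intro sum_nonneg mult_nonneg_nonneg face_inner_nonneg faces_ofD) (auto simp: less_imp_le diameter_pos)

lemma a_form_nonneg: "0 \<le> a_form k Ts Es \<mu> lam u u \<sigma> \<sigma>"
  unfolding a_form_def by (intro sum_nonneg add_nonneg_nonneg elem_inner_nonneg)

lemma lsform_nonneg: "0 \<le> lsform k \<mu> lam x x"
  unfolding lsform_def by (intro add_nonneg_nonneg a_form_nonneg stabilizer_nonneg)

lemma stabilizer_zero:
  assumes x: "weak_cont x" and z: "stabilizer Ts Es x x = 0"
    and T: "T \<in> Ts" and e: "e \<in> faces_of Es T" and p: "p \<in> e"
  shows "fst x T p = snd x e p"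
proof -
  let ?f = "\<lambda>T e p. fst x T p - snd x e p"
  have nn: "0 \<le> (\<Sum>e\<in>faces_of Es T. face_inner e (?f T e) (?f T e))" for T
    by (intro sum_nonneg face_inner_nonneg faces_ofD)
  have "\<forall>T\<in>Ts. inverse (diameter T) * (\<Sum>e\<in>faces_of Es T. face_inner e (?f T e) (?f T e)) = 0"
    using z nn unfolding stabilizer_def bdry_inner_def
    by (subst (asm) sum_nonneg_eq_0_iff[OF finite_Ts]) (auto simp: less_imp_le diameter_pos)
  then have "(\<Sum>e\<in>faces_of Es T. face_inner e (?f T e) (?f T e)) = 0"
    using T diameter_pos[OF T] by auto
  then have "face_inner e (?f T e) (?f T e) = 0"
    using sum_nonneg_eq_0_iff[OF finite_faces, of T "\<lambda>e. face_inner e (?f T e) (?f T e)"]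
      face_inner_nonneg faces_ofD(1) e by blast
  moreover have "continuous_on e (?f T e)"
    by (intro continuous_intros weak_contD(4)[OF x T e] weak_contD(3)[OF x e])
  ultimately show ?thesis using face_inner_definite[OF faces_ofD(1)[OF e] _ _ p] by fastforce
qed

lemma lsform_zero:
  assumes u: "weak_cont u" and \<sigma>: "weak_cont \<sigma>" and z: "lsform k \<mu> lam (u, \<sigma>) (u, \<sigma>) = 0"
  shows "T \<in> Ts \<Longrightarrow> x \<in> T \<Longrightarrow> weak_div_mat k Es \<sigma> T x = 0"
    "T \<in> Ts \<Longrightarrow> x \<in> T \<Longrightarrow> residual k Es \<mu> lam u \<sigma> T x = 0"
    "T \<in> Ts \<Longrightarrow> e \<in> faces_of Es T \<Longrightarrow> x \<in> e \<Longrightarrow> fst u T x = snd u e x"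
    "T \<in> Ts \<Longrightarrow> e \<in> faces_of Es T \<Longrightarrow> x \<in> e \<Longrightarrow> fst \<sigma> T x = snd \<sigma> e x"
proof -
  have s: "a_form k Ts Es \<mu> lam u u \<sigma> \<sigma> = 0" "stabilizer Ts Es u u = 0" "stabilizer Ts Es \<sigma> \<sigma> = 0"
    using z a_form_nonneg[of k \<mu> lam u \<sigma>] stabilizer_nonneg[of u] stabilizer_nonneg[of \<sigma>]
    by (simp_all add: lsform_def)
  show "T \<in> Ts \<Longrightarrow> e \<in> faces_of Es T \<Longrightarrow> x \<in> e \<Longrightarrow> fst u T x = snd u e x"
    "T \<in> Ts \<Longrightarrow> e \<in> faces_of Es T \<Longrightarrow> x \<in> e \<Longrightarrow> fst \<sigma> T x = snd \<sigma> e x"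
    by (rule stabilizer_zero[OF u s(2)] stabilizer_zero[OF \<sigma> s(3)]; assumption)+
  let ?d = "\<lambda>T. weak_div_mat k Es \<sigma> T" and ?r = "\<lambda>T. residual k Es \<mu> lam u \<sigma> T"
  have sum0: "elem_inner T (?d T) (?d T) + elem_inner T (?r T) (?r T) = 0" if "T \<in> Ts" for T
    using s(1) that unfolding a_form_def
    by (subst (asm) sum_nonneg_eq_0_iff[OF finite_Ts]) (auto intro: add_nonneg_nonneg elem_inner_nonneg)
  have 0: "elem_inner T (?d T) (?d T) = 0" "elem_inner T (?r T) (?r T) = 0" if T: "T \<in> Ts" for T
    using sum0[OF T] elem_inner_nonneg[OF T, of "?d T"] elem_inner_nonneg[OF T, of "?r T"] by linarith+
  show "weak_div_mat k Es \<sigma> T x = 0" if "T \<in> Ts" "x \<in> T"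
    by (rule elem_inner_definite[OF that(1) weak_div_mat_cont[OF \<sigma> that(1)] 0(1)[OF that(1)] that(2)])
  show "residual k Es \<mu> lam u \<sigma> T x = 0" if "T \<in> Ts" "x \<in> T"
    by (rule elem_inner_definite[OF that(1) residual_cont[OF u \<sigma> that(1)] 0(2)[OF that(1)] that(2)])
qed

end

section \<open>Definiteness of the least-squares form\<close>

text \<open>The hypothesis \<open>rigid\<close> follows from a vanishing symmetric gradient along segments, without
  second derivatives.\<close>

lemma rigid_zero:
  fixes u :: "real^'d \<Rightarrow> real^'d"
  assumes rigid: "\<And>x y. (u x - u y) \<bullet> (x - y) = 0"
    and face: "hyperplane_face e n c" and x0: "x0 \<in> e" and zero: "\<And>x. x \<in> e \<Longrightarrow> u x = 0"
  shows "u x = 0"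
proof -
  interpret hyperplane_face e n c by (rule face)
  have base: "u x \<bullet> (x - x0) = 0" for x using rigid[of x x0] zero[OF x0] by simp
  \<comment> \<open>Polarization of \<open>base\<close>: about \<open>x0\<close>, where
    \<open>u\<close> vanishes, the motion is antisymmetric.\<close>
  have skew: "u x \<bullet> (y - x0) = - (u y \<bullet> (x - x0))" for x y
  proof -
    have "(u x - u y) \<bullet> ((x - x0) - (y - x0)) = 0" using rigid[of x y] by simp
    then show ?thesis using base[of x] base[of y] by (simp add: inner_diff_left inner_diff_right)
  qed
  \<comment> \<open>Antisymmetry against the points of \<open>e\<close>, where \<open>u\<close> is
    zero, makes \<open>u x\<close> orthogonal to all tangential directions of the face.\<close>
  have normal: "u x = (u x \<bullet> n) *\<^sub>R n" for x
  proof -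
    have aff: "affine {z. u x \<bullet> z = u x \<bullet> x0}" by (rule affine_hyperplane)
    have "e \<subseteq> {z. u x \<bullet> z = u x \<bullet> x0}"
    proof
      fix y assume "y \<in> e"
      then have "u x \<bullet> (y - x0) = 0" using skew[of x y] zero by simp
      then show "y \<in> {z. u x \<bullet> z = u x \<bullet> x0}" by (simp add: inner_diff_right)
    qed
    then have hsub: "affine hull e \<subseteq> {z. u x \<bullet> z = u x \<bullet> x0}" using aff by (rule hull_minimal)
    define w where "w = u x - (u x \<bullet> n) *\<^sub>R n"
    have nw: "n \<bullet> w = 0" by (simp add: w_def inner_diff_right inner_commute)
    have "x0 + w \<in> affine hull e" using n_e[OF x0] nw by (simp add: hull inner_add_right)
    then have "u x \<bullet> w = 0" using hsub by (auto simp: inner_add_right)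
    moreover have "w \<bullet> w = u x \<bullet> w - (u x \<bullet> n) * (n \<bullet> w)"
      by (simp add: w_def algebra_simps inner_commute)
    ultimately have "w \<bullet> w = 0" using nw by simp
    then show ?thesis by (simp add: w_def)
  qed
  have off: "u x = 0" if "n \<bullet> (x - x0) \<noteq> 0" for x
  proof -
    have "u x \<bullet> (x - x0) = (u x \<bullet> n) * (n \<bullet> (x - x0))" by (subst normal) simp
    then have "u x \<bullet> n = 0" using base[of x] that by simp
    then show ?thesis using normal[of x] by simp
  qed
  show "u x = 0"
  proof (cases "n \<bullet> (x - x0) = 0")
    case True
    \<comment> \<open>For \<open>x\<close> in the plane of the face, \<open>base\<close> gives no
      information on the normal component; it is obtained from antisymmetry against a point off the
      plane, where the motion is already known to vanish.\<close>
    have "u (x0 + n) = 0" by (rule off) simp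
    then have "u x \<bullet> n = 0" using skew[of x "x0 + n"] by simp
    then show ?thesis using normal[of x] by simp
  qed (rule off)
qed

text \<open>Along the segment from \<open>y\<close> to \<open>x\<close>, the derivative of
  \<open>U\<close> in the direction \<open>h\<close>, paired with \<open>h\<close>, is the quadratic
  form of the gradient. It sees only the symmetric part, so \<open>f\<close> is constant.\<close>

lemma sym_grad_zero_rigid:
  fixes U :: "real^'d \<Rightarrow> real^'d"
  assumes U: "poly_fun k U" and z: "\<And>x. sym_part (grad_vec U x) = 0"
  shows "(U x - U y) \<bullet> (x - y) = 0"
proof -
  define h where "h = x - y"
  define f where "f = (\<lambda>s. U (y + s *\<^sub>R h) \<bullet> h)"
  have Ui: "poly_fun k (\<lambda>x. U x $ i)" for i using U by (rule poly_fun_component)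
  have quad: "(\<Sum>i\<in>UNIV. (\<Sum>j\<in>UNIV. h $ j * partial j (\<lambda>x. U x $ i) p) * h $ i) = 0" for p
  proof -
    define A where "A = (\<chi> i j. h $ i * h $ j)"
    have "transpose A = A" by (simp add: A_def transpose_def vec_eq_iff mult.commute)
    then have "sym_part A = A" by (simp add: sym_part_def vec_eq_iff)
    then have "grad_vec U p \<bullet> A = sym_part (grad_vec U p) \<bullet> A" using sym_part_inner(1) by metis
    then have "grad_vec U p \<bullet> A = 0" by (simp add: z)
    then show ?thesis
      by (simp add: inner_vec_def grad_vec_def A_def sum_distrib_right sum_distrib_left mult_ac)
  qed
  have "(f has_real_derivative 0) (at s)" for s
  proof -
    let ?p = "y + s *\<^sub>R h"
    have "((\<lambda>s. y + s *\<^sub>R h) has_derivative (\<lambda>t. t *\<^sub>R h)) (at s)"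
      by (auto intro!: derivative_eq_intros)
    from has_derivative_compose[OF this has_derivative_partial[OF poly_fun_differentiable[OF Ui]]]
    have "((\<lambda>s. U (y + s *\<^sub>R h) $ i) has_derivative
        (\<lambda>t. \<Sum>j\<in>UNIV. (t *\<^sub>R h) $ j * partial j (\<lambda>x. U x $ i) ?p)) (at s)" for i .
    then have "((\<lambda>s. \<Sum>i\<in>UNIV. U (y + s *\<^sub>R h) $ i * h $ i) has_derivative
        (\<lambda>t. \<Sum>i\<in>UNIV. (\<Sum>j\<in>UNIV. (t *\<^sub>R h) $ j * partial j (\<lambda>x. U x $ i) ?p) * h $ i)) (at s)"
      by (intro has_derivative_sum has_derivative_mult_left)
    moreover have "(\<lambda>s. \<Sum>i\<in>UNIV. U (y + s *\<^sub>R h) $ i * h $ i) = f"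
      by (simp add: f_def inner_vec_def fun_eq_iff)
    moreover have "(\<lambda>t. \<Sum>i\<in>UNIV. (\<Sum>j\<in>UNIV. (t *\<^sub>R h) $ j * partial j (\<lambda>x. U x $ i) ?p) * h $ i) = (*) 0"
    proof
      fix t
      have "(\<Sum>i\<in>UNIV. (\<Sum>j\<in>UNIV. (t *\<^sub>R h) $ j * partial j (\<lambda>x. U x $ i) ?p) * h $ i) =
          t * (\<Sum>i\<in>UNIV. (\<Sum>j\<in>UNIV. h $ j * partial j (\<lambda>x. U x $ i) ?p) * h $ i)"
        by (simp add: sum_distrib_left sum_distrib_right mult_ac)
      then show "(\<Sum>i\<in>UNIV. (\<Sum>j\<in>UNIV. (t *\<^sub>R h) $ j * partial j (\<lambda>x. U x $ i) ?p) * h $ i) = 0 * t"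
        by (simp add: quad)
    qed
    ultimately show ?thesis by (simp add: has_field_derivative_def)
  qed
  then have "f 1 = f 0" using DERIV_isconst_all by blast
  then show ?thesis by (simp add: f_def h_def inner_diff_left)
qed

section \<open>From zero energy to zero solution\<close>

context regular_mesh
begin

text \<open>With matching traces, integration by parts turns the defining equations into tests that
  the classical strain passes; it has degree at most \<open>k\<close> like \<open>U\<close>.\<close>

lemma weak_strain_eq:
  assumes T: "T \<in> Ts" and u: "weak_cont u" and U: "poly_fun k U"
    and eq: "\<And>x. x \<in> T \<Longrightarrow> fst u T x = U x" "\<And>e x. e \<in> faces_of Es T \<Longrightarrow> x \<in> e \<Longrightarrow> snd u e x = U x"
    and x: "x \<in> T"
  shows "weak_strain k Es u T x = sym_part (grad_vec U x)"
  unfolding weak_strain_weak_op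
proof (rule weak_op_eqI[OF admissible_strain[OF T] weak_contD(1)[OF u T] weak_contD(3)[OF u] _ _ x])
  show "poly_fun k (\<lambda>x. sym_part (grad_vec U x))" using U by (intro poly_fun_sym_part poly_fun_grad_vec)
  fix \<phi> :: "real^'d \<Rightarrow> real^'d^'d" assume \<phi>: "poly_fun k \<phi>"
  have s: "poly_fun k (\<lambda>x. sym_part (\<phi> x))" using \<phi> by (rule poly_fun_sym_part)
  have "elem_inner T (\<lambda>x. sym_part (grad_vec U x)) \<phi> = elem_inner T (grad_vec U) (\<lambda>x. sym_part (\<phi> x))"
    by (simp add: elem_inner_def sym_part_inner(1))
  also have "\<dots> = - elem_inner T U (div_mat (\<lambda>x. sym_part (\<phi> x))) +
      (\<Sum>e\<in>faces_of Es T. face_inner e U (\<lambda>x. sym_part (\<phi> x) *v face_normal T e))"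
    by (rule integration_by_parts_matrix[OF T U s])
  also have "elem_inner T U (div_mat (\<lambda>x. sym_part (\<phi> x))) = elem_inner T (fst u T) (div_mat (\<lambda>x. sym_part (\<phi> x)))"
    by (rule elem_inner_cong[OF T]) (use U s eq in \<open>auto intro: continuous_on_poly_fun poly_fun_div_mat\<close>)
  also have "(\<Sum>e\<in>faces_of Es T. face_inner e U (\<lambda>x. sym_part (\<phi> x) *v face_normal T e)) =
      (\<Sum>e\<in>faces_of Es T. face_inner e (snd u e) (\<lambda>x. sym_part (\<phi> x) *v face_normal T e))"
    by (intro sum.cong refl face_inner_cong faces_ofD continuous_on_poly_fun[OF U]
        continuous_on_matrix_vector_left continuous_on_poly_fun[OF s]) (simp_all add: eq)
  finally show "elem_inner T (\<lambda>x. sym_part (grad_vec U x)) \<phi> =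
      - elem_inner T (fst u T) (div_mat (\<lambda>y. sym_part (\<phi> y))) +
      (\<Sum>e\<in>faces_of Es T. face_inner e (snd u e) (\<lambda>x. sym_part (\<phi> x) *v face_normal T e))" .
qed

text \<open>The matrix formula is applied to \<open>\<phi> x *\<^sub>R mat 1\<close>, whose row
  divergence is \<open>grad \<phi>\<close> and whose product with the normal is
  \<open>\<phi> x\<close> times the normal.\<close>

lemma weak_div_eq:
  assumes T: "T \<in> Ts" and u: "weak_cont u" and U: "poly_fun k U"
    and eq: "\<And>x. x \<in> T \<Longrightarrow> fst u T x = U x" "\<And>e x. e \<in> faces_of Es T \<Longrightarrow> x \<in> e \<Longrightarrow> snd u e x = U x"
    and x: "x \<in> T"
  shows "weak_div k Es u T x = mat 1 \<bullet> grad_vec U x"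
  unfolding weak_div_weak_op
proof (rule weak_op_eqI[OF admissible_div[OF T] weak_contD(1)[OF u T] _ _ _ x])
  show "continuous_on e (\<lambda>x. snd u e x \<bullet> face_normal T e)" if "e \<in> faces_of Es T" for e
    by (intro continuous_intros weak_contD(3)[OF u that])
  show "poly_fun k (\<lambda>x. mat 1 \<bullet> grad_vec U x)"
    unfolding inner_mat_1 using U by (intro poly_fun_sum poly_fun_entry poly_fun_grad_vec)
  fix \<phi> :: "real^'d \<Rightarrow> real" assume \<phi>: "poly_fun k \<phi>"
  have s: "poly_fun k (\<lambda>x. \<phi> x *\<^sub>R (mat 1 :: real^'d^'d))"
    using \<phi> by (rule poly_fun_linear) (auto intro!: linearI simp: scaleR_add_left)
  have d: "div_mat (\<lambda>x. \<phi> x *\<^sub>R (mat 1 :: real^'d^'d)) = grad \<phi>"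
  proof
    fix x
    have "partial j (\<lambda>y. \<phi> y * (if i = j then 1 else 0)) x = (if i = j then partial j \<phi> x else 0)" for i j :: 'd
      by (simp add: partial_def)
    then show "div_mat (\<lambda>x. \<phi> x *\<^sub>R (mat 1 :: real^'d^'d)) x = grad \<phi> x"
      by (simp add: div_mat_def grad_def mat_def vec_eq_iff)
  qed
  have "elem_inner T (\<lambda>x. mat 1 \<bullet> grad_vec U x) \<phi> = elem_inner T (grad_vec U) (\<lambda>x. \<phi> x *\<^sub>R mat 1)"
    by (simp add: elem_inner_def inner_commute mult.commute)
  also have "\<dots> = - elem_inner T U (grad \<phi>) +
      (\<Sum>e\<in>faces_of Es T. face_inner e U (\<lambda>x. (\<phi> x *\<^sub>R mat 1) *v face_normal T e))"
    unfolding d[symmetric] by (rule integration_by_parts_matrix[OF T U s])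
  also have "elem_inner T U (grad \<phi>) = elem_inner T (fst u T) (grad \<phi>)"
    by (rule elem_inner_cong[OF T]) (use U \<phi> eq in \<open>auto intro: continuous_on_poly_fun poly_fun_grad\<close>)
  also have "(\<Sum>e\<in>faces_of Es T. face_inner e U (\<lambda>x. (\<phi> x *\<^sub>R mat 1) *v face_normal T e)) =
      (\<Sum>e\<in>faces_of Es T. face_inner e (\<lambda>x. snd u e x \<bullet> face_normal T e) \<phi>)"
  proof (rule sum.cong[OF refl])
    fix e assume e: "e \<in> faces_of Es T"
    have "face_inner e U (\<lambda>x. (\<phi> x *\<^sub>R mat 1) *v face_normal T e) = face_inner e (\<lambda>x. U x \<bullet> face_normal T e) \<phi>"
      by (simp add: face_inner_def scaleR_matrix_vector_assoc[symmetric] mult.commute)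
    also have "\<dots> = face_inner e (\<lambda>x. snd u e x \<bullet> face_normal T e) \<phi>"
      by (intro face_inner_cong faces_ofD[OF e] continuous_intros continuous_on_poly_fun[OF U]
          continuous_on_poly_fun[OF \<phi>]) (simp_all add: eq(2)[OF e])
    finally show "face_inner e U (\<lambda>x. (\<phi> x *\<^sub>R mat 1) *v face_normal T e) =
        face_inner e (\<lambda>x. snd u e x \<bullet> face_normal T e) \<phi>" .
  qed
  finally show "elem_inner T (\<lambda>x. mat 1 \<bullet> grad_vec U x) \<phi> = - elem_inner T (fst u T) (grad \<phi>) +
      (\<Sum>e\<in>faces_of Es T. face_inner e (\<lambda>x. snd u e x \<bullet> face_normal T e) \<phi>)" .
qed

text \<open>Summing over faces first, an interior face contributes its two elements with opposite
  signs. Used both for the energy and for the volume.\<close>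

lemma sum_faces_cancel:
  fixes X :: "(real^'d) set \<Rightarrow> (real^'d) set \<Rightarrow> real"
  assumes bdry: "\<And>T e. T \<in> Ts \<Longrightarrow> e \<in> faces_of Es T \<Longrightarrow> e \<in> boundary_faces \<Omega> Es \<Longrightarrow> X T e = 0"
    and opp: "\<And>T T' e. T \<in> Ts \<Longrightarrow> e \<in> faces_of Es T \<Longrightarrow> T' \<in> Ts \<Longrightarrow> e \<in> faces_of Es T' \<Longrightarrow> T \<noteq> T' \<Longrightarrow>
      X T' e = - X T e"
  shows "(\<Sum>T\<in>Ts. \<Sum>e\<in>faces_of Es T. X T e) = 0"
proof -
  have "(\<Sum>T\<in>Ts. \<Sum>e\<in>faces_of Es T. X T e) = (\<Sum>T\<in>Ts. \<Sum>e\<in>{e\<in>Es. e \<in> faces_of Es T}. X T e)"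
    by (intro sum.cong refl) (auto simp: faces_of_def)
  also have "\<dots> = (\<Sum>e\<in>Es. \<Sum>T\<in>{T\<in>Ts. e \<in> faces_of Es T}. X T e)"
    by (rule sum.swap_restrict[OF finite_Ts finite_Es])
  also have "\<dots> = 0"
  proof (rule sum.neutral, rule ballI)
    fix e assume e: "e \<in> Es"
    show "(\<Sum>T\<in>{T\<in>Ts. e \<in> faces_of Es T}. X T e) = 0"
    proof (cases "e \<in> boundary_faces \<Omega> Es")
      case True
      then show ?thesis using bdry by (intro sum.neutral) auto
    next
      case False
      then have "card {T\<in>Ts. e \<in> faces_of Es T} = 2" using e by (intro face_of_two) blast
      then obtain T T' where TT: "{T\<in>Ts. e \<in> faces_of Es T} = {T, T'}" "T \<noteq> T'"
        unfolding card_2_iff by blast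
      then have "T \<in> Ts" "e \<in> faces_of Es T" "T' \<in> Ts" "e \<in> faces_of Es T'" by blast+
      from opp[OF this TT(2)] show ?thesis unfolding TT(1) using TT(2) by simp
    qed
  qed
  finally show ?thesis .
qed

lemma face_nonempty: "e \<in> Es \<Longrightarrow> \<exists>x. x \<in> e"
  using polytopal_rel_interior_nonempty[OF polytopal_e] rel_interior_subset by blast

text \<open>The volume of the elements with a nonzero motion is computed by the divergence theorem for
  \<open>x $ j\<close> in direction \<open>j\<close>, whose face terms cancel.\<close>

lemma rigid_motions_vanish:
  assumes rigid: "\<And>T x y. T \<in> Ts \<Longrightarrow> (U T x - U T y) \<bullet> (x - y) = 0"
    and cont: "\<And>T e x. T \<in> Ts \<Longrightarrow> e \<in> faces_of Es T \<Longrightarrow> x \<in> e \<Longrightarrow> U T x = b e x"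
    and bdry: "\<And>e x. e \<in> boundary_faces \<Omega> Es \<Longrightarrow> x \<in> e \<Longrightarrow> b e x = (0::real^'d)"
    and T: "T \<in> Ts"
  shows "U T x = 0"
proof (rule ccontr)
  assume nz: "U T x \<noteq> 0"
  define \<S> where "\<S> = {T\<in>Ts. \<exists>x. U T x \<noteq> 0}"
  \<comment> \<open>A rigid motion vanishing on a face is zero, so an element of \<open>\<S>\<close>
    has no face on which the trace vanishes; in particular, none on the boundary.\<close>
  have rz: "T \<notin> \<S>" if T: "T \<in> Ts" "e \<in> faces_of Es T" "\<And>x. x \<in> e \<Longrightarrow> b e x = 0" for T e
  proof -
    obtain x0 where x0: "x0 \<in> e" using face_nonempty faces_ofD(1)[OF T(2)] by blast
    have "U T x = 0" for x
      by (rule rigid_zero[OF rigid[OF T(1)] off(1)[OF T(1,2)] x0]) (use cont[OF T(1,2)] T(3) in simp)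
    then show ?thesis by (simp add: \<S>_def)
  qed
  fix j :: 'd
  \<comment> \<open>The face terms of the volume of the elements in \<open>\<S>\<close>; any
    \<open>j\<close> will do, since the \<open>j\<close>-th derivative of \<open>x $ j\<close> is
    1.\<close>
  define X where "X = (\<lambda>T e. if T \<in> \<S> then face_normal T e $ j * (\<integral>x. x $ j \<partial>face_measure e) else 0)"
  \<comment> \<open>\<open>\<S>\<close> is closed under passing to a neighbour: a zero motion on one
    side makes the shared trace zero, hence also the motion on the other side.\<close>
  have share: "T' \<in> \<S>" if "T \<in> \<S>" "e \<in> faces_of Es T" "T' \<in> Ts" "e \<in> faces_of Es T'" for T T' e
  proof (rule ccontr)
    assume "T' \<notin> \<S>"
    then have "b e x = 0" if "x \<in> e" for x using cont[of T' e x] that \<open>T' \<in> Ts\<close> \<open>e \<in> faces_of Es T'\<close> by (simp add: \<S>_def)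
    then show False using rz[of T e] \<open>T \<in> \<S>\<close> \<open>e \<in> faces_of Es T\<close> by (auto simp: \<S>_def)
  qed
  have "(\<Sum>T\<in>Ts. \<Sum>e\<in>faces_of Es T. X T e) = 0"
  proof (rule sum_faces_cancel)
    fix T e assume "T \<in> Ts" "e \<in> faces_of Es T" "e \<in> boundary_faces \<Omega> Es"
    then have "T \<notin> \<S>" using bdry rz by blast
    then show "X T e = 0" by (simp add: X_def)
  next
    fix T T' e assume T: "T \<in> Ts" "e \<in> faces_of Es T" "T' \<in> Ts" "e \<in> faces_of Es T'" "T \<noteq> T'"
    have "T \<in> \<S> \<longleftrightarrow> T' \<in> \<S>" using share T by blast
    then show "X T' e = - X T e" using opposite_normals[OF T] by (simp add: X_def)
  qed
  moreover have vol: "(\<Sum>e\<in>faces_of Es T. X T e) = (if T \<in> \<S> then \<integral>x. 1 \<partial>lebesgue_on T else 0)"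
    if T: "T \<in> Ts" for T
  proof -
    interpret flat_boundary T "faces_of Es T" "face_normal T" "off T" planes by (rule flat_boundary[OF T])
    interpret I: integration_support "lebesgue_on T" T by (rule elem_support[OF T])
    have "(\<integral>x. axis j 1 $ j \<partial>lebesgue_on T) =
        (\<Sum>e\<in>faces_of Es T. (face_normal T e \<bullet> axis j 1) * integral\<^sup>L (face_measure e) (\<lambda>x. x $ j))"
      using I.integrable_cont
      by (intro divergence_theorem[where p' = "\<lambda>x v. v $ j"])
        (auto intro: bounded_linear_imp_has_derivative bounded_linear_vec_nth)
    then show ?thesis by (simp add: X_def inner_axis)
  qed
  ultimately have "(\<Sum>T\<in>Ts. if T \<in> \<S> then \<integral>x. 1 \<partial>lebesgue_on T else 0) = (0::real)" by simp
  moreover have nn: "0 \<le> (\<integral>x. 1 \<partial>lebesgue_on T :: real)" for T by (rule integral_nonneg_AE) simp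
  ultimately have "\<forall>T\<in>Ts. (if T \<in> \<S> then \<integral>x. 1 \<partial>lebesgue_on T else 0) = (0::real)"
    by (subst (asm) sum_nonneg_eq_0_iff[OF finite_Ts]) auto
  moreover have "T \<in> \<S>" using nz T by (auto simp: \<S>_def)
  ultimately have "(\<integral>x. 1 \<partial>lebesgue_on T) = (0::real)" using T by auto
  moreover obtain x where "x \<in> T" using interior_T[OF T] interior_subset by blast
  ultimately have "(1::real) = 0"
    by (intro integration_support.definite[OF elem_support[OF T], of "\<lambda>x. 1" x]) auto
  then show False by simp
qed

text \<open>\<open>U\<close> supplies polynomials on the whole space that agree with the
  displacement on the elements; derivatives are taken of these, because \<open>fst u T\<close> may
  be \<open>undefined\<close> outside \<open>T\<close>. The conclusions concern values on elements
  and faces only, which is all that the form can see.\<close>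

theorem lsform_definite:
  assumes \<mu>: "\<mu> > 0" and lam: "lam \<ge> 0"
    and u: "weak_cont u" and \<sigma>: "weak_cont \<sigma>"
    and U: "\<And>T. T \<in> Ts \<Longrightarrow> poly_fun k (U T)" "\<And>T x. T \<in> Ts \<Longrightarrow> x \<in> T \<Longrightarrow> fst u T x = U T x"
    and bdry: "\<And>e x. e \<in> boundary_faces \<Omega> Es \<Longrightarrow> x \<in> e \<Longrightarrow> snd u e x = 0"
    and z: "lsform k \<mu> lam (u, \<sigma>) (u, \<sigma>) = 0"
  shows "T \<in> Ts \<Longrightarrow> x \<in> T \<Longrightarrow> fst u T x = 0" "e \<in> Es \<Longrightarrow> x \<in> e \<Longrightarrow> snd u e x = 0"
    "T \<in> Ts \<Longrightarrow> x \<in> T \<Longrightarrow> fst \<sigma> T x = 0" "e \<in> Es \<Longrightarrow> x \<in> e \<Longrightarrow> snd \<sigma> e x = 0"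
proof -
  note zero = lsform_zero[OF u \<sigma> z]
  have trace: "snd u e x = U T x" if "T \<in> Ts" "e \<in> faces_of Es T" "x \<in> e" for T e x
    using zero(3)[OF that] U(2)[OF that(1)] face_subset_elem[OF that(1,2)] that(3) by auto
  define \<epsilon> where "\<epsilon> = (\<lambda>T x. sym_part (grad_vec (U T) x))"
  define \<delta> where "\<delta> = (\<lambda>T x. mat 1 \<bullet> grad_vec (U T) x)"
  have stress: "fst \<sigma> T x = (2 * \<mu>) *\<^sub>R \<epsilon> T x + (lam * \<delta> T x) *\<^sub>R mat 1" if T: "T \<in> Ts" "x \<in> T" for T x
  proof -
    have "weak_strain k Es u T x = \<epsilon> T x"
      unfolding \<epsilon>_def by (rule weak_strain_eq[OF T(1) u U(1)[OF T(1)] U(2)[OF T(1)] trace[OF T(1)] T(2)])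
    moreover have "weak_div k Es u T x = \<delta> T x"
      unfolding \<delta>_def by (rule weak_div_eq[OF T(1) u U(1)[OF T(1)] U(2)[OF T(1)] trace[OF T(1)] T(2)])
    ultimately show ?thesis using zero(2)[OF T] by (simp add: residual_def algebra_simps)
  qed
  have grad_cont: "continuous_on A (grad_vec (U T))" if "T \<in> Ts" for A T
    using U(1)[OF that] by (intro continuous_on_poly_fun poly_fun_grad_vec)
  have eps_poly: "poly_fun k (\<epsilon> T)" if "T \<in> Ts" for T
    unfolding \<epsilon>_def using U(1)[OF that] by (intro poly_fun_sym_part poly_fun_grad_vec)
  \<comment> \<open>The strain is symmetric, so its product with the full gradient is its product
    with itself; the product of the identity with the gradient is the divergence.\<close>
  have energy: "elem_inner T (fst \<sigma> T) (grad_vec (U T)) =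
      (\<integral>x. 2 * \<mu> * (\<epsilon> T x \<bullet> \<epsilon> T x) + lam * (\<delta> T x)\<^sup>2 \<partial>lebesgue_on T)" if T: "T \<in> Ts" for T
    unfolding elem_inner_def
  proof (rule integration_support.integral_cong_on[OF elem_support[OF T]])
    show "continuous_on T (\<lambda>x. fst \<sigma> T x \<bullet> grad_vec (U T) x)"
      by (intro continuous_intros weak_contD(1)[OF \<sigma> T] grad_cont[OF T])
    show "fst \<sigma> T x \<bullet> grad_vec (U T) x = 2 * \<mu> * (\<epsilon> T x \<bullet> \<epsilon> T x) + lam * (\<delta> T x)\<^sup>2" if "x \<in> T" for x
      unfolding stress[OF T that]
      by (simp add: inner_add_left \<delta>_def[symmetric] power2_eq_square)
        (simp add: \<epsilon>_def \<delta>_def sym_part_inner(2))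
  qed
  have "(\<Sum>T\<in>Ts. elem_inner T (fst \<sigma> T) (grad_vec (U T))) =
      (\<Sum>T\<in>Ts. \<Sum>e\<in>faces_of Es T. face_inner e (\<lambda>x. snd \<sigma> e x *v face_normal T e) (snd u e))"
  proof (rule sum.cong[OF refl])
    fix T assume T: "T \<in> Ts"
    \<comment> \<open>\<open>U T\<close> is an admissible test function for the weak divergence of
      \<open>\<sigma>\<close>, which is zero. No traces of the stress are needed here, only those of
      the displacement.\<close>
    have "0 = elem_inner T (weak_div_mat k Es \<sigma> T) (U T)"
    proof -
      have "elem_inner T (weak_div_mat k Es \<sigma> T) (U T) = elem_inner T (\<lambda>x. 0) (U T)"
        using zero(1)[OF T] by (intro elem_inner_cong[OF T] weak_div_mat_cont[OF \<sigma> T] continuous_on_poly_fun[OF U(1)[OF T]]) auto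
      then show ?thesis by (simp add: elem_inner_def)
    qed
    also have "\<dots> = - elem_inner T (fst \<sigma> T) (grad_vec (U T)) +
        (\<Sum>e\<in>faces_of Es T. face_inner e (\<lambda>x. snd \<sigma> e x *v face_normal T e) (U T))"
      unfolding weak_div_mat_weak_op
      by (intro weak_op(2) admissible_div_mat T U(1) weak_contD(1)[OF \<sigma>] weak_contD(3)[OF \<sigma>] continuous_on_matrix_vector_left)
    also have "(\<Sum>e\<in>faces_of Es T. face_inner e (\<lambda>x. snd \<sigma> e x *v face_normal T e) (U T)) =
        (\<Sum>e\<in>faces_of Es T. face_inner e (\<lambda>x. snd \<sigma> e x *v face_normal T e) (snd u e))"
      by (intro sum.cong refl face_inner_cong faces_ofD continuous_on_matrix_vector_left
          weak_contD(3)[OF \<sigma>] continuous_on_poly_fun[OF U(1)[OF T]]) (simp_all add: trace[OF T])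
    finally show "elem_inner T (fst \<sigma> T) (grad_vec (U T)) =
        (\<Sum>e\<in>faces_of Es T. face_inner e (\<lambda>x. snd \<sigma> e x *v face_normal T e) (snd u e))" by simp
  qed
  also have "\<dots> = 0"
  proof (rule sum_faces_cancel)
    fix T e assume "T \<in> Ts" and e: "e \<in> faces_of Es T" "e \<in> boundary_faces \<Omega> Es"
    have "face_inner e (\<lambda>x. snd \<sigma> e x *v face_normal T e) (snd u e) =
        face_inner e (\<lambda>x. snd \<sigma> e x *v face_normal T e) (\<lambda>x. 0)"
      by (intro face_inner_cong faces_ofD[OF e(1)] continuous_on_matrix_vector_left
          weak_contD(3)[OF \<sigma> e(1)] weak_contD(3)[OF u e(1)]) (simp_all add: bdry[OF e(2)])
    then show "face_inner e (\<lambda>x. snd \<sigma> e x *v face_normal T e) (snd u e) = 0"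
      by (simp add: face_inner_def)
  next
    fix T T' e assume T: "T \<in> Ts" "e \<in> faces_of Es T" "T' \<in> Ts" "e \<in> faces_of Es T'" "T \<noteq> T'"
    have "A *v (- n) = - (A *v n)" for A :: "real^'d^'d" and n
      by (simp add: matrix_vector_mult_def vec_eq_iff sum_negf)
    then show "face_inner e (\<lambda>x. snd \<sigma> e x *v face_normal T' e) (snd u e) =
        - face_inner e (\<lambda>x. snd \<sigma> e x *v face_normal T e) (snd u e)"
      unfolding opposite_normals[OF T] by (simp add: face_inner_def)
  qed
  finally have sum0: "(\<Sum>T\<in>Ts. elem_inner T (fst \<sigma> T) (grad_vec (U T))) = 0" .
  have nn: "0 \<le> 2 * \<mu> * (\<epsilon> T x \<bullet> \<epsilon> T x) + lam * (\<delta> T x)\<^sup>2" for T x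
    using \<mu> lam by simp
  have "\<forall>T\<in>Ts. elem_inner T (fst \<sigma> T) (grad_vec (U T)) = 0"
    using sum0 by (subst (asm) sum_nonneg_eq_0_iff[OF finite_Ts]) (auto simp: energy intro: integral_nonneg_AE nn)
  then have int0: "(\<integral>x. 2 * \<mu> * (\<epsilon> T x \<bullet> \<epsilon> T x) + lam * (\<delta> T x)\<^sup>2 \<partial>lebesgue_on T) = 0" if "T \<in> Ts" for T
    using energy[OF that] that by simp
  have eps0: "\<epsilon> T x = 0" if T: "T \<in> Ts" for T x
  proof (rule poly_fun_zero_on_elem[OF T eps_poly[OF T]])
    fix x assume x: "x \<in> T"
    have "2 * \<mu> * (\<epsilon> T x \<bullet> \<epsilon> T x) + lam * (\<delta> T x)\<^sup>2 = 0"
      by (rule integration_support.definite[OF elem_support[OF T] _ nn int0[OF T] x])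
        (unfold \<delta>_def, intro continuous_intros continuous_on_poly_fun[OF eps_poly[OF T]] grad_cont[OF T])
    moreover have "0 \<le> 2 * \<mu> * (\<epsilon> T x \<bullet> \<epsilon> T x)" "0 \<le> lam * (\<delta> T x)\<^sup>2" using \<mu> lam by simp_all
    ultimately have "2 * \<mu> * (\<epsilon> T x \<bullet> \<epsilon> T x) = 0" by linarith
    then show "\<epsilon> T x = 0" using \<mu> by simp
  qed
  have U0: "U T x = 0" if T: "T \<in> Ts" for T x
  proof (rule rigid_motions_vanish[where U = U and b = "snd u"])
    show "(U T x - U T y) \<bullet> (x - y) = 0" if "T \<in> Ts" for T x y
      using sym_grad_zero_rigid[OF U(1)[OF that]] eps0[OF that] unfolding \<epsilon>_def by blast
  qed (use trace bdry T in auto)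
  have U0': "U T = (\<lambda>x. 0)" if "T \<in> Ts" for T using U0[OF that] by (rule ext)
  have face: "\<exists>T\<in>Ts. e \<in> faces_of Es T" if "e \<in> Es" for e using face_of_some[OF that] .
  have u1: "fst u T x = 0" if "T \<in> Ts" "x \<in> T" for T x using U(2) U0 that by simp
  have u2: "snd u e x = 0" if "e \<in> Es" "x \<in> e" for e x using face trace U0 that by metis
  have "\<delta> T x = 0" if "T \<in> Ts" for T x
    by (simp add: \<delta>_def U0'[OF that] inner_mat_1 grad_vec_def partial_def)
  then have s1: "fst \<sigma> T x = 0" if "T \<in> Ts" "x \<in> T" for T x using stress eps0 that by simp
  have s2: "snd \<sigma> e x = 0" if e: "e \<in> Es" "x \<in> e" for e x
  proof -
    obtain T where T: "T \<in> Ts" "e \<in> faces_of Es T" using face[OF e(1)] by blast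
    have "x \<in> T" using face_subset_elem[OF T] e(2) by blast
    then show ?thesis using zero(4)[OF T e(2)] s1[OF T(1)] by simp
  qed
  show "T \<in> Ts \<Longrightarrow> x \<in> T \<Longrightarrow> fst u T x = 0" "e \<in> Es \<Longrightarrow> x \<in> e \<Longrightarrow> snd u e x = 0"
    "T \<in> Ts \<Longrightarrow> x \<in> T \<Longrightarrow> fst \<sigma> T x = 0" "e \<in> Es \<Longrightarrow> x \<in> e \<Longrightarrow> snd \<sigma> e x = 0"
    by (fact u1 u2 s1 s2)+
qed

end

section \<open>Existence and uniqueness\<close>

lemma mult_le_sum_squares: "0 \<le> a \<Longrightarrow> 0 \<le> b \<Longrightarrow> a * b \<le> a\<^sup>2 + b\<^sup>2" for a b :: real
  using sum_squares_bound[of a b] mult_nonneg_nonneg[of a b] by linarith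

text \<open>Preimages under the two functions differ by a null set, and the completed measure
  contains all such modifications.\<close>

lemma borel_measurable_completion_cong_AE:
  fixes f g :: "'a \<Rightarrow> 'b::topological_space"
  assumes f: "f \<in> borel_measurable (completion M)" and eq: "AE x in completion M. f x = g x"
  shows "g \<in> borel_measurable (completion M)"
proof (rule measurableI)
  fix A :: "'b set" assume "A \<in> sets borel"
  then have fA: "f -` A \<inter> space (completion M) \<in> sets (completion M)" using f by (rule measurable_sets[rotated])
  show "g -` A \<inter> space (completion M) \<in> sets (completion M)"
  proof (rule completion.in_sets_AE[OF _ fA])
    show "AE x in completion M. (x \<in> f -` A \<inter> space (completion M)) = (x \<in> g -` A \<inter> space (completion M))"
      using eq by eventually_elim auto
  qed auto
qed auto

text \<open>A boundary point can be approached by exterior points strictly below the Lipschitz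
  graph. This excludes slits, whose points would disappear into the interior of the closure.\<close>

lemma lipschitz_domain_frontier:
  fixes \<Omega> :: "(real^'d) set"
  assumes "lipschitz_domain \<Omega>"
  shows "frontier \<Omega> \<subseteq> frontier (closure \<Omega>)"
proof
  fix x assume x: "x \<in> frontier \<Omega>"
  have op: "open \<Omega>" using assms by (simp add: lipschitz_domain_def)
  then have xn: "x \<notin> \<Omega>" and xc: "x \<in> closure \<Omega>" using x by (auto simp: frontier_def interior_open)
  obtain r \<nu> \<gamma> L where r: "r > 0" and nu: "norm \<nu> = 1" and lip: "L-lipschitz_on {z. z \<bullet> \<nu> = 0} \<gamma>"
    and gr: "\<Omega> \<inter> ball x r = {y \<in> ball x r. \<gamma> (y - (y \<bullet> \<nu>) *\<^sub>R \<nu>) < y \<bullet> \<nu>}"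
    using assms x unfolding lipschitz_domain_def lipschitz_boundary_def by meson
  have nn: "\<nu> \<bullet> \<nu> = 1" using nu by (simp add: norm_eq_1)
  define \<pi> where "\<pi> = (\<lambda>y. y - (y \<bullet> \<nu>) *\<^sub>R \<nu>)"
  have \<pi>0: "\<pi> y \<bullet> \<nu> = 0" for y by (simp add: \<pi>_def inner_diff_left nn)
  have cont: "continuous_on UNIV (\<lambda>y. \<gamma> (\<pi> y) - y \<bullet> \<nu>)"
  proof (intro continuous_intros)
    show "continuous_on UNIV (\<lambda>y. \<gamma> (\<pi> y))"
      by (rule continuous_on_compose2[OF lipschitz_on_continuous_on[OF lip]])
        (auto simp: \<pi>0, auto simp: \<pi>_def intro!: continuous_intros)
  qed
  have gx: "x \<bullet> \<nu> \<le> \<gamma> (\<pi> x)"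
  proof (rule ccontr)
    assume "\<not> ?thesis"
    then have "x \<in> {y \<in> ball x r. \<gamma> (y - (y \<bullet> \<nu>) *\<^sub>R \<nu>) < y \<bullet> \<nu>}" using r by (simp add: \<pi>_def)
    then show False using xn gr by blast
  qed
  \<comment> \<open>The open region strictly below the graph misses \<open>\<Omega>\<close>, and
    therefore also \<open>closure \<Omega>\<close>.\<close>
  define V where "V = ball x r \<inter> {y. 0 < \<gamma> (\<pi> y) - y \<bullet> \<nu>}"
  have "open V" unfolding V_def by (intro open_Int open_ball open_Collect_less cont continuous_on_const)
  moreover have "V \<inter> {y \<in> ball x r. \<gamma> (y - (y \<bullet> \<nu>) *\<^sub>R \<nu>) < y \<bullet> \<nu>} = {}"
    unfolding V_def \<pi>_def by auto
  then have "V \<inter> \<Omega> = {}" using gr unfolding V_def by blast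
  ultimately have V: "V \<inter> closure \<Omega> = {}" by (simp add: open_Int_closure_eq_empty)
  have "x \<in> closure (- closure \<Omega>)"
    unfolding closure_approachable
  proof (intro allI impI)
    fix s :: real assume s: "s > 0"
    define t where "t = min r s / 2"
    have t: "t > 0" "t < r" "t < s" using r s by (auto simp: t_def min_def)
    define y where "y = x - t *\<^sub>R \<nu>"
    have "\<pi> y = \<pi> x" by (simp add: \<pi>_def y_def inner_diff_left nn algebra_simps)
    moreover have "y \<bullet> \<nu> = x \<bullet> \<nu> - t" by (simp add: y_def inner_diff_left nn)
    ultimately have "y \<in> V" using gx t nu by (simp add: V_def y_def dist_norm)
    then have "y \<in> - closure \<Omega>" using V by blast
    moreover have "dist y x < s" using t nu by (simp add: y_def dist_norm)
    ultimately show "\<exists>y\<in>- closure \<Omega>. dist y x < s" by blast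
  qed
  then show "x \<in> frontier (closure \<Omega>)"
    using xc by (simp add: frontier_def closure_complement)
qed

lemma subspace_PiE_zero:
  assumes "\<And>i. i \<in> I \<Longrightarrow> subspace (V i)"
  shows "subspace {f. (\<forall>i\<in>I. f i \<in> V i) \<and> (\<forall>i. i \<notin> I \<longrightarrow> f i = 0)}"
  using assms by (auto simp: subspace_def)

section \<open>The load, the boundary data and the linear test space\<close>

context regular_mesh
begin

lemma negligible_face: "e \<in> Es \<Longrightarrow> negligible e"
proof -
  assume "e \<in> Es"
  then obtain n c where h: "hyperplane_face e n c" using polytopal_hyperplane polytopal_e by blast
  interpret hyperplane_face e n c by (rule h)
  have "n \<noteq> 0" using n by auto
  then have "negligible {z. n \<bullet> z = c}" by (intro negligible_hyperplane) simp
  moreover have "e \<subseteq> {z. n \<bullet> z = c}" using n_e by blast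
  ultimately show ?thesis by (rule negligible_subset)
qed

text \<open>The elements cover the closure, so \<open>T\<close> leaves \<open>\<Omega>\<close> only
  on its frontier. That is part of the frontier of the union of all elements, hence lies in finitely
  many flat faces.\<close>

lemma negligible_elem_diff:
  assumes "lipschitz_domain \<Omega>" "T \<in> Ts"
  shows "negligible (T - \<Omega>)"
proof -
  have cover: "\<Union>Ts = closure \<Omega>" using mesh by (simp add: polytopal_mesh_def)
  have "open \<Omega>" using assms(1) by (simp add: lipschitz_domain_def)
  then have "T - \<Omega> \<subseteq> frontier \<Omega>" using cover assms(2) by (auto simp: frontier_def interior_open)
  also have "\<dots> \<subseteq> frontier (\<Union>Ts)" unfolding cover by (rule lipschitz_domain_frontier[OF assms(1)])
  also have "\<dots> \<subseteq> (\<Union>T\<in>Ts. frontier T)" by (rule frontier_Union_subset[OF finite_Ts])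
  also have "\<dots> \<subseteq> \<Union>Es" using frontier_T faces_ofD by blast
  finally show ?thesis
    using negligible_Union[OF finite_Es negligible_face] negligible_subset by blast
qed

text \<open>\<open>f\<close> is controlled on \<open>\<Omega>\<close> only, while \<open>T\<close>
  may contain points outside it. Those form a null set, so \<open>f\<close> can be exchanged for its
  extension by zero, whose product with \<open>w\<close> is dominated by the sum of the squared
  norms.\<close>

lemma integrable_load:
  fixes f w :: "real^'d \<Rightarrow> real^'d"
  assumes lip: "lipschitz_domain \<Omega>" and f: "square_integrable (lebesgue_on \<Omega>) f"
    and T: "T \<in> Ts" and w: "continuous_on T w"
  shows "integrable (lebesgue_on T) (\<lambda>x. f x \<bullet> w x)"
proof -
  define F where "F = (\<lambda>x. indicator \<Omega> x *\<^sub>R f x)"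
  have \<Omega>: "\<Omega> \<inter> space lebesgue \<in> sets lebesgue" using lip by (simp add: lipschitz_domain_def borel_open)
  have Tm: "T \<inter> space lebesgue \<in> sets lebesgue" using compact_T[OF T] by (simp add: borel_closed compact_imp_closed)
  have Fm: "F \<in> borel_measurable lebesgue"
    using f unfolding F_def square_integrable_def by (simp add: borel_measurable_restrict_space_iff[OF \<Omega>])
  have "integrable lebesgue (\<lambda>x. indicator \<Omega> x *\<^sub>R (norm (f x))\<^sup>2)"
    using f unfolding square_integrable_def by (simp add: integrable_restrict_space[OF \<Omega>])
  then have "integrable lebesgue (\<lambda>x. indicator T x *\<^sub>R (indicator \<Omega> x *\<^sub>R (norm (f x))\<^sup>2))"
    by (rule integrable_mult_indicator[rotated]) (use Tm in simp)
  then have F2: "integrable (lebesgue_on T) (\<lambda>x. (norm (F x))\<^sup>2)"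
    unfolding integrable_restrict_space[OF Tm]
    by (rule Bochner_Integration.integrable_cong[OF refl, THEN iffD1, rotated]) (auto simp: F_def indicator_def)
  have w2: "integrable (lebesgue_on T) (\<lambda>x. (norm (w x))\<^sup>2)"
    by (intro integration_support.integrable_cont[OF elem_support[OF T]] continuous_intros w)
  have wm: "w \<in> borel_measurable (lebesgue_on T)"
    using continuous_imp_measurable_on_sets_lebesgue[OF w] Tm by simp
  have FT: "F \<in> borel_measurable (lebesgue_on T)" using Fm by (rule measurable_restrict_space1)
  have Fw: "integrable (lebesgue_on T) (\<lambda>x. F x \<bullet> w x)"
  proof (rule Bochner_Integration.integrable_bound[OF Bochner_Integration.integrable_add[OF F2 w2]])
    show "(\<lambda>x. F x \<bullet> w x) \<in> borel_measurable (lebesgue_on T)" using FT wm by measurable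
    have "\<bar>F x \<bullet> w x\<bar> \<le> (norm (F x))\<^sup>2 + (norm (w x))\<^sup>2" for x
    proof -
      have "\<bar>F x \<bullet> w x\<bar> \<le> norm (F x) * norm (w x)" by (rule Cauchy_Schwarz_ineq2)
      also have "\<dots> \<le> (norm (F x))\<^sup>2 + (norm (w x))\<^sup>2"
        by (rule mult_le_sum_squares) simp_all
      finally show ?thesis .
    qed
    then show "AE x in lebesgue_on T. norm (F x \<bullet> w x) \<le> norm ((norm (F x))\<^sup>2 + (norm (w x))\<^sup>2)"
      by (intro AE_I2) (simp add: order_trans[OF _ abs_ge_self])
  qed
  have "AE x in lebesgue. x \<notin> T - \<Omega>"
    using negligible_elem_diff[OF lip T] by (intro AE_not_in) (simp add: negligible_iff_null_sets)
  then have ae: "AE x in lebesgue. indicator T x *\<^sub>R (F x \<bullet> w x) = indicator T x *\<^sub>R (f x \<bullet> w x)"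
    by eventually_elim (auto simp: F_def indicator_def)
  have i: "integrable lebesgue (\<lambda>x. indicator T x *\<^sub>R (F x \<bullet> w x))"
    using Fw unfolding integrable_restrict_space[OF Tm] .
  have "(\<lambda>x. indicator T x *\<^sub>R (f x \<bullet> w x)) \<in> borel_measurable lebesgue"
    using borel_measurable_completion_cong_AE[OF borel_measurable_integrable[OF i] ae] .
  from integrable_cong_AE_imp[OF i this ae] show ?thesis
    unfolding integrable_restrict_space[OF Tm] .
qed

definition load :: "nat \<Rightarrow> (real^'d \<Rightarrow> real^'d) \<Rightarrow> ('d, real^'d) weak_fun \<times> ('d, real^'d^'d) weak_fun \<Rightarrow> real" where
  "load k f x = (\<Sum>T\<in>Ts. elem_inner T (\<lambda>x. - f x) (weak_div_mat k Es (snd x) T))"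

lemma load_comb:
  assumes lip: "lipschitz_domain \<Omega>" and f: "square_integrable (lebesgue_on \<Omega>) f"
    and x: "weak_cont (snd x)" and y: "weak_cont (snd y)" and z: "is_comb c (snd x) (snd y) (snd z)"
  shows "load k f z = c * load k f x + load k f y"
proof -
  have "elem_inner T (\<lambda>x. - f x) (weak_div_mat k Es (snd z) T) =
      c * elem_inner T (\<lambda>x. - f x) (weak_div_mat k Es (snd x) T) + elem_inner T (\<lambda>x. - f x) (weak_div_mat k Es (snd y) T)"
    if T: "T \<in> Ts" for T
  proof -
    let ?d = "\<lambda>x. weak_div_mat k Es (snd x) T"
    have i: "integrable (lebesgue_on T) (\<lambda>p. f p \<bullet> ?d x p)" "integrable (lebesgue_on T) (\<lambda>p. f p \<bullet> ?d y p)"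
      using integrable_load[OF lip f T] weak_div_mat_cont x y T by blast+
    have "elem_inner T (\<lambda>x. - f x) (?d z) = (\<integral>p. - (c * (f p \<bullet> ?d x p) + f p \<bullet> ?d y p) \<partial>lebesgue_on T)"
      unfolding elem_inner_def
      by (intro Bochner_Integration.integral_cong refl)
        (simp add: weak_div_mat_comb[OF x y z T] inner_add_right)
    also have "\<dots> = - (c * (\<integral>p. f p \<bullet> ?d x p \<partial>lebesgue_on T) + (\<integral>p. f p \<bullet> ?d y p \<partial>lebesgue_on T))"
      using i by simp
    finally show ?thesis by (simp add: elem_inner_def)
  qed
  then show ?thesis by (simp add: load_def sum.distrib sum_distrib_left)
qed

text \<open>Square integrability of \<open>g\<close> makes each product with a polynomial
  integrable, so that pairing with a component of \<open>g\<close> is a linear functional and the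
  projection exists. The result lifts the boundary data to polynomials.\<close>

lemma Q_b_poly:
  assumes e: "e \<in> Es" and g: "square_integrable (face_measure e) g"
  shows "\<exists>G. poly_fun k G \<and> Q_b k e g = restrict G e"
proof -
  interpret I: integration_support "face_measure e" e by (rule face_support[OF e])
  have gm: "g \<in> borel_measurable (face_measure e)" and g2: "integrable (face_measure e) (\<lambda>x. (norm (g x))\<^sup>2)"
    using g by (auto simp: square_integrable_def)
  have "L2_proj k e (\<lambda>y. g y $ i) \<in> poly_space k e" for i
  proof -
    have int: "integrable (face_measure e) (\<lambda>x. g x $ i * p x)" if p: "poly_fun k p" for p
    proof -
      have pc: "continuous_on e p" by (rule continuous_on_poly_fun[OF p])
      have p2: "integrable (face_measure e) (\<lambda>x. (p x)\<^sup>2)" by (intro I.integrable_cont continuous_intros pc)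
      have pm: "p \<in> borel_measurable (face_measure e)" using I.integrable_cont[OF pc] by simp
      have gi: "(\<lambda>x. g x $ i) \<in> borel_measurable (face_measure e)"
        using measurable_compose[OF gm borel_measurable_continuous_onI[OF linear_continuous_on[OF bounded_linear_vec_nth]]] .
      show ?thesis
      proof (rule Bochner_Integration.integrable_bound[OF Bochner_Integration.integrable_add[OF g2 p2]])
        show "(\<lambda>x. g x $ i * p x) \<in> borel_measurable (face_measure e)" using gi pm by measurable
        have "\<bar>g x $ i * p x\<bar> \<le> (norm (g x))\<^sup>2 + (p x)\<^sup>2" for x
        proof -
          have "\<bar>g x $ i * p x\<bar> \<le> norm (g x) * \<bar>p x\<bar>"
            unfolding abs_mult by (intro mult_right_mono component_le_norm_cart) simp
          also have "\<dots> \<le> (norm (g x))\<^sup>2 + (p x)\<^sup>2"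
            using mult_le_sum_squares[of "norm (g x)" "\<bar>p x\<bar>"] by simp
          finally show ?thesis .
        qed
        then show "AE x in face_measure e. norm (g x $ i * p x) \<le> norm ((norm (g x))\<^sup>2 + (p x)\<^sup>2)"
          by (intro AE_I2) (simp add: order_trans[OF _ abs_ge_self])
      qed
    qed
    have "\<exists>!q. q \<in> poly_space k e \<and> (\<forall>p. poly_fun k p \<longrightarrow> I.ip q p = face_inner e (\<lambda>y. g y $ i) p)"
    proof (rule I.riesz_poly_fun)
      show "face_inner e (\<lambda>y. g y $ i) (\<lambda>x. p x + q x) = face_inner e (\<lambda>y. g y $ i) p + face_inner e (\<lambda>y. g y $ i) q"
        if "poly_fun k p" "poly_fun k q" for p q
        using int that by (simp add: face_inner_def distrib_left)
      show "face_inner e (\<lambda>y. g y $ i) (\<lambda>x. c *\<^sub>R p x) = c * face_inner e (\<lambda>y. g y $ i) p"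
        if "poly_fun k p" for c p
        by (simp add: face_inner_def mult.left_commute)
      show "face_inner e (\<lambda>y. g y $ i) p = 0" if p: "poly_fun k p" "\<And>x. x \<in> e \<Longrightarrow> p x = 0" for p
        unfolding face_inner_def using I.AE_in by (intro integral_eq_zero_AE) (auto simp: p(2) elim!: eventually_mono)
    qed
    then have "\<exists>!q. q \<in> poly_space k e \<and> (\<forall>p. poly_fun k p \<longrightarrow> face_inner e q p = face_inner e (\<lambda>y. g y $ i) p)"
      by (simp only: face_inner_ip[OF e])
    from theI'[OF this] show ?thesis unfolding L2_proj_def by blast
  qed
  then have "\<forall>i. \<exists>p. poly_fun k p \<and> L2_proj k e (\<lambda>y. g y $ i) = restrict p e"
    unfolding poly_space_def by blast
  then obtain p where p: "\<And>i. poly_fun k (p i)" "\<And>i. L2_proj k e (\<lambda>y. g y $ i) = restrict (p i) e"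
    by metis
  have "poly_fun k (\<lambda>x. \<chi> i. p i x)" by (intro poly_fun_vector) (simp add: p)
  moreover have "Q_b k e g = restrict (\<lambda>x. \<chi> i. p i x) e"
    by (auto simp: Q_b_def p(2) intro!: restrict_ext)
  ultimately show ?thesis by blast
qed

text \<open>Representatives by polynomials on the whole space. They are closed under pointwise
  combinations, whereas \<open>weak_space\<close> fixes the value \<open>undefined\<close> off each
  element and face; \<open>restr\<close> leads back.\<close>

definition poly_weak :: "nat \<Rightarrow> ('d, 'v::euclidean_space) weak_fun \<Rightarrow> bool" where
  "poly_weak k v \<longleftrightarrow> (\<forall>T\<in>Ts. poly_fun k (fst v T)) \<and> (\<forall>e\<in>Es. poly_fun k (snd v e))"

definition restr :: "('d, 'v::euclidean_space) weak_fun \<Rightarrow> ('d, 'v) weak_fun" where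
  "restr v = (\<lambda>T\<in>Ts. restrict (fst v T) T, \<lambda>e\<in>Es. restrict (snd v e) e)"

lemma poly_weak_cont: "poly_weak k v \<Longrightarrow> weak_cont v"
  unfolding poly_weak_def weak_cont_def by (auto intro: continuous_on_poly_fun)

lemma poly_weak_comb:
  "poly_weak k v \<Longrightarrow> poly_weak k w \<Longrightarrow>
    poly_weak k (\<lambda>T x. c *\<^sub>R fst v T x + fst w T x, \<lambda>e x. c *\<^sub>R snd v e x + snd w e x)"
  unfolding poly_weak_def by (auto intro!: poly_fun_comb)

lemma restr_in_weak_space: "poly_weak k v \<Longrightarrow> restr v \<in> weak_space k Ts Es"
  unfolding restr_def weak_space_def poly_weak_def by (auto intro!: restrict_in_poly_space)

lemma weak_space_restr:
  assumes "v \<in> weak_space k Ts Es"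
  obtains w where "poly_weak k w" "v = restr w"
proof -
  have v: "fst v \<in> (\<Pi>\<^sub>E T\<in>Ts. poly_space k T)" "snd v \<in> (\<Pi>\<^sub>E e\<in>Es. poly_space k e)"
    using assms by (auto simp: weak_space_def)
  have "\<forall>T\<in>Ts. \<exists>p. poly_fun k p \<and> fst v T = restrict p T"
    using v(1) unfolding poly_space_def by blast
  then obtain P where P: "\<forall>T\<in>Ts. poly_fun k (P T) \<and> fst v T = restrict (P T) T" by metis
  have "\<forall>e\<in>Es. \<exists>p. poly_fun k p \<and> snd v e = restrict p e"
    using v(2) unfolding poly_space_def by blast
  then obtain Q where Q: "\<forall>e\<in>Es. poly_fun k (Q e) \<and> snd v e = restrict (Q e) e" by metis
  have "fst v = (\<lambda>T\<in>Ts. restrict (P T) T)" using v(1) P by (auto simp: fun_eq_iff PiE_def extensional_def)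
  moreover have "snd v = (\<lambda>e\<in>Es. restrict (Q e) e)" using v(2) Q by (auto simp: fun_eq_iff PiE_def extensional_def)
  ultimately have "v = restr (P, Q)" by (simp add: restr_def prod_eq_iff)
  moreover have "poly_weak k (P, Q)" using P Q by (simp add: poly_weak_def)
  ultimately show ?thesis using that by blast
qed

lemma restr_apply:
  "T \<in> Ts \<Longrightarrow> x \<in> T \<Longrightarrow> fst (restr v) T x = fst v T x"
  "e \<in> Es \<Longrightarrow> x \<in> e \<Longrightarrow> snd (restr v) e x = snd v e x"
  by (simp_all add: restr_def)

text \<open>With the factor 0, the combination lemmas become invariance lemmas: neither the form nor
  the load distinguishes \<open>v\<close> from \<open>restr v\<close>.\<close>

lemma is_comb_restr: "is_comb 0 v v (restr v)"
  by (simp add: is_comb_def restr_apply)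

lemma restr_cont: "weak_cont v \<Longrightarrow> weak_cont (restr v)"
  by (rule weak_cont_comb[OF _ _ is_comb_restr])

lemma lsform_restr:
  assumes "weak_cont (fst x)" "weak_cont (snd x)" "weak_cont (fst w)" "weak_cont (snd w)"
  shows "lsform k \<mu> lam (restr (fst x), restr (snd x)) w = lsform k \<mu> lam x w"
  using lsform_comb[OF assms(1,2,1,2), of 0 "(restr (fst x), restr (snd x))" w] assms(3,4)
  by (simp add: is_comb_restr)

lemma restr_eqI:
  assumes "\<And>T x. T \<in> Ts \<Longrightarrow> x \<in> T \<Longrightarrow> fst v T x = fst w T x" "\<And>e x. e \<in> Es \<Longrightarrow> x \<in> e \<Longrightarrow> snd v e x = snd w e x"
  shows "restr v = restr w"
  using assms by (auto simp: restr_def intro!: restrict_ext)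

text \<open>A finite-dimensional vector space of representatives. Entries outside the mesh are zero,
  and the homogeneous boundary condition is imposed by the zero polynomial on boundary
  faces.\<close>

definition test_space ::
    "nat \<Rightarrow> (('d, real^'d) weak_fun \<times> ('d, real^'d^'d) weak_fun) set" where
  "test_space k =
    ({p. (\<forall>T\<in>Ts. p T \<in> {p. poly_fun k p}) \<and> (\<forall>T. T \<notin> Ts \<longrightarrow> p T = 0)} \<times>
     {q. (\<forall>e\<in>Es - boundary_faces \<Omega> Es. q e \<in> {p. poly_fun k p}) \<and> (\<forall>e. e \<notin> Es - boundary_faces \<Omega> Es \<longrightarrow> q e = 0)}) \<times>
    ({p. (\<forall>T\<in>Ts. p T \<in> {p. poly_fun k p}) \<and> (\<forall>T. T \<notin> Ts \<longrightarrow> p T = 0)} \<times>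
     {q. (\<forall>e\<in>Es. q e \<in> {p. poly_fun k p}) \<and> (\<forall>e. e \<notin> Es \<longrightarrow> q e = 0)})"

lemma subspace_test_space: "subspace (test_space k)"
  unfolding test_space_def by (intro subspace_Times subspace_PiE_zero subspace_poly_fun)

lemma fin_dim_test_space: "fin_dim (test_space k)"
  unfolding test_space_def
  by (intro fin_dim_Times fin_dim_PiE_zero fin_dim_poly_fun finite_Ts finite_Es finite_Diff)

lemma test_space_poly_weak:
  assumes "x \<in> test_space k"
  shows "poly_weak k (fst x)" "poly_weak k (snd x)"
    "e \<in> boundary_faces \<Omega> Es \<Longrightarrow> snd (fst x) e = 0"
proof -
  have "poly_fun k (snd (fst x) e)" if "e \<in> Es" for e
  proof (cases "e \<in> boundary_faces \<Omega> Es")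
    case True
    then have "snd (fst x) e = 0" using assms by (auto simp: test_space_def)
    then show ?thesis using poly_fun_zero[of k] by (simp add: zero_fun_def)
  next
    case False
    then show ?thesis using assms that by (auto simp: test_space_def)
  qed
  then show "poly_weak k (fst x)" "poly_weak k (snd x)"
    "e \<in> boundary_faces \<Omega> Es \<Longrightarrow> snd (fst x) e = 0"
    using assms by (auto simp: test_space_def poly_weak_def)
qed

lemma test_space_cont:
  assumes "x \<in> test_space k"
  shows "weak_cont (fst x)" "weak_cont (snd x)"
  by (rule poly_weak_cont[OF test_space_poly_weak(1)[OF assms]] poly_weak_cont[OF test_space_poly_weak(2)[OF assms]])+

text \<open>A representative on a boundary face need only vanish on that face; replacing it by the
  zero polynomial does not change the restriction.\<close>

lemma test_space_restr:
  assumes v: "v \<in> W_h0 k \<Omega> Ts Es" and \<delta>: "\<delta> \<in> V_h k Ts Es"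
  obtains w where "w \<in> test_space k" "v = restr (fst w)" "\<delta> = restr (snd w)"
proof -
  have "v \<in> weak_space k Ts Es" using v by (simp add: W_h0_def W_h_def)
  then obtain a where a: "poly_weak k a" "v = restr a" by (rule weak_space_restr)
  have "\<delta> \<in> weak_space k Ts Es" using \<delta> by (simp add: V_h_def)
  then obtain b where b: "poly_weak k b" "\<delta> = restr b" by (rule weak_space_restr)
  have bd: "snd v e x = 0" if "e \<in> boundary_faces \<Omega> Es" "x \<in> e" for e x using v that by (simp add: W_h0_def)
  define a' where "a' = (\<lambda>T. if T \<in> Ts then fst a T else 0, \<lambda>e. if e \<in> Es - boundary_faces \<Omega> Es then snd a e else 0)"
  define b' where "b' = (\<lambda>T. if T \<in> Ts then fst b T else 0, \<lambda>e. if e \<in> Es then snd b e else 0)"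
  have "restr a' = restr a"
  proof (rule restr_eqI)
    show "snd a' e x = snd a e x" if e: "e \<in> Es" "x \<in> e" for e x
      using bd[of e x] restr_apply(2)[OF e, of a] e a(2) by (auto simp: a'_def)
  qed (simp add: a'_def)
  moreover have "restr b' = restr b" by (rule restr_eqI) (simp_all add: b'_def)
  moreover have "(a', b') \<in> test_space k"
    using a(1) b(1) by (auto simp: test_space_def a'_def b'_def poly_weak_def)
  ultimately show ?thesis using that[of "(a', b')"] a b by simp
qed

lemma lsform_test_restr:
  assumes "weak_cont (fst x)" "weak_cont (snd x)" "w \<in> test_space k"
  shows "lsform k \<mu> lam x (restr (fst w), restr (snd w)) = lsform k \<mu> lam x w"
  unfolding lsform_commute[of k \<mu> lam x]
  by (rule lsform_restr[OF test_space_cont[OF assms(3)] assms(1,2)])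

text \<open>The boundary values of two solutions coincide, so their difference is an admissible test
  pair. Tested with itself it has zero energy, and functions equal on elements and faces are equal
  after \<open>restr\<close>.\<close>

lemma unique_solution:
  assumes \<mu>: "\<mu> > 0" and lam: "lam \<ge> 0"
    and s: "lswg_solution k \<Omega> Ts Es \<mu> lam f g u \<sigma>" and s': "lswg_solution k \<Omega> Ts Es \<mu> lam f g u' \<sigma>'"
  shows "u = u' \<and> \<sigma> = \<sigma>'"
proof -
  obtain a where a: "poly_weak k a" "u = restr a"
    using s weak_space_restr unfolding lswg_solution_def W_h_def by metis
  obtain a' where a': "poly_weak k a'" "u' = restr a'"
    using s' weak_space_restr unfolding lswg_solution_def W_h_def by metis
  obtain b where b: "poly_weak k b" "\<sigma> = restr b"
    using s weak_space_restr unfolding lswg_solution_def V_h_def by metis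
  obtain b' where b': "poly_weak k b'" "\<sigma>' = restr b'"
    using s' weak_space_restr unfolding lswg_solution_def V_h_def by metis
  define da where "da = (\<lambda>T x. (-1) *\<^sub>R fst a' T x + fst a T x, \<lambda>e x. (-1) *\<^sub>R snd a' e x + snd a e x)"
  define db where "db = (\<lambda>T x. (-1) *\<^sub>R fst b' T x + fst b T x, \<lambda>e x. (-1) *\<^sub>R snd b' e x + snd b e x)"
  have dp: "poly_weak k da" "poly_weak k db"
    unfolding da_def db_def by (rule poly_weak_comb[OF a'(1) a(1)] poly_weak_comb[OF b'(1) b(1)])+
  define v \<delta> where "v = restr da" and "\<delta> = restr db"
  have comb: "is_comb (-1) u' u v" "is_comb (-1) \<sigma>' \<sigma> \<delta>"
    by (auto simp: is_comb_def v_def \<delta>_def a a' b b' restr_apply da_def db_def)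
  have cont: "weak_cont u" "weak_cont u'" "weak_cont \<sigma>" "weak_cont \<sigma>'" "weak_cont v" "weak_cont \<delta>"
    unfolding v_def \<delta>_def a(2) a'(2) b(2) b'(2)
    by (rule restr_cont[OF poly_weak_cont], fact a(1) a'(1) b(1) b'(1) dp)+
  have bd: "snd v e x = 0" if e: "e \<in> boundary_faces \<Omega> Es" "x \<in> e" for e x
  proof -
    have "e \<in> Es" using e by (simp add: boundary_faces_def)
    moreover have "snd u e = snd u' e" using s s' e unfolding lswg_solution_def by simp
    ultimately show ?thesis using is_combD(2)[OF comb(1) _ e(2)] by simp
  qed
  have v: "v \<in> W_h0 k \<Omega> Ts Es" and \<delta>: "\<delta> \<in> V_h k Ts Es"
    using bd dp by (auto simp: W_h0_def W_h_def V_h_def v_def \<delta>_def restr_in_weak_space)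
  have "lsform k \<mu> lam (u, \<sigma>) (v, \<delta>) = lsform k \<mu> lam (u', \<sigma>') (v, \<delta>)"
    using s s' v \<delta> unfolding lswg_solution_def lsform_def by simp
  moreover have "lsform k \<mu> lam (v, \<delta>) (v, \<delta>) = (-1) * lsform k \<mu> lam (u', \<sigma>') (v, \<delta>) + lsform k \<mu> lam (u, \<sigma>) (v, \<delta>)"
    by (rule lsform_comb) (use cont comb in simp_all)
  ultimately have z: "lsform k \<mu> lam (v, \<delta>) (v, \<delta>) = 0" by simp
  have vU: "poly_fun k (fst da T)" "x \<in> T \<Longrightarrow> fst v T x = fst da T x" if "T \<in> Ts" for T x
    using dp(1) that by (auto simp: poly_weak_def v_def restr_apply)
  note def = lsform_definite[OF \<mu> lam cont(5,6) vU bd z]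
  have "restr a = restr a'" "restr b = restr b'"
    using def restr_apply[of _ _ da] restr_apply[of _ _ db]
    by (auto intro!: restr_eqI simp: v_def \<delta>_def da_def db_def)
  then show ?thesis by (simp add: a a' b b')
qed

text \<open>The boundary data are lifted to \<open>xg\<close> and the remainder \<open>z\<close> is
  sought in the linear test space, with the load reduced by the form at \<open>xg\<close>. That the
  functional kills null vectors is \<open>lsform_definite\<close>.\<close>

lemma solution_exists:
  assumes lip: "lipschitz_domain \<Omega>" and \<mu>: "\<mu> > 0" and lam: "lam \<ge> 0"
    and f: "square_integrable (lebesgue_on \<Omega>) f"
    and g: "\<forall>e\<in>boundary_faces \<Omega> Es. square_integrable (face_measure e) g"
  shows "\<exists>u \<sigma>. lswg_solution k \<Omega> Ts Es \<mu> lam f g u \<sigma>"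
proof -
  have "\<forall>e\<in>boundary_faces \<Omega> Es. \<exists>G. poly_fun k G \<and> Q_b k e g = restrict G e"
    using Q_b_poly g by (auto simp: boundary_faces_def)
  then obtain G where G: "\<forall>e\<in>boundary_faces \<Omega> Es. poly_fun k (G e) \<and> Q_b k e g = restrict (G e) e" by metis
  define ug :: "('d, real^'d) weak_fun" where
    \<comment> \<open>The lift is zero in the elements and on interior faces; weak functions require
      no matching of traces.\<close>
    "ug = (\<lambda>T x. 0, \<lambda>e. if e \<in> boundary_faces \<Omega> Es then G e else (\<lambda>x. 0))"
  define xg where "xg = (ug, (\<lambda>T x. 0, \<lambda>e x. 0) :: ('d, real^'d^'d) weak_fun)"
  have pg: "poly_weak k (fst xg)" "poly_weak k (snd xg)"
    using G by (auto simp: xg_def ug_def poly_weak_def poly_fun_zero)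
  note cg = poly_weak_cont[OF pg(1)] poly_weak_cont[OF pg(2)]
  define V where "V = test_space k"
  have cV: "weak_cont (fst x)" "weak_cont (snd x)" if "x \<in> V" for x
    using test_space_cont[OF that[unfolded V_def]] .
  define L where "L = (\<lambda>w. load k f w - lsform k \<mu> lam xg w)"
  have L_comb: "L z = c * L x + L y"
    if "x \<in> V" "y \<in> V" "is_comb c (fst x) (fst y) (fst z)" "is_comb c (snd x) (snd y) (snd z)" for c x y z
  proof -
    have "load k f z = c * load k f x + load k f y"
      by (rule load_comb[OF lip f]) (use that cV in auto)
    moreover have "lsform k \<mu> lam z xg = c * lsform k \<mu> lam x xg + lsform k \<mu> lam y xg"
      by (rule lsform_comb) (use that cV cg in auto)
    ultimately show ?thesis by (simp add: L_def lsform_commute[of k \<mu> lam xg] algebra_simps)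
  qed
  \<comment> \<open>A multiple of \<open>x\<close> is written as
    \<open>(c - 1) *\<^sub>R x + x\<close>, so that homogeneity too is an instance of the
    combination lemmas.\<close>
  have add: "is_comb 1 (fst x) (fst y) (fst (x + y))" "is_comb 1 (snd x) (snd y) (snd (x + y))"
    and scale: "is_comb (c - 1) (fst x) (fst x) (fst (c *\<^sub>R x))" "is_comb (c - 1) (snd x) (snd x) (snd (c *\<^sub>R x))"
    for c and x y :: "('d, real^'d) weak_fun \<times> ('d, real^'d^'d) weak_fun"
    by (simp_all add: is_comb_def algebra_simps)
  obtain S where S: "finite S" "span S = V"
    using fin_dim_subspaceE[OF fin_dim_test_space subspace_test_space] unfolding V_def by blast
  have "\<exists>c\<in>span S. \<forall>y\<in>span S. lsform k \<mu> lam c y = L y"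
  proof (rule riesz_semidefinite)
    show "subspace V" unfolding V_def by (rule subspace_test_space)
    show "finite S" "S \<subseteq> V" using S span_superset by auto
    show "lsform k \<mu> lam (x + y) z = lsform k \<mu> lam x z + lsform k \<mu> lam y z" if "x \<in> V" "y \<in> V" "z \<in> V" for x y z
      using lsform_comb[OF cV[OF that(1)] cV[OF that(2)] add cV[OF that(3)]] by simp
    show "lsform k \<mu> lam (c *\<^sub>R x) z = c * lsform k \<mu> lam x z" if "x \<in> V" "z \<in> V" for c x z
      using lsform_comb[OF cV[OF that(1)] cV[OF that(1)] scale cV[OF that(2)]] by (simp add: algebra_simps)
    show "L (x + y) = L x + L y" if "x \<in> V" "y \<in> V" for x y using L_comb[OF that add] by simp
    show "L (c *\<^sub>R x) = c * L x" if "x \<in> V" for c x using L_comb[OF that that scale] by (simp add: algebra_simps)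
    show "L x = 0" if x: "x \<in> V" "lsform k \<mu> lam x x = 0" for x
    proof -
      have z: "lsform k \<mu> lam (fst x, snd x) (fst x, snd x) = 0" using x(2) by simp
      have p: "poly_fun k (fst (fst x) T)" "y \<in> T \<Longrightarrow> fst (fst x) T y = fst (fst x) T y" if "T \<in> Ts" for T y
        using test_space_poly_weak(1)[OF x(1)[unfolded V_def]] that by (auto simp: poly_weak_def)
      have b: "snd (fst x) e y = 0" if "e \<in> boundary_faces \<Omega> Es" for e y
        using test_space_poly_weak(3)[OF x(1)[unfolded V_def] that] by simp
      note def = lsform_definite[OF \<mu> lam cV[OF x(1)] p b z]
      \<comment> \<open>As \<open>x\<close> vanishes on all elements and faces, it is there equal to
        \<open>(-1) *\<^sub>R x + x\<close>, and hence \<open>L x = - L x + L x\<close>.\<close>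
      have "is_comb (-1) (fst x) (fst x) (fst x)" "is_comb (-1) (snd x) (snd x) (snd x)"
        using def by (auto simp: is_comb_def)
      then show ?thesis using L_comb[OF x(1) x(1)] by fastforce
    qed
  qed (rule lsform_commute lsform_nonneg)+
  then obtain z where z: "z \<in> V" "\<And>w. w \<in> V \<Longrightarrow> lsform k \<mu> lam z w = L w" unfolding S(2) by (elim bexE) simp
  define y where "y = (z + xg :: ('d, real^'d) weak_fun \<times> ('d, real^'d^'d) weak_fun)"
  have py: "poly_weak k (fst y)" "poly_weak k (snd y)"
    using test_space_poly_weak[OF z(1)[unfolded V_def]] pg
    by (auto simp: y_def poly_weak_def plus_fun_def intro!: poly_fun_add)
  note cy = poly_weak_cont[OF py(1)] poly_weak_cont[OF py(2)]
  have yw: "lsform k \<mu> lam y w = load k f w" if w: "w \<in> V" for w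
  proof -
    have "lsform k \<mu> lam y w = 1 * lsform k \<mu> lam z w + lsform k \<mu> lam xg w"
      unfolding y_def by (rule lsform_comb[OF cV[OF z(1)] cg add cV[OF w]])
    then show ?thesis using z(2)[OF w] by (simp add: L_def)
  qed
  have "lswg_solution k \<Omega> Ts Es \<mu> lam f g (restr (fst y)) (restr (snd y))"
    unfolding lswg_solution_def
  proof (intro conjI ballI)
    show "restr (fst y) \<in> W_h k Ts Es" "restr (snd y) \<in> V_h k Ts Es"
      unfolding W_h_def V_h_def by (rule restr_in_weak_space py)+
    show "snd (restr (fst y)) e = Q_b k e g" if e: "e \<in> boundary_faces \<Omega> Es" for e
    proof -
      have "snd (fst z) e = 0" using test_space_poly_weak(3)[OF z(1)[unfolded V_def] e] .
      then have "snd (fst y) e = G e" using e by (simp add: y_def xg_def ug_def)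
      moreover have "e \<in> Es" using e by (simp add: boundary_faces_def)
      ultimately show ?thesis using G e by (simp add: restr_def)
    qed
    fix v \<delta> assume "v \<in> W_h0 k \<Omega> Ts Es" "\<delta> \<in> V_h k Ts Es"
    then obtain w where w: "w \<in> V" "v = restr (fst w)" "\<delta> = restr (snd w)"
      unfolding V_def by (rule test_space_restr)
    have "lsform k \<mu> lam (restr (fst y), restr (snd y)) (v, \<delta>) = lsform k \<mu> lam y (v, \<delta>)"
      using cV[OF w(1)] w(2,3) by (intro lsform_restr cy) (auto intro: restr_cont)
    also have "\<dots> = load k f w"
      unfolding w(2,3) using lsform_test_restr[OF cy, of w k \<mu> lam] yw[OF w(1)] w(1) by (simp add: V_def)
    also have "\<dots> = load k f (v, \<delta>)"
      using load_comb[OF lip f cV(2)[OF w(1)] cV(2)[OF w(1)], of 0 "(v, \<delta>)"] w(3)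
      by (simp add: is_comb_restr)
    finally show "a_form k Ts Es \<mu> lam (restr (fst y)) v (restr (snd y)) \<delta> +
        stabilizer Ts Es (restr (fst y)) v + stabilizer Ts Es (restr (snd y)) \<delta> =
        (\<Sum>T\<in>Ts. elem_inner T (\<lambda>x. - f x) (weak_div_mat k Es \<delta> T))"
      by (simp add: lsform_def load_def)
  qed
  then show ?thesis by blast
qed

end

theorem theorem3p1:
  fixes \<Omega> :: "(real^'d) set"
    and Ts Es :: "(real^'d) set set"
    and k N :: nat
    and \<mu> lam \<rho>\<^sub>v \<rho>\<^sub>e \<kappa> \<sigma>\<^sub>s \<theta>\<^sub>0 \<gamma>\<^sub>s \<rho>\<^sub>S :: real
    and f g :: "real^'d \<Rightarrow> real^'d"
  assumes "CARD('d) = 2 \<or> CARD('d) = 3"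
    and "k \<ge> 1"
    and "lipschitz_domain \<Omega>"
    and "polytopal_mesh \<Omega> Ts Es"
    and "shape_regular \<rho>\<^sub>v \<rho>\<^sub>e \<kappa> \<sigma>\<^sub>s \<theta>\<^sub>0 \<gamma>\<^sub>s \<rho>\<^sub>S N Ts Es"
    and "\<mu> > 0" and "lam \<ge> 0"
    and "square_integrable (lebesgue_on \<Omega>) f"
    and "\<forall>e\<in>boundary_faces \<Omega> Es. square_integrable (face_measure e) g"
  shows "\<exists>!(u, \<sigma>). lswg_solution k \<Omega> Ts Es \<mu> lam f g u \<sigma>"
proof -
  interpret regular_mesh \<Omega> Ts Es \<rho>\<^sub>v \<rho>\<^sub>e \<kappa> \<sigma>\<^sub>s \<theta>\<^sub>0 \<gamma>\<^sub>s \<rho>\<^sub>S N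
    using assms(1,4,5) by (rule regular_mesh.intro)
  obtain u \<sigma> where "lswg_solution k \<Omega> Ts Es \<mu> lam f g u \<sigma>"
    using solution_exists[OF assms(3,6,7,8,9)] by blast
  moreover have "x = (u, \<sigma>)" if "case x of (u, \<sigma>) \<Rightarrow> lswg_solution k \<Omega> Ts Es \<mu> lam f g u \<sigma>" for x
    using unique_solution[OF assms(6,7) _ calculation] that by (cases x) simp
  ultimately show ?thesis by (intro ex1I[of _ "(u, \<sigma>)"]) simp_all
qed

end
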